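(* Let $\mathbf U_h^C\in\mathbb W_h^{C,k}$ and $\mathbf U_h^D\in\mathbb W_h^{D,k}$ (locally divergence-free piecewise polynomials of total degree at most $k$ on the primal and dual meshes). Assume that $\overline{\mathbf U}_{ij}^C\in G$ and $\overline{\mathbf U}_{i+\frac12,j+\frac12}^D\in G$ for all $i,j$, and that $$\mathbf U_h^C(x,y)\in G,\qquad \mathbf U_h^D(x,y)\in G\qquad\forall (x,y)\in\bigcup_{i,j}\mathbb Q_{ij},\qquad \mathbb Q_{ij}:=(\mathbb Q_i^x\otimes\hat{\mathbb Q}_j^y)\cup(\hat{\mathbb Q}_i^x\otimes\mathbb Q_j^y).$$ Let $a_\ell=\max\{\hat a_\ell,\beta_\ell\}$, $\ell=1,2$, and let $\Delta t>0$, $\tau_{\max}>0$ satisfy the CFL condition $$\frac{a_1\Delta t}{\Delta x}+\frac{a_2\Delta t}{\Delta y}<\frac{\theta\hat\omega_1}{2},\qquad\theta=\frac{\Delta t}{\tau_{\max}}\in(0,1].$$ Then the new locally divergence-free central DG method is positivity-preserving, namely for all $i,j$, $$\overline{\mathbf U}_{ij}^C+\Delta t\,\mathcal L_{ij}^{\rm new}(\mathbf U_h^C,\mathbf U_h^D)\in G,\qquad \overline{\mathbf U}_{i+\frac12,j+\frac12}^D+\Delta t\,\mathcal L_{i+\frac12,j+\frac12}^{\rm new}(\mathbf U_h^D,\mathbf U_h^C)\in G .$$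
   Context: **Ideal MHD.** States are $\mathbf U=(\rho,\mathbf m,\mathbf B,E)^\top\in\mathbb R^8$ with $\mathbf m,\mathbf B\in\mathbb R^3$. Put $\mathbf v=\mathbf m/\rho$, $\mathcal E(\mathbf U)=E-\frac{|\mathbf m|^2}{2\rho}-\frac{|\mathbf B|^2}{2}=\rho e$ (this defines the specific internal energy $e$), and $p=p(\rho,e)$ given by an equation of state for which $p>0\Leftrightarrow e>0$ (when $\rho>0$). The flux in direction $\ell$ is $$\mathbf F_\ell(\mathbf U)=\Big(\rho v_\ell,\ v_\ell\mathbf m-B_\ell\mathbf B+(p+\tfrac12|\mathbf B|^2)\mathbf e_\ell,\ v_\ell\mathbf B-B_\ell\mathbf v,\ v_\ell(E+p+\tfrac12|\mathbf B|^2)-B_\ell(\mathbf v\cdot\mathbf B)\Big)^\top,$$ with $\mathbf e_\ell$ the $\ell$th column of the $3\times3$ identity matrix, and $\mathbf S(\mathbf U)=(0,\mathbf B,\mathbf v,\mathbf v\cdot\mathbf B)^\top$. (The method discretizes the modified system $\mathbf U_t+\nabla\cdot\mathbf F(\mathbf U)=(-\nabla\cdot\mathbf B)\,\mathbf S(\mathbf U)$.) The admissible set is $G=\{\mathbf U:\rho>0,\ \mathcal E(\mathbf U)>0\}$. **Wave speed bound.** For $\mathbf U,\tilde{\mathbf U}\in G$ (tilde denotes quantities of $\tilde{\mathbf U}$), $$\alpha_\ell(\mathbf U,\tilde{\mathbf U})=\max\Big\{|v_\ell|+\mathcal C_\ell,\ |\tilde v_\ell|+\tilde{\mathcal C}_\ell,\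 \frac{|\sqrt\rho v_\ell+\sqrt{\tilde\rho}\tilde v_\ell|}{\sqrt\rho+\sqrt{\tilde\rho}}+\max\{\mathcal C_\ell,\tilde{\mathcal C}_\ell\}\Big\}+\frac{|\mathbf B-\tilde{\mathbf B}|}{\sqrt\rho+\sqrt{\tilde\rho}},$$ $$\mathcal C_\ell=\frac1{\sqrt2}\Big[\frac{|\mathbf B|^2}{\rho}+\mathcal C_s^2+\sqrt{\big(\tfrac{|\mathbf B|^2}{\rho}+\mathcal C_s^2\big)^2-4\tfrac{B_\ell^2\mathcal C_s^2}{\rho}}\Big]^{1/2},\qquad \mathcal C_s=\frac{p}{\rho\sqrt{2e}} .$$ **Meshes and spaces.** A rectangle is covered by two overlapping uniform meshes with step sizes $\Delta x,\Delta y$: primal cells $I_{i,j}=(x_{i-\frac12},x_{i+\frac12})\times(y_{j-\frac12},y_{j+\frac12})$ with center $(x_i,y_j)$, and dual cells $I_{i+\frac12,j+\frac12}=(x_i,x_{i+1})\times(y_j,y_{j+1})$. Indices $i,j$ range over all mesh indices; values needed beyond the boundary are supplied by boundary conditions and subject to the same hypotheses. $\mathbb W_h^{C,k}$ is the space of $\mathbb R^8$-valued functions $\mathbf w=(w_1,\dots,w_8)$ whose components are polynomials of total degree at most $k$ on each primal cell and such that $\partial_xw_5+\partial_yw_6=0$ in each primal cell; $\mathbb W_h^{D,k}$ is the analogous space on the dual cells. (Components 5, 6, 7 are $B_1,B_2,B_3$.) $\rho_h^\star$, $B_{1,h}^\star$, $B_{2,h}^\star$ denote the corresponding components of $\mathbf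 U_h^\star$, $\star\in\{C,D\}$; $\overline{\mathbf U}^\star_{ij}$ and $\overline{\mathbf U}^\star_{i+\frac12,j+\frac12}$ denote the averages of $\mathbf U_h^\star$ over $I_{i,j}$ and $I_{i+\frac12,j+\frac12}$. **Jumps and averages.** At a point of a mesh interface, $\llbracket\cdot\rrbracket$ is the limit from the right (resp. above) minus the limit from the left (resp. below), and $\langle\!\langle\cdot\rangle\!\rangle$ is the arithmetic mean of the two limits; e.g. $\llbracket B_{1,h}^D(x_i,y)\rrbracket=B_{1,h}^D(x_i^+,y)-B_{1,h}^D(x_i^-,y)$, $\langle\!\langle\mathbf U_h^D(x,y_j)\rangle\!\rangle=\frac12(\mathbf U_h^D(x,y_j^-)+\mathbf U_h^D(x,y_j^+))$. **Quadrature.** Let $N=k+1$, $L=\lceil\frac{k+3}2\rceil$. $\{x_{i\pm\frac14}^{(\mu)}\}_{\mu=1}^N$ are the $N$-point Gauss nodes on the half-intervals: subscript $i-\frac14$ refers to $[x_{i-\frac12},x_i]$, subscript $i+\frac14$ to $[x_i,x_{i+\frac12}]$; weights $\omega_\mu$, $\sum_\mu\omega_\mu=1$; $\mathbb Q_i^x$ is the union of these two node sets. $\{\hat x_{i\pm\frac14}^{(\nu)}\}_{\nu=1}^L$ are the $L$-point Gauss–Lobatto nodes (endpoints included) on the same half-intervals; weights $\hat\omega_\nu$, $\sum_\nu\hat\omega_\nu=1$; $\hat{\mathbb Q}_i^x$ is the union. The sets $\mathbb Q_j^y,\hat{\mathbb Q}_j^y$ and nodes $y_{j\pm\frac14}^{(\mu)}$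 are defined likewise. The same convention is used for shifted subscripts (e.g. $i+\frac12\pm\frac14$ refers to $[x_i,x_{i+\frac12}]$ and $[x_{i+\frac12},x_{i+1}]$). At nodes where a piecewise polynomial is discontinuous, its value is the one-sided limit from within the half-interval to which the node belongs (both limits, if it belongs to both). **Scheme (cell averages).** $\mathcal L_{ij}^{\rm new}=\mathcal L_{ij}+\mathcal S_{ij}^D$ and $\mathcal L_{i+\frac12,j+\frac12}^{\rm new}=\mathcal L_{i+\frac12,j+\frac12}+\mathcal S_{i+\frac12,j+\frac12}^C$, where $$\mathcal L_{ij}(\mathbf U_h^C,\mathbf U_h^D)=\frac{\overline{\mathbf U}_{ij}^D-\overline{\mathbf U}_{ij}^C}{\tau_{\max}}-\frac1{\Delta x}\sum_{\sigma=\pm1}\sum_{\mu=1}^N\frac{\omega_\mu}2\Big(\mathbf F_1(\mathbf U_h^D(x_{i+\frac12},y_{j+\frac\sigma4}^{(\mu)}))-\mathbf F_1(\mathbf U_h^D(x_{i-\frac12},y_{j+\frac\sigma4}^{(\mu)}))\Big)$$ $$\qquad-\frac1{\Delta y}\sum_{\sigma=\pm1}\sum_{\mu=1}^N\frac{\omega_\mu}2\Big(\mathbf F_2(\mathbf U_h^D(x_{i+\frac\sigma4}^{(\mu)},y_{j+\frac12}))-\mathbf F_2(\mathbf U_h^D(x_{i+\frac\sigma4}^{(\mu)},y_{j-\frac12}))\Big),$$ $$\mathcal S_{ij}^D=-\sum_{\sigma=\pm1}\sum_{\mu=1}^N\frac{\omega_\mu}2\bigg(\frac{\llbracket B_{1,h}^D(x_i,y_{j+\frac\sigma4}^{(\mu)})\rrbracket}{\Delta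 x}\,\mathbf S\big(\langle\!\langle\mathbf U_h^D(x_i,y_{j+\frac\sigma4}^{(\mu)})\rangle\!\rangle\big)+\frac{\llbracket B_{2,h}^D(x_{i+\frac\sigma4}^{(\mu)},y_j)\rrbracket}{\Delta y}\,\mathbf S\big(\langle\!\langle\mathbf U_h^D(x_{i+\frac\sigma4}^{(\mu)},y_j)\rangle\!\rangle\big)\bigg),$$ and $\mathcal L_{i+\frac12,j+\frac12}(\mathbf U_h^D,\mathbf U_h^C)$, $\mathcal S_{i+\frac12,j+\frac12}^C$ are the same expressions with the roles of $C$ and $D$ exchanged and $i,j$ replaced by $i+\frac12,j+\frac12$ everywhere. **Wave speeds.** $$\hat a_1=\max_{i,j}\max_{y\in\mathbb Q_j^y}\big\{\alpha_1(\mathbf U_h^C(x_{i+1},y),\mathbf U_h^C(x_i,y)),\ \alpha_1(\mathbf U_h^D(x_{i+\frac12},y),\mathbf U_h^D(x_{i-\frac12},y))\big\},$$ $$\hat a_2=\max_{i,j}\max_{x\in\mathbb Q_i^x}\big\{\alpha_2(\mathbf U_h^C(x,y_{j+1}),\mathbf U_h^C(x,y_j)),\ \alpha_2(\mathbf U_h^D(x,y_{j+\frac12}),\mathbf U_h^D(x,y_{j-\frac12}))\big\},$$ $$\beta_1=\max_{i,j,\mu,\sigma}\left\{\frac{|\llbracket B_{1,h}^D(x_i,y_{j+\frac\sigma4}^{(\mu)})\rrbracket|}{2\sqrt{\langle\!\langle\rho_h^D(x_i,y_{j+\frac\sigma4}^{(\mu)})\rangle\!\rangle}},\ \frac{|\llbracket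 B_{1,h}^C(x_{i+\frac12},y_{j+\frac12+\frac\sigma4}^{(\mu)})\rrbracket|}{2\sqrt{\langle\!\langle\rho_h^C(x_{i+\frac12},y_{j+\frac12+\frac\sigma4}^{(\mu)})\rangle\!\rangle}}\right\},$$ $$\beta_2=\max_{i,j,\mu,\sigma}\left\{\frac{|\llbracket B_{2,h}^D(x_{i+\frac\sigma4}^{(\mu)},y_j)\rrbracket|}{2\sqrt{\langle\!\langle\rho_h^D(x_{i+\frac\sigma4}^{(\mu)},y_j)\rangle\!\rangle}},\ \frac{|\llbracket B_{2,h}^C(x_{i+\frac12+\frac\sigma4}^{(\mu)},y_{j+\frac12})\rrbracket|}{2\sqrt{\langle\!\langle\rho_h^C(x_{i+\frac12+\frac\sigma4}^{(\mu)},y_{j+\frac12})\rangle\!\rangle}}\right\}.$$ *)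

theory Defs
  imports "HOL-Analysis.Analysis" "HOL-Computational_Algebra.Polynomial"
begin

section \<open>Ideal MHD\<close>

text \<open>States \<open>(\<rho>, m, B, E)\<close>; as a vector of \<open>\<real>\<^sup>8\<close>, components 2--4 are \<open>m\<close> and 5--7 are \<open>B\<close>.\<close>

type_synonym state = "real \<times> (real^3) \<times> (real^3) \<times> real"

definition rho :: "state \<Rightarrow> real" where "rho U = fst U"
definition mom :: "state \<Rightarrow> real^3" where "mom U = fst (snd U)"
definition mag :: "state \<Rightarrow> real^3" where "mag U = fst (snd (snd U))"
definition toten :: "state \<Rightarrow> real" where "toten U = snd (snd (snd U))"

definition vel :: "state \<Rightarrow> real^3" where
  "vel U = mom U /\<^sub>R rho U"

definition internal_energy :: "state \<Rightarrow> real" where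
  "internal_energy U = toten U - (norm (mom U))\<^sup>2 / (2 * rho U) - (norm (mag U))\<^sup>2 / 2"

definition spec_energy :: "state \<Rightarrow> real" where
  "spec_energy U = internal_energy U / rho U"

text \<open>An equation of state is a function \<open>p \<rho> e\<close> of density and specific internal energy.\<close>

definition equation_of_state :: "(real \<Rightarrow> real \<Rightarrow> real) \<Rightarrow> bool" where
  "equation_of_state p \<longleftrightarrow> (\<forall>\<rho> e. \<rho> > 0 \<longrightarrow> (p \<rho> e > 0 \<longleftrightarrow> e > 0))"

definition pressure :: "(real \<Rightarrow> real \<Rightarrow> real) \<Rightarrow> state \<Rightarrow> real" where
  "pressure p U = p (rho U) (spec_energy U)"

definition admissible :: "state set" where
  "admissible = {U. rho U > 0 \<and> internal_energy U > 0}"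

definition flux :: "(real \<Rightarrow> real \<Rightarrow> real) \<Rightarrow> 3 \<Rightarrow> state \<Rightarrow> state" where
  "flux p l U =
    (let v = vel U; B = mag U; ptot = pressure p U + (norm B)\<^sup>2 / 2 in
     (rho U * v $ l,
      (v $ l) *\<^sub>R mom U - (B $ l) *\<^sub>R B + ptot *\<^sub>R axis l 1,
      (v $ l) *\<^sub>R B - (B $ l) *\<^sub>R v,
      v $ l * (toten U + ptot) - B $ l * (v \<bullet> B)))"

definition source :: "state \<Rightarrow> state" where
  "source U = (0, mag U, vel U, vel U \<bullet> mag U)"

definition sound_speed :: "(real \<Rightarrow> real \<Rightarrow> real) \<Rightarrow> state \<Rightarrow> real" where
  "sound_speed p U = pressure p U / (rho U * sqrt (2 * spec_energy U))"

definition char_speed :: "(real \<Rightarrow> real \<Rightarrow> real) \<Rightarrow> 3 \<Rightarrow> state \<Rightarrow> real" where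
  "char_speed p l U =
    (let b = (norm (mag U))\<^sup>2 / rho U; c = (sound_speed p U)\<^sup>2 in
     1 / sqrt 2 * sqrt (b + c + sqrt ((b + c)\<^sup>2 - 4 * ((mag U $ l)\<^sup>2 * c / rho U))))"

definition wave_bound :: "(real \<Rightarrow> real \<Rightarrow> real) \<Rightarrow> 3 \<Rightarrow> state \<Rightarrow> state \<Rightarrow> real" where
  "wave_bound p l U V =
    Max {\<bar>vel U $ l\<bar> + char_speed p l U,
         \<bar>vel V $ l\<bar> + char_speed p l V,
         \<bar>sqrt (rho U) * vel U $ l + sqrt (rho V) * vel V $ l\<bar> / (sqrt (rho U) + sqrt (rho V))
           + max (char_speed p l U) (char_speed p l V)}
    + norm (mag U - mag V) / (sqrt (rho U) + sqrt (rho V))"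

section \<open>Meshes and spaces\<close>

text \<open>
  The rectangle has \<open>cells_x \<times> cells_y\<close> primal cells. Mesh subscripts are real numbers:
  \<open>xpos M r\<close> is \<open>x\<^sub>r\<close>, also for half-integer \<open>r\<close>, and the cell with subscript \<open>(r, s)\<close> is primal
  for integer \<open>r, s\<close> and dual for half-odd-integer \<open>r, s\<close>. The rectangle itself is
  \<open>x\<^bsub>1/2\<^esub> \<le> x \<le> x\<^bsub>n+1/2\<^esub>\<close> with \<open>n = cells_x M\<close>, and similarly in \<open>y\<close>.
\<close>

record mesh =
  org_x :: real
  org_y :: real
  dx :: real
  dy :: real
  cells_x :: nat
  cells_y :: nat

definition xpos :: "mesh \<Rightarrow> real \<Rightarrow> real" where "xpos M r = org_x M + r * dx M"
definition ypos :: "mesh \<Rightarrow> real \<Rightarrow> real" where "ypos M s = org_y M + s * dy M"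

definition valid_mesh :: "mesh \<Rightarrow> bool" where
  "valid_mesh M \<longleftrightarrow> dx M > 0 \<and> dy M > 0 \<and> cells_x M \<ge> 1 \<and> cells_y M \<ge> 1"

definition cell :: "mesh \<Rightarrow> real \<Rightarrow> real \<Rightarrow> (real \<times> real) set" where
  "cell M r s = box (xpos M (r - 1/2), ypos M (s - 1/2)) (xpos M (r + 1/2), ypos M (s + 1/2))"

text \<open>
  The dual cells covering the rectangle overlap its boundary, so evolving them needs values
  (boundary data) on one layer of ghost primal cells, included in \<open>primal_ghost_cells\<close>.
\<close>

definition primal_cells :: "mesh \<Rightarrow> (real \<times> real) set" where
  "primal_cells M = {(real i, real j) | i j. i \<in> {1..cells_x M} \<and> j \<in> {1..cells_y M}}"

definition primal_ghost_cells :: "mesh \<Rightarrow> (real \<times> real) set" where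
  "primal_ghost_cells M =
    {(real i, real j) | i j. i \<in> {0..cells_x M + 1} \<and> j \<in> {0..cells_y M + 1}}"

definition dual_cells :: "mesh \<Rightarrow> (real \<times> real) set" where
  "dual_cells M =
    {(real i + 1/2, real j + 1/2) | i j. i \<in> {0..cells_x M} \<and> j \<in> {0..cells_y M}}"

definition polynomial_on :: "nat \<Rightarrow> (real \<times> real) set \<Rightarrow> (real \<times> real \<Rightarrow> state) \<Rightarrow> bool" where
  "polynomial_on k S w \<longleftrightarrow>
    (\<exists>c :: nat \<Rightarrow> nat \<Rightarrow> state.
      \<forall>(x, y) \<in> S. w (x, y) = (\<Sum>a\<le>k. \<Sum>b\<le>k - a. (x ^ a * y ^ b) *\<^sub>R c a b))"

definition divergence_free_on :: "(real \<times> real) set \<Rightarrow> (real \<times> real \<Rightarrow> state) \<Rightarrow> bool" where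
  "divergence_free_on S w \<longleftrightarrow>
    (\<forall>(x, y) \<in> S. deriv (\<lambda>t. mag (w (t, y)) $ 1) x + deriv (\<lambda>t. mag (w (x, t)) $ 2) y = 0)"

text \<open>Elements are unconstrained on the cell interfaces, where only one-sided limits are used.\<close>

definition ldf_space ::
  "mesh \<Rightarrow> (real \<times> real) set \<Rightarrow> nat \<Rightarrow> (real \<times> real \<Rightarrow> state) set" where
  "ldf_space M C k =
    {w. \<forall>(r, s) \<in> C. polynomial_on k (cell M r s) w \<and> divergence_free_on (cell M r s) w}"

definition W_primal :: "mesh \<Rightarrow> nat \<Rightarrow> (real \<times> real \<Rightarrow> state) set" where
  "W_primal M k = ldf_space M (primal_ghost_cells M) k"

definition W_dual :: "mesh \<Rightarrow> nat \<Rightarrow> (real \<times> real \<Rightarrow> state) set" where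
  "W_dual M k = ldf_space M (dual_cells M) k"

definition cell_avg :: "mesh \<Rightarrow> (real \<times> real \<Rightarrow> state) \<Rightarrow> real \<Rightarrow> real \<Rightarrow> state" where
  "cell_avg M w r s = (1 / (dx M * dy M)) *\<^sub>R integral (cell M r s) w"

section \<open>Jumps and averages at interfaces\<close>

definition jump :: "(real \<Rightarrow> 'a::real_normed_vector) \<Rightarrow> real \<Rightarrow> 'a" where
  "jump g t = Lim (at_right t) g - Lim (at_left t) g"

definition mean :: "(real \<Rightarrow> 'a::real_normed_vector) \<Rightarrow> real \<Rightarrow> 'a" where
  "mean g t = (1/2) *\<^sub>R (Lim (at_left t) g + Lim (at_right t) g)"

section \<open>Quadrature\<close>

text \<open>Rules on the reference interval \<open>[0, 1]\<close>, so that exactness normalizes the weights to sum 1.\<close>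

definition quadrature_rule :: "nat \<Rightarrow> nat \<Rightarrow> (nat \<Rightarrow> real) \<Rightarrow> (nat \<Rightarrow> real) \<Rightarrow> bool" where
  "quadrature_rule n d \<xi> \<omega> \<longleftrightarrow>
    strict_mono_on {1..n} \<xi> \<and> \<xi> ` {1..n} \<subseteq> {0..1} \<and>
    (\<forall>q :: real poly. degree q \<le> d \<longrightarrow>
       (\<Sum>\<mu>=1..n. \<omega> \<mu> * poly q (\<xi> \<mu>)) = integral {0..1} (poly q))"

definition gauss_rule :: "nat \<Rightarrow> (nat \<Rightarrow> real) \<Rightarrow> (nat \<Rightarrow> real) \<Rightarrow> bool" where
  "gauss_rule n \<xi> \<omega> \<longleftrightarrow> quadrature_rule n (2 * n - 1) \<xi> \<omega>"

definition gauss_lobatto_rule :: "nat \<Rightarrow> (nat \<Rightarrow> real) \<Rightarrow> (nat \<Rightarrow> real) \<Rightarrow> bool" where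
  "gauss_lobatto_rule n \<xi> \<omega> \<longleftrightarrow>
    \<xi> 1 = 0 \<and> \<xi> n = 1 \<and> quadrature_rule n (2 * n - 3) \<xi> \<omega>"

text \<open>
  The half-interval with subscript \<open>q = r \<plusminus> 1/4\<close> is \<open>[x\<^bsub>q-1/4\<^esub>, x\<^bsub>q+1/4\<^esub>]\<close>; \<open>node_x M \<xi> q \<mu>\<close> is its
  \<open>\<mu>\<close>-th node. A product of two half-intervals is a quarter of a primal and of a dual cell.
\<close>

definition node_x :: "mesh \<Rightarrow> (nat \<Rightarrow> real) \<Rightarrow> real \<Rightarrow> nat \<Rightarrow> real" where
  "node_x M \<xi> q \<mu> = xpos M (q - 1/4 + \<xi> \<mu> / 2)"

definition node_y :: "mesh \<Rightarrow> (nat \<Rightarrow> real) \<Rightarrow> real \<Rightarrow> nat \<Rightarrow> real" where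
  "node_y M \<xi> q \<mu> = ypos M (q - 1/4 + \<xi> \<mu> / 2)"

definition nodes_x :: "mesh \<Rightarrow> nat \<Rightarrow> (nat \<Rightarrow> real) \<Rightarrow> real \<Rightarrow> real set" where
  "nodes_x M n \<xi> r = {node_x M \<xi> (r + \<sigma>/4) \<mu> | \<sigma> \<mu>. \<sigma> \<in> {-1, 1} \<and> \<mu> \<in> {1..n}}"

definition nodes_y :: "mesh \<Rightarrow> nat \<Rightarrow> (nat \<Rightarrow> real) \<Rightarrow> real \<Rightarrow> real set" where
  "nodes_y M n \<xi> s = {node_y M \<xi> (s + \<sigma>/4) \<mu> | \<sigma> \<mu>. \<sigma> \<in> {-1, 1} \<and> \<mu> \<in> {1..n}}"

definition quarter :: "mesh \<Rightarrow> real \<Rightarrow> real \<Rightarrow> (real \<times> real) set" where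
  "quarter M q q' = box (xpos M (q - 1/4), ypos M (q' - 1/4)) (xpos M (q + 1/4), ypos M (q' + 1/4))"

definition value_from :: "(real \<times> real) set \<Rightarrow> (real \<times> real \<Rightarrow> state) \<Rightarrow> real \<times> real \<Rightarrow> state" where
  "value_from S w z = Lim (at z within S) w"

text \<open>
  \<open>w\<close> is admissible on \<open>(\<bbbQ>\<^sub>r\<^sup>x \<otimes> \<bbbQ>'\<^sub>s\<^sup>y) \<union> (\<bbbQ>'\<^sub>r\<^sup>x \<otimes> \<bbbQ>\<^sub>s\<^sup>y)\<close>, with Gauss nodes \<open>\<xi>\<close>
  (giving \<open>\<bbbQ>\<close>) and Gauss--Lobatto nodes \<open>\<eta>\<close> (giving \<open>\<bbbQ>'\<close>). A node shared by several quarters is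
  considered once for each of them, with the limit from within that quarter.
\<close>

definition admissible_at_nodes ::
  "mesh \<Rightarrow> nat \<Rightarrow> (nat \<Rightarrow> real) \<Rightarrow> nat \<Rightarrow> (nat \<Rightarrow> real) \<Rightarrow>
   (real \<times> real \<Rightarrow> state) \<Rightarrow> real \<Rightarrow> real \<Rightarrow> bool" where
  "admissible_at_nodes M N \<xi> L \<eta> w r s \<longleftrightarrow>
    (\<forall>\<sigma> \<in> {-1, 1}. \<forall>\<sigma>' \<in> {-1, 1}. \<forall>\<mu> \<in> {1..N}. \<forall>\<nu> \<in> {1..L}.
      let q = r + \<sigma>/4; q' = s + \<sigma>'/4 in
      value_from (quarter M q q') w (node_x M \<xi> q \<mu>, node_y M \<eta> q' \<nu>) \<in> admissible \<and>
      value_from (quarter M q q') w (node_x M \<eta> q \<nu>, node_y M \<xi> q' \<mu>) \<in> admissible)"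

section \<open>The scheme for cell averages\<close>

text \<open>
  \<open>V\<close> is the numerical solution on the mesh containing the cell \<open>(r, s)\<close> that is evolved, and \<open>W\<close>
  the one on the other mesh. Primal cells: \<open>V = U\<^sup>C\<close>, \<open>W = U\<^sup>D\<close>; dual cells: the reverse.
\<close>

definition L_op ::
  "(real \<Rightarrow> real \<Rightarrow> real) \<Rightarrow> mesh \<Rightarrow> nat \<Rightarrow> (nat \<Rightarrow> real) \<Rightarrow> (nat \<Rightarrow> real) \<Rightarrow> real \<Rightarrow>
   (real \<times> real \<Rightarrow> state) \<Rightarrow> (real \<times> real \<Rightarrow> state) \<Rightarrow> real \<Rightarrow> real \<Rightarrow> state" where
  "L_op p M N \<xi> \<omega> \<tau> V W r s =
    (1 / \<tau>) *\<^sub>R (cell_avg M W r s - cell_avg M V r s)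
    - (1 / dx M) *\<^sub>R (\<Sum>\<sigma>\<in>{-1, 1}. \<Sum>\<mu>=1..N. (\<omega> \<mu> / 2) *\<^sub>R
        (flux p 1 (W (xpos M (r + 1/2), node_y M \<xi> (s + \<sigma>/4) \<mu>))
         - flux p 1 (W (xpos M (r - 1/2), node_y M \<xi> (s + \<sigma>/4) \<mu>))))
    - (1 / dy M) *\<^sub>R (\<Sum>\<sigma>\<in>{-1, 1}. \<Sum>\<mu>=1..N. (\<omega> \<mu> / 2) *\<^sub>R
        (flux p 2 (W (node_x M \<xi> (r + \<sigma>/4) \<mu>, ypos M (s + 1/2)))
         - flux p 2 (W (node_x M \<xi> (r + \<sigma>/4) \<mu>, ypos M (s - 1/2)))))"

definition S_op ::
  "mesh \<Rightarrow> nat \<Rightarrow> (nat \<Rightarrow> real) \<Rightarrow> (nat \<Rightarrow> real) \<Rightarrow>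
   (real \<times> real \<Rightarrow> state) \<Rightarrow> real \<Rightarrow> real \<Rightarrow> state" where
  "S_op M N \<xi> \<omega> W r s =
    - (\<Sum>\<sigma>\<in>{-1, 1}. \<Sum>\<mu>=1..N. (\<omega> \<mu> / 2) *\<^sub>R
        (let x = node_x M \<xi> (r + \<sigma>/4) \<mu>; y = node_y M \<xi> (s + \<sigma>/4) \<mu> in
         (jump (\<lambda>t. mag (W (t, y)) $ 1) (xpos M r) / dx M) *\<^sub>R
           source (mean (\<lambda>t. W (t, y)) (xpos M r))
         + (jump (\<lambda>t. mag (W (x, t)) $ 2) (ypos M s) / dy M) *\<^sub>R
           source (mean (\<lambda>t. W (x, t)) (ypos M s))))"

definition Lnew ::
  "(real \<Rightarrow> real \<Rightarrow> real) \<Rightarrow> mesh \<Rightarrow> nat \<Rightarrow> (nat \<Rightarrow> real) \<Rightarrow> (nat \<Rightarrow> real) \<Rightarrow> real \<Rightarrow>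
   (real \<times> real \<Rightarrow> state) \<Rightarrow> (real \<times> real \<Rightarrow> state) \<Rightarrow> real \<Rightarrow> real \<Rightarrow> state" where
  "Lnew p M N \<xi> \<omega> \<tau> V W r s = L_op p M N \<xi> \<omega> \<tau> V W r s + S_op M N \<xi> \<omega> W r s"

section \<open>Wave speeds\<close>

text \<open>
  In the following maxima the terms of \<open>U\<^sup>D\<close> belong to the primal cells and those of \<open>U\<^sup>C\<close> to the
  dual cells in whose evolution they occur. For the latter the nodes are written
  \<open>\<bbbQ>\<^bsub>j+1/2\<^esub>\<close>; as \<open>j\<close> varies, these are the nodes \<open>\<bbbQ>\<^sub>j\<close>, on the same half-intervals.
\<close>

definition a_hat1 ::
  "(real \<Rightarrow> real \<Rightarrow> real) \<Rightarrow> mesh \<Rightarrow> nat \<Rightarrow> (nat \<Rightarrow> real) \<Rightarrow>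
   (real \<times> real \<Rightarrow> state) \<Rightarrow> (real \<times> real \<Rightarrow> state) \<Rightarrow> real" where
  "a_hat1 p M N \<xi> UC UD = Max (
     {wave_bound p 1 (UC (xpos M (r + 1/2), y)) (UC (xpos M (r - 1/2), y)) | r s y.
        (r, s) \<in> dual_cells M \<and> y \<in> nodes_y M N \<xi> s} \<union>
     {wave_bound p 1 (UD (xpos M (r + 1/2), y)) (UD (xpos M (r - 1/2), y)) | r s y.
        (r, s) \<in> primal_cells M \<and> y \<in> nodes_y M N \<xi> s})"

definition a_hat2 ::
  "(real \<Rightarrow> real \<Rightarrow> real) \<Rightarrow> mesh \<Rightarrow> nat \<Rightarrow> (nat \<Rightarrow> real) \<Rightarrow>
   (real \<times> real \<Rightarrow> state) \<Rightarrow> (real \<times> real \<Rightarrow> state) \<Rightarrow> real" where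
  "a_hat2 p M N \<xi> UC UD = Max (
     {wave_bound p 2 (UC (x, ypos M (s + 1/2))) (UC (x, ypos M (s - 1/2))) | r s x.
        (r, s) \<in> dual_cells M \<and> x \<in> nodes_x M N \<xi> r} \<union>
     {wave_bound p 2 (UD (x, ypos M (s + 1/2))) (UD (x, ypos M (s - 1/2))) | r s x.
        (r, s) \<in> primal_cells M \<and> x \<in> nodes_x M N \<xi> r})"

definition jump_speed1 :: "mesh \<Rightarrow> (real \<times> real \<Rightarrow> state) \<Rightarrow> real \<Rightarrow> real \<Rightarrow> real" where
  "jump_speed1 M w r y =
    \<bar>jump (\<lambda>t. mag (w (t, y)) $ 1) (xpos M r)\<bar> / (2 * sqrt (mean (\<lambda>t. rho (w (t, y))) (xpos M r)))"

definition jump_speed2 :: "mesh \<Rightarrow> (real \<times> real \<Rightarrow> state) \<Rightarrow> real \<Rightarrow> real \<Rightarrow> real" where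
  "jump_speed2 M w x s =
    \<bar>jump (\<lambda>t. mag (w (x, t)) $ 2) (ypos M s)\<bar> / (2 * sqrt (mean (\<lambda>t. rho (w (x, t))) (ypos M s)))"

definition beta1 ::
  "mesh \<Rightarrow> nat \<Rightarrow> (nat \<Rightarrow> real) \<Rightarrow> (real \<times> real \<Rightarrow> state) \<Rightarrow> (real \<times> real \<Rightarrow> state) \<Rightarrow> real" where
  "beta1 M N \<xi> UC UD = Max (
     {jump_speed1 M UD r y | r s y. (r, s) \<in> primal_cells M \<and> y \<in> nodes_y M N \<xi> s} \<union>
     {jump_speed1 M UC r y | r s y. (r, s) \<in> dual_cells M \<and> y \<in> nodes_y M N \<xi> s})"

definition beta2 ::
  "mesh \<Rightarrow> nat \<Rightarrow> (nat \<Rightarrow> real) \<Rightarrow> (real \<times> real \<Rightarrow> state) \<Rightarrow> (real \<times> real \<Rightarrow> state) \<Rightarrow> real" where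
  "beta2 M N \<xi> UC UD = Max (
     {jump_speed2 M UD x s | r s x. (r, s) \<in> primal_cells M \<and> x \<in> nodes_x M N \<xi> r} \<union>
     {jump_speed2 M UC x s | r s x. (r, s) \<in> dual_cells M \<and> x \<in> nodes_x M N \<xi> r})"

end

theory Submission
  imports Defs
begin

text \<open>
  For \<open>n = (|v\<^sup>*|\<^sup>2/2, -v\<^sup>*, -B\<^sup>*, 1)\<close> one has
  \<open>U \<bullet> n + |B\<^sup>*|\<^sup>2/2 = \<rho> |v - v\<^sup>*|\<^sup>2/2 + |B - B\<^sup>*|\<^sup>2/2 + \<rho> e\<close>, so admissibility of \<open>U\<close> means \<open>\<rho> > 0\<close>
  and positivity of the left-hand side, which is affine in \<open>U\<close>, for all \<open>v\<^sup>*, B\<^sup>*\<close>. Tested against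
  \<open>n\<close>, the difference of two fluxes is bounded by the wave speed times the sum of the two left-hand
  sides, up to \<open>v\<^sup>* \<bullet> B\<^sup>*\<close> times the difference of the normal magnetic fields. Summed over a cell,
  these normal differences reduce by the divergence-free property to the jumps inside the cell,
  which the source term cancels up to an error controlled by \<open>\<beta>\<close>. What remains is dominated, under
  the CFL condition, by the end-point terms of the Gauss--Lobatto formula for the cell average.
\<close>

section \<open>Ideal MHD states and fluxes\<close>

text \<open>Two geometric facts shape the argument. The faces of the evolved cell run through the
  middle of cells of the other mesh, so fluxes are plain point values; the discontinuities of the
  other solution lie on the two mid-lines of the evolved cell. Hence everything is done on the four
  quarters, on each of which that solution is one polynomial. The term v* . B* times a normal field
  difference has no sign and is not part of the energies, so it must vanish by summation. This
  requires the flux sums, the source sum and the discrete divergence theorem to share the same Gauss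
  nodes, while the end points of the Lobatto rule supply exactly the face and mid-line states on
  these grid lines. The CFL constant: with \<Delta>t = \<theta> \<tau> the update is a convex
  combination of the old average, with weight 1 - \<theta>, and a step of length \<tau> from the
  other mesh's average. In that step each end point carries the factor 1/2 from the flux sum and
  \<open>\<omega>' 1\<close> / 4 from the four-quarter average, whose ratio leaves the bound
  \<open>\<omega>' 1\<close> / 2.\<close>

definition dual_vec :: "real^3 \<Rightarrow> real^3 \<Rightarrow> state" where
  "dual_vec vs Bs = ((norm vs)\<^sup>2 / 2, - vs, - Bs, 1)"

definition dual_energy :: "real^3 \<Rightarrow> real^3 \<Rightarrow> state \<Rightarrow> real" where
  "dual_energy vs Bs U = dual_vec vs Bs \<bullet> U + (norm Bs)\<^sup>2 / 2"

lemma mom_eq: "rho U > 0 \<Longrightarrow> mom U = rho U *\<^sub>R vel U"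
  by (simp add: vel_def)

lemma toten_eq:
  assumes "rho U > 0"
  shows "toten U = internal_energy U + rho U * (vel U \<bullet> vel U) / 2 + (mag U \<bullet> mag U) / 2"
proof -
  have "(norm (mom U))\<^sup>2 / (2 * rho U) = rho U * (vel U \<bullet> vel U) / 2"
    using assms by (simp add: mom_eq power2_eq_square norm_scaleR flip: power2_norm_eq_inner)
  then show ?thesis by (simp add: internal_energy_def power2_norm_eq_inner)
qed

lemma state_eq: "U = (rho U, mom U, mag U, toten U)"
  by (simp add: rho_def mom_def mag_def toten_def)

lemma dual_vec_inner:
  "dual_vec vs Bs \<bullet> (a, m, B, E) = a * (vs \<bullet> vs) / 2 - vs \<bullet> m - Bs \<bullet> B + E"
  by (simp add: dual_vec_def power2_norm_eq_inner)

lemma dual_energy_eq: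
  assumes "rho U > 0"
  shows "dual_energy vs Bs U =
    rho U * (norm (vel U - vs))\<^sup>2 / 2 + (norm (mag U - Bs))\<^sup>2 / 2 + internal_energy U"
proof -
  have "dual_energy vs Bs U = dual_vec vs Bs \<bullet> (rho U, mom U, mag U, toten U) + Bs \<bullet> Bs / 2"
    using state_eq[of U] by (simp add: dual_energy_def power2_norm_eq_inner)
  then show ?thesis
    by (simp add: dual_vec_inner power2_norm_eq_inner mom_eq[OF assms] toten_eq[OF assms]
        inner_simps inner_commute field_simps)
qed

lemma dual_energy_pos: "U \<in> admissible \<Longrightarrow> dual_energy vs Bs U > 0"
  by (simp add: admissible_def dual_energy_eq add_nonneg_pos)

text \<open>At \<open>vs = vel U\<close>, \<open>Bs = mag U\<close> both squares in
  \<open>dual_energy_eq\<close> vanish and only the internal energy remains.\<close>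

lemma admissibleI:
  assumes "rho U > 0" "\<And>vs Bs. dual_energy vs Bs U > 0"
  shows "U \<in> admissible"
  using assms(1) assms(2)[of "vel U" "mag U"] by (simp add: admissible_def dual_energy_eq)

lemma admissible_convex:
  assumes "U \<in> admissible" "V \<in> admissible" "0 < t" "t \<le> 1"
  shows "(1 - t) *\<^sub>R U + t *\<^sub>R V \<in> admissible"
proof (rule admissibleI)
  show "rho ((1 - t) *\<^sub>R U + t *\<^sub>R V) > 0"
    using assms by (simp add: admissible_def rho_def add_nonneg_pos)
  fix vs Bs
  have "dual_energy vs Bs ((1 - t) *\<^sub>R U + t *\<^sub>R V) =
      (1 - t) * dual_energy vs Bs U + t * dual_energy vs Bs V"
    by (simp add: dual_energy_def inner_simps field_simps)
  then show "dual_energy vs Bs ((1 - t) *\<^sub>R U + t *\<^sub>R V) > 0"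
    using dual_energy_pos[OF assms(1), of vs Bs] dual_energy_pos[OF assms(2), of vs Bs] assms(3,4)
    by (simp add: add_nonneg_pos)
qed

section \<open>Flux differences, the fast magnetosonic speed and the source term\<close>

text \<open>The form is \<open>K X \<bullet> (b, T)\<close> with \<open>K X = (X\<^sub>l \<beta> - \<beta>\<^sub>l X, s X\<^sub>l)\<close>, and \<open>c\<close> is the norm of \<open>K\<close>: \<open>c\<^sup>2\<close> is the
  larger root of \<open>z\<^sup>2 - (|\<beta>|\<^sup>2 + s\<^sup>2) z + \<beta>\<^sub>l\<^sup>2 s\<^sup>2\<close>.\<close>

lemma fast_speed_bound:
  fixes X \<beta> b :: "real^'n" and l :: 'n
  assumes c: "c = 1 / sqrt 2 * sqrt ((norm \<beta>)\<^sup>2 + s\<^sup>2 + sqrt (((norm \<beta>)\<^sup>2 + s\<^sup>2)\<^sup>2 - 4 * ((\<beta> $ l)\<^sup>2 * s\<^sup>2)))"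
  shows "\<bar>s * X $ l * T + (\<beta> \<bullet> b) * X $ l - \<beta> $ l * (X \<bullet> b)\<bar>
    \<le> c * (((norm X)\<^sup>2 + T\<^sup>2) / 2 + (norm b)\<^sup>2 / 2)"
proof -
  define q where "q = (norm \<beta>)\<^sup>2 + s\<^sup>2"
  define D where "D = q\<^sup>2 - 4 * ((\<beta> $ l)\<^sup>2 * s\<^sup>2)"
  have bl: "(\<beta> $ l)\<^sup>2 \<le> (norm \<beta>)\<^sup>2"
    using component_le_norm_cart[of \<beta> l] by (simp add: abs_le_square_iff[symmetric])
  have "4 * ((\<beta> $ l)\<^sup>2 * s\<^sup>2) \<le> 4 * ((norm \<beta>)\<^sup>2 * s\<^sup>2)"
    using bl by (simp add: mult_right_mono)
  moreover have "0 \<le> ((norm \<beta>)\<^sup>2 - s\<^sup>2)\<^sup>2" by simp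
  ultimately have D0: "D \<ge> 0"
    unfolding D_def q_def by (simp add: power2_eq_square algebra_simps)
  have q0: "q \<ge> 0" by (simp add: q_def)
  have c0: "c \<ge> 0" using c q0 D0 by (simp add: q_def[symmetric] D_def)
  have c2: "c\<^sup>2 = (q + sqrt D) / 2"
    using q0 D0 unfolding c q_def[symmetric] D_def[symmetric]
    by (simp add: power_mult_distrib power_divide)
  have quad: "c\<^sup>2 * c\<^sup>2 - q * c\<^sup>2 + (\<beta> $ l)\<^sup>2 * s\<^sup>2 = 0"
  proof -
    have "sqrt D * sqrt D = D" using D0 by simp
    then show ?thesis unfolding c2 by (simp add: field_simps D_def power2_eq_square)
  qed
  define \<gamma> where "\<gamma> = \<beta> - (\<beta> $ l) *\<^sub>R axis l 1"
  define Y where "Y = X - (X $ l) *\<^sub>R axis l 1"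
  have g: "(norm \<gamma>)\<^sup>2 = (norm \<beta>)\<^sup>2 - (\<beta> $ l)\<^sup>2" and y: "(norm Y)\<^sup>2 = (norm X)\<^sup>2 - (X $ l)\<^sup>2"
    unfolding \<gamma>_def Y_def
    unfolding power2_norm_eq_inner
    by (simp_all add: inner_simps inner_axis inner_axis' power2_eq_square algebra_simps)
  have gy: "\<gamma> \<bullet> Y = \<beta> \<bullet> X - \<beta> $ l * X $ l"
    unfolding \<gamma>_def Y_def by (simp add: inner_simps inner_axis inner_axis' algebra_simps)
  \<comment> \<open>The equation \<open>quad\<close> as a vanishing determinant: c^2 |X|^2 - |K X|^2
    is a quadratic form in X_l and Y whose diagonal coefficients are these two factors and whose
    mixed coefficient has size at most |\<beta>_l| |\<gamma>|.\<close>
  have prod: "(c\<^sup>2 - (\<beta> $ l)\<^sup>2) * (c\<^sup>2 - ((norm \<gamma>)\<^sup>2 + s\<^sup>2)) = (\<beta> $ l)\<^sup>2 * (norm \<gamma>)\<^sup>2"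
    using quad unfolding g q_def by (simp add: algebra_simps power2_eq_square)
  have h1: "c\<^sup>2 \<ge> (\<beta> $ l)\<^sup>2" and h2: "c\<^sup>2 \<ge> (norm \<gamma>)\<^sup>2 + s\<^sup>2"
  proof -
    have pr: "(c\<^sup>2 - (\<beta> $ l)\<^sup>2) * (c\<^sup>2 - ((norm \<gamma>)\<^sup>2 + s\<^sup>2)) \<ge> 0"
      unfolding prod by simp
    \<comment> \<open>The larger root lies above the mean q / 2 of both roots, so the two factors
      have a nonnegative sum; as their product is nonnegative too, neither is negative.\<close>
    have "2 * c\<^sup>2 \<ge> q" unfolding c2 using real_sqrt_ge_zero[OF D0] by simp
    then have sm: "(c\<^sup>2 - (\<beta> $ l)\<^sup>2) + (c\<^sup>2 - ((norm \<gamma>)\<^sup>2 + s\<^sup>2)) \<ge> 0"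
      unfolding g q_def by simp
    show "c\<^sup>2 \<ge> (\<beta> $ l)\<^sup>2" "c\<^sup>2 \<ge> (norm \<gamma>)\<^sup>2 + s\<^sup>2"
      using pr sm by (auto simp: zero_le_mult_iff)
  qed
  define u where "u = (X $ l) *\<^sub>R \<beta> - (\<beta> $ l) *\<^sub>R X"
  define a1 where "a1 = sqrt (c\<^sup>2 - (\<beta> $ l)\<^sup>2)"
  define a2 where "a2 = sqrt (c\<^sup>2 - ((norm \<gamma>)\<^sup>2 + s\<^sup>2))"
  have a12: "a1 * a2 = \<bar>\<beta> $ l\<bar> * norm \<gamma>"
    unfolding a1_def a2_def real_sqrt_mult[symmetric] prod by (simp add: real_sqrt_mult)
  have a1s: "a1\<^sup>2 = c\<^sup>2 - (\<beta> $ l)\<^sup>2" and a2s: "a2\<^sup>2 = c\<^sup>2 - ((norm \<gamma>)\<^sup>2 + s\<^sup>2)"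
    unfolding a1_def a2_def using h1 h2 by simp_all
  \<comment> \<open>Cauchy-Schwarz on the mixed term; by \<open>a12\<close> the quadratic form is
    then at least the square of a2 |X_l| - a1 |Y|.\<close>
  have "2 * (\<beta> $ l * X $ l * (\<gamma> \<bullet> Y)) \<ge> - (2 * (a2 * \<bar>X $ l\<bar>) * (a1 * norm Y))"
  proof -
    have "\<bar>\<beta> $ l * X $ l * (\<gamma> \<bullet> Y)\<bar> \<le> \<bar>\<beta> $ l\<bar> * \<bar>X $ l\<bar> * (norm \<gamma> * norm Y)"
      using Cauchy_Schwarz_ineq2[of \<gamma> Y] by (simp add: abs_mult mult_left_mono)
    also have "\<dots> = (a1 * a2) * (\<bar>X $ l\<bar> * norm Y)" unfolding a12 by simp
    finally show ?thesis by (simp add: algebra_simps)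
  qed
  moreover have "0 \<le> (a2 * \<bar>X $ l\<bar> - a1 * norm Y)\<^sup>2" by simp
  ultimately have "0 \<le> (a2 * \<bar>X $ l\<bar>)\<^sup>2 + (a1 * norm Y)\<^sup>2 + 2 * (\<beta> $ l * X $ l * (\<gamma> \<bullet> Y))"
    unfolding power2_diff by linarith
  moreover have "(norm u)\<^sup>2 = (X $ l)\<^sup>2 * (norm \<beta>)\<^sup>2 + (\<beta> $ l)\<^sup>2 * (norm X)\<^sup>2 - 2 * (\<beta> $ l * X $ l * (\<beta> \<bullet> X))"
    unfolding power2_norm_eq_inner u_def
    by (simp add: inner_simps inner_commute[of X \<beta>] power2_eq_square algebra_simps)
  ultimately have "(norm u)\<^sup>2 + (s * X $ l)\<^sup>2 \<le> c\<^sup>2 * (norm X)\<^sup>2"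
    unfolding power_mult_distrib a1s a2s gy g y power2_abs
    by (simp add: algebra_simps power2_eq_square)
  moreover have "norm (u, s * X $ l) = sqrt ((norm u)\<^sup>2 + (s * X $ l)\<^sup>2)"
    by (simp add: norm_prod_def)
  ultimately have nK: "norm (u, s * X $ l) \<le> c * norm X"
    using c0 by (metis power_mult_distrib real_le_lsqrt real_sqrt_le_mono mult_nonneg_nonneg norm_ge_zero real_sqrt_abs abs_of_nonneg)
  have "s * X $ l * T + (\<beta> \<bullet> b) * X $ l - \<beta> $ l * (X \<bullet> b) = (u, s * X $ l) \<bullet> (b, T)"
    by (simp add: u_def inner_simps)
  then have "\<bar>s * X $ l * T + (\<beta> \<bullet> b) * X $ l - \<beta> $ l * (X \<bullet> b)\<bar> \<le> norm (u, s * X $ l) * norm (b, T)"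
    using Cauchy_Schwarz_ineq2[of "(u, s * X $ l)" "(b, T)"] by simp
  also have "\<dots> \<le> c * norm X * norm (b, T)"
    using nK by (simp add: mult_right_mono)
  also have "\<dots> \<le> c * (((norm X)\<^sup>2 + (norm (b, T))\<^sup>2) / 2)"
    using sum_squares_bound[of "norm X" "norm (b,T)"] c0 by (simp add: mult.assoc mult_left_mono)
  also have "(norm (b, T))\<^sup>2 = (norm b)\<^sup>2 + T\<^sup>2" by (simp add: norm_prod_def)
  finally show ?thesis by (simp add: algebra_simps add_divide_distrib)
qed

text \<open>Sorted by transport velocity: kinetic and internal energy travel with
  \<open>vel U\<close>, the magnetic deviation with \<open>vs\<close>, and the last bracket is the
  acoustic and Alfvenic coupling that \<open>char_speed\<close> controls. The term in
  \<open>norm Bs\<close> is independent of \<open>U\<close> and cancels in flux differences.\<close>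

lemma flux_dual:
  assumes "rho U > 0"
  shows "dual_vec vs Bs \<bullet> flux p l U - (vs \<bullet> Bs) * mag U $ l =
    vel U $ l * (rho U * (norm (vel U - vs))\<^sup>2 / 2 + internal_energy U)
    + vs $ l * ((norm (mag U - Bs))\<^sup>2 / 2) - vs $ l * ((norm Bs)\<^sup>2 / 2)
    + (pressure p U * (vel U - vs) $ l + (mag U \<bullet> (mag U - Bs)) * (vel U - vs) $ l
       - mag U $ l * ((vel U - vs) \<bullet> (mag U - Bs)))"
  unfolding flux_def Let_def dual_vec_inner mom_eq[OF assms] toten_eq[OF assms]
  by (simp add: power2_norm_eq_inner inner_simps inner_axis algebra_simps add_divide_distrib diff_divide_distrib)
    (simp add: inner_commute)

text \<open>Rescaling to \<open>fast_speed_bound\<close>: X is the velocity deviation times sqrt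
  \<rho>, \<beta> the Alfven velocity, T = sqrt (2 \<rho> e), s the sound speed. Then (|X|^2 + T^2)
  / 2 is kinetic plus internal energy, and p / (\<rho> sqrt (2 e)) is precisely the s with s T sqrt
  \<rho> = p.\<close>

lemma char_term_bound:
  assumes U: "U \<in> admissible"
  shows "\<bar>pressure p U * w $ l + (mag U \<bullet> b) * w $ l - mag U $ l * (w \<bullet> b)\<bar>
    \<le> char_speed p l U * ((rho U * (norm w)\<^sup>2 / 2 + internal_energy U) + (norm b)\<^sup>2 / 2)"
proof -
  define r where "r = sqrt (rho U)"
  have r: "r > 0" "r\<^sup>2 = rho U" using U by (simp_all add: r_def admissible_def)
  define \<beta> where "\<beta> = mag U /\<^sub>R r"
  define X where "X = r *\<^sub>R w"
  define T where "T = sqrt (2 * internal_energy U)"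
  define s where "s = sound_speed p U"
  have ie: "internal_energy U > 0" using U by (simp add: admissible_def)
  have T: "T\<^sup>2 = 2 * internal_energy U" "T > 0" using ie by (simp_all add: T_def)
  have "sqrt (2 * spec_energy U) = T / r"
    by (simp add: spec_energy_def T_def r_def real_sqrt_divide[symmetric])
  then have sT: "s * T * r = pressure p U"
    using r T(2) by (simp add: s_def sound_speed_def r(2)[symmetric] power2_eq_square)
  have nb: "(norm \<beta>)\<^sup>2 = (norm (mag U))\<^sup>2 / rho U"
    using r by (simp add: \<beta>_def power_mult_distrib power_divide divide_inverse flip: r(2)) (simp add: power_inverse)
  have bl: "(\<beta> $ l)\<^sup>2 * s\<^sup>2 = (mag U $ l)\<^sup>2 * s\<^sup>2 / rho U"
    using r by (simp add: \<beta>_def power_mult_distrib divide_inverse power_inverse flip: r(2))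
  have cs: "char_speed p l U = 1 / sqrt 2 * sqrt ((norm \<beta>)\<^sup>2 + s\<^sup>2 + sqrt (((norm \<beta>)\<^sup>2 + s\<^sup>2)\<^sup>2 - 4 * ((\<beta> $ l)\<^sup>2 * s\<^sup>2)))"
    unfolding bl nb by (simp add: char_speed_def Let_def s_def)
  have "s * X $ l * T = pressure p U * w $ l" using sT by (simp add: X_def ac_simps)
  moreover have "(\<beta> \<bullet> b) * X $ l = (mag U \<bullet> b) * w $ l" "\<beta> $ l * (X \<bullet> b) = mag U $ l * (w \<bullet> b)"
    using r by (simp_all add: X_def \<beta>_def)
  moreover have "(norm X)\<^sup>2 = rho U * (norm w)\<^sup>2" by (simp add: X_def power_mult_distrib r(2))
  ultimately show ?thesis
    using fast_speed_bound[OF cs, of X T b] by (simp add: T add_divide_distrib)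
qed

text \<open>At w = b = 0 the previous bound says that \<open>char_speed\<close> times a positive
  internal energy is nonnegative.\<close>

lemma char_speed_nonneg:
  assumes U: "U \<in> admissible"
  shows "char_speed p l U \<ge> 0"
proof -
  have "0 \<le> char_speed p l U * ((rho U * (norm 0)\<^sup>2 / 2 + internal_energy U) + (norm 0)\<^sup>2 / 2)"
    using char_term_bound[OF U, of p 0 l 0] by simp
  then show ?thesis using U by (simp add: admissible_def zero_le_mult_iff)
qed

text \<open>The entries of the maximum in \<open>wave_bound\<close> meet the parts of
  \<open>flux_dual\<close> one by one: the first two serve the kinetic and internal energies
  \<open>K\<close>, \<open>K'\<close>, the third the magnetic deviations, which are transported by
  the Roe-type mean \<open>Z\<close>. The summand \<open>d\<close> pays for replacing
  \<open>vs\<close> by \<open>Z\<close>.\<close>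

lemma wave_bound_flux:
  assumes U: "U \<in> admissible" and V: "V \<in> admissible"
  shows "dual_vec vs Bs \<bullet> (flux p l U - flux p l V) - (vs \<bullet> Bs) * (mag U $ l - mag V $ l)
    \<le> wave_bound p l U V * (dual_energy vs Bs U + dual_energy vs Bs V)"
proof -
  define K where "K = rho U * (norm (vel U - vs))\<^sup>2 / 2 + internal_energy U"
  define K' where "K' = rho V * (norm (vel V - vs))\<^sup>2 / 2 + internal_energy V"
  define b where "b = mag U - Bs"
  define b' where "b' = mag V - Bs"
  define r where "r = sqrt (rho U)"
  define r' where "r' = sqrt (rho V)"
  have r: "r > 0" "r\<^sup>2 = rho U" "r' > 0" "r'\<^sup>2 = rho V"
    using U V by (simp_all add: r_def r'_def admissible_def)
  define X where "X = r *\<^sub>R (vel U - vs)"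
  define X' where "X' = r' *\<^sub>R (vel V - vs)"
  define c where "c = char_speed p l U"
  define c' where "c' = char_speed p l V"
  define Z where "Z = (r * vel U $ l + r' * vel V $ l) / (r + r')"
  define m where "m = Max {\<bar>vel U $ l\<bar> + c, \<bar>vel V $ l\<bar> + c', \<bar>Z\<bar> + max c c'}"
  define d where "d = norm (mag U - mag V) / (r + r')"
  have wb: "wave_bound p l U V = m + d"
    using r unfolding wave_bound_def m_def d_def c_def c'_def Z_def r_def r'_def by simp
  have m: "\<bar>vel U $ l\<bar> + c \<le> m" "\<bar>vel V $ l\<bar> + c' \<le> m" "\<bar>Z\<bar> + max c c' \<le> m"
    unfolding m_def by (rule Max_ge; simp)+
  \<comment> \<open>Writing \<open>v\<^sup>*\<close> as Roe-type mean velocity minus mean deviation is what limits the wave speed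
    needed for the term \<open>v\<^sup>*\<^sub>l (|b|\<^sup>2 - |b'|\<^sup>2) / 2\<close> uniformly in \<open>v\<^sup>*\<close>.\<close>
  have vsl: "vs $ l = Z - (X $ l + X' $ l) / (r + r')"
  proof -
    have "Z - (X $ l + X' $ l) / (r + r') = vs $ l * (r + r') / (r + r')"
      unfolding Z_def X_def X'_def diff_divide_distrib[symmetric] by (simp add: algebra_simps)
    then show ?thesis using r by simp
  qed
  have e: "dual_energy vs Bs U = K + (norm b)\<^sup>2 / 2" "dual_energy vs Bs V = K' + (norm b')\<^sup>2 / 2"
    using U V by (simp_all add: dual_energy_eq admissible_def K_def K'_def b_def b'_def)
  have K: "K \<ge> (norm X)\<^sup>2 / 2" "K' \<ge> (norm X')\<^sup>2 / 2"
    using U V by (simp_all add: K_def K'_def X_def X'_def power_mult_distrib r admissible_def)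
  have K0: "K \<ge> 0" "K' \<ge> 0"
    using order_trans[OF _ K(1), of 0] order_trans[OF _ K(2), of 0] by simp_all
  define Q where "Q = pressure p U * (vel U - vs) $ l + (mag U \<bullet> b) * (vel U - vs) $ l
       - mag U $ l * ((vel U - vs) \<bullet> b)"
  define Q' where "Q' = pressure p V * (vel V - vs) $ l + (mag V \<bullet> b') * (vel V - vs) $ l
       - mag V $ l * ((vel V - vs) \<bullet> b')"
  have Q: "Q \<le> c * (K + (norm b)\<^sup>2 / 2)" "- Q' \<le> c' * (K' + (norm b')\<^sup>2 / 2)"
    using char_term_bound[OF U, of p "vel U - vs" l b] char_term_bound[OF V, of p "vel V - vs" l b']
    by (simp_all add: Q_def Q'_def K_def K'_def c_def c'_def)
  have "dual_vec vs Bs \<bullet> (flux p l U - flux p l V) - (vs \<bullet> Bs) * (mag U $ l - mag V $ l)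
    = vel U $ l * K - vel V $ l * K' + vs $ l * ((norm b)\<^sup>2 / 2 - (norm b')\<^sup>2 / 2) + Q - Q'"
    using flux_dual[of U vs Bs p l] flux_dual[of V vs Bs p l] U V
    by (simp add: admissible_def inner_simps K_def K'_def b_def b'_def Q_def Q'_def algebra_simps)
  also have "vs $ l * ((norm b)\<^sup>2 / 2 - (norm b')\<^sup>2 / 2) =
      Z * ((norm b)\<^sup>2 / 2) - Z * ((norm b')\<^sup>2 / 2)
      - (X $ l + X' $ l) / (r + r') * ((norm b)\<^sup>2 / 2 - (norm b')\<^sup>2 / 2)"
    unfolding vsl by (simp add: algebra_simps)
  finally have split: "dual_vec vs Bs \<bullet> (flux p l U - flux p l V) - (vs \<bullet> Bs) * (mag U $ l - mag V $ l)
    = vel U $ l * K - vel V $ l * K' + (Z * ((norm b)\<^sup>2 / 2) - Z * ((norm b')\<^sup>2 / 2)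
      - (X $ l + X' $ l) / (r + r') * ((norm b)\<^sup>2 / 2 - (norm b')\<^sup>2 / 2)) + Q - Q'" .
  \<comment> \<open>As mag U - mag V = b - b', the difference of magnetic energies is (mag U - mag
    V) . (b + b') / 2. Its factor is at most |X + X'| / (r + r'), so Young's inequality applied to
    |X + X'| |b + b'| leaves \<open>d\<close> times the energies.\<close>
  have t1: "- ((X $ l + X' $ l) / (r + r') * ((norm b)\<^sup>2 / 2 - (norm b')\<^sup>2 / 2))
      \<le> d * (K + (norm b)\<^sup>2 / 2 + (K' + (norm b')\<^sup>2 / 2))"
  proof -
    have "(norm b)\<^sup>2 / 2 - (norm b')\<^sup>2 / 2 = ((mag U - mag V) \<bullet> (b + b')) / 2"
    proof -
      have "mag U - mag V = b - b'" by (simp add: b_def b'_def)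
      moreover have "(b - b') \<bullet> (b + b') = b \<bullet> b - b' \<bullet> b'"
        unfolding inner_diff_left inner_add_right by (simp add: inner_commute[of b' b])
      ultimately show ?thesis by (simp add: power2_norm_eq_inner diff_divide_distrib)
    qed
    then have "\<bar>(norm b)\<^sup>2 / 2 - (norm b')\<^sup>2 / 2\<bar> \<le> norm (mag U - mag V) * norm (b + b') / 2"
      using Cauchy_Schwarz_ineq2[of "mag U - mag V" "b + b'"] by linarith
    moreover have "\<bar>(X $ l + X' $ l) / (r + r')\<bar> \<le> norm (X + X') / (r + r')"
      using component_le_norm_cart[of "X + X'" l] r by (simp add: divide_right_mono)
    ultimately have "\<bar>(X $ l + X' $ l) / (r + r') * ((norm b)\<^sup>2 / 2 - (norm b')\<^sup>2 / 2)\<bar>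
        \<le> norm (X + X') / (r + r') * (norm (mag U - mag V) * norm (b + b') / 2)"
      unfolding abs_mult using r by (intro mult_mono) auto
    also have "\<dots> = d * (norm (X + X') * norm (b + b') / 2)" by (simp add: d_def)
    also have "\<dots> \<le> d * (((norm (X + X'))\<^sup>2 + (norm (b + b'))\<^sup>2) / 4)"
      using sum_squares_bound[of "norm (X + X')" "norm (b + b')"] r
      by (intro mult_left_mono) (auto simp: d_def)
    also have "\<dots> \<le> d * (K + (norm b)\<^sup>2 / 2 + (K' + (norm b')\<^sup>2 / 2))"
    proof (rule mult_left_mono)
      have "(norm (x + y))\<^sup>2 \<le> 2 * (norm x)\<^sup>2 + 2 * (norm y)\<^sup>2" for x y :: "real^3"
        using zero_le_power2[of "norm (x - y)"]
        by (simp add: power2_norm_eq_inner inner_simps inner_commute)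
      from this[of X X'] this[of b b'] K
      show "((norm (X + X'))\<^sup>2 + (norm (b + b'))\<^sup>2) / 4 \<le> K + (norm b)\<^sup>2 / 2 + (K' + (norm b')\<^sup>2 / 2)"
        by (simp add: field_simps)
    qed (use r in \<open>auto simp: d_def\<close>)
    finally show ?thesis by linarith
  qed
  have t2: "vel U $ l * K \<le> \<bar>vel U $ l\<bar> * K" "- (vel V $ l) * K' \<le> \<bar>vel V $ l\<bar> * K'"
    "Z * ((norm b)\<^sup>2 / 2) \<le> \<bar>Z\<bar> * ((norm b)\<^sup>2 / 2)"
    "(- Z) * ((norm b')\<^sup>2 / 2) \<le> \<bar>Z\<bar> * ((norm b')\<^sup>2 / 2)"
    using K0 by (intro mult_right_mono; simp; fail)+
  have *: "dual_vec vs Bs \<bullet> (flux p l U - flux p l V) - (vs \<bullet> Bs) * (mag U $ l - mag V $ l)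
      \<le> (\<bar>vel U $ l\<bar> + c) * K + (\<bar>vel V $ l\<bar> + c') * K' + (\<bar>Z\<bar> + c) * ((norm b)\<^sup>2 / 2)
        + (\<bar>Z\<bar> + c') * ((norm b')\<^sup>2 / 2) + d * (K + (norm b)\<^sup>2 / 2 + (K' + (norm b')\<^sup>2 / 2))"
    using Q t1 t2 unfolding split unfolding ring_distribs by linarith
  have "(\<bar>vel U $ l\<bar> + c) * K \<le> m * K" "(\<bar>vel V $ l\<bar> + c') * K' \<le> m * K'"
      "(\<bar>Z\<bar> + c) * ((norm b)\<^sup>2 / 2) \<le> m * ((norm b)\<^sup>2 / 2)"
      "(\<bar>Z\<bar> + c') * ((norm b')\<^sup>2 / 2) \<le> m * ((norm b')\<^sup>2 / 2)"
    using m K0 by (intro mult_right_mono; simp; fail)+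
  then show ?thesis unfolding wb e using * unfolding ring_distribs by linarith
qed

text \<open>Needed for the density test, where the flux is simply \<rho> times the normal
  velocity.\<close>

lemma wave_bound_ge_speed:
  assumes U: "U \<in> admissible" and V: "V \<in> admissible"
  shows "\<bar>vel U $ l\<bar> \<le> wave_bound p l U V" "\<bar>vel V $ l\<bar> \<le> wave_bound p l U V"
proof -
  define S where "S = {\<bar>vel U $ l\<bar> + char_speed p l U,
         \<bar>vel V $ l\<bar> + char_speed p l V,
         \<bar>sqrt (rho U) * vel U $ l + sqrt (rho V) * vel V $ l\<bar> / (sqrt (rho U) + sqrt (rho V))
           + max (char_speed p l U) (char_speed p l V)}"
  have "\<bar>vel U $ l\<bar> + char_speed p l U \<le> Max S" "\<bar>vel V $ l\<bar> + char_speed p l V \<le> Max S"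
    unfolding S_def by (rule Max_ge; simp)+
  moreover have "norm (mag U - mag V) / (sqrt (rho U) + sqrt (rho V)) \<ge> 0"
    using U V by (simp add: admissible_def)
  ultimately show "\<bar>vel U $ l\<bar> \<le> wave_bound p l U V" "\<bar>vel V $ l\<bar> \<le> wave_bound p l U V"
    using char_speed_nonneg[OF U, of p l] char_speed_nonneg[OF V, of p l]
    unfolding wave_bound_def S_def[symmetric] by linarith+
qed

lemma source_dual_bound:
  assumes U: "U \<in> admissible"
  shows "\<bar>dual_vec vs Bs \<bullet> source U + vs \<bullet> Bs\<bar> \<le> dual_energy vs Bs U / sqrt (rho U)"
proof -
  define r where "r = sqrt (rho U)"
  have r: "r > 0" "r\<^sup>2 = rho U" using U by (simp_all add: r_def admissible_def)
  have "dual_vec vs Bs \<bullet> source U + vs \<bullet> Bs = (vel U - vs) \<bullet> (mag U - Bs)"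
    by (simp add: source_def dual_vec_inner inner_simps inner_commute)
  also have "\<bar>\<dots>\<bar> \<le> (r * norm (vel U - vs)) * norm (mag U - Bs) / r"
    using Cauchy_Schwarz_ineq2[of "vel U - vs" "mag U - Bs"] r by simp
  also have "\<dots> \<le> ((r * norm (vel U - vs))\<^sup>2 + (norm (mag U - Bs))\<^sup>2) / 2 / r"
    using sum_squares_bound[of "r * norm (vel U - vs)" "norm (mag U - Bs)"] r
    by (intro divide_right_mono) auto
  also have "\<dots> \<le> dual_energy vs Bs U / r"
    using U r by (intro divide_right_mono)
      (auto simp: dual_energy_eq admissible_def power_mult_distrib add_divide_distrib)
  finally show ?thesis unfolding r_def .
qed

section \<open>Gauss and Gauss--Lobatto quadrature\<close>

lemma integral_poly_pos:
  fixes q :: "real poly"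
  assumes "q \<noteq> 0" and nonneg: "\<And>x. x \<in> {0..1} \<Longrightarrow> poly q x \<ge> 0"
  shows "integral {0..1} (poly q) > 0"
proof -
  have cont: "continuous_on {0..1} (poly q)" by (intro continuous_intros)
  have "integral {0..1} (poly q) \<noteq> 0"
  proof
    assume "integral {0..1} (poly q) = 0"
    then have "(poly q has_integral 0) (cbox 0 1)"
      using integrable_integral[OF integrable_continuous_real[OF cont]] by simp
    then have "poly q x = 0" if "x \<in> {0..1}" for x
      using has_integral_0_cbox_imp_0[of 0 1 "poly q" x] cont nonneg that by auto
    then have "{0..1} \<subseteq> {x. poly q x = 0}" by blast
    then show False
      using poly_roots_finite[OF assms(1)] infinite_Icc[of 0 "1::real"] by (simp add: finite_subset)
  qed
  moreover have "integral {0..1} (poly q) \<ge> 0"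
    using integrable_continuous_real[OF cont] nonneg by (rule integral_nonneg)
  ultimately show ?thesis by simp
qed

lemma quadrature_ruleD:
  "quadrature_rule n d \<xi> \<omega> \<Longrightarrow> degree q \<le> d \<Longrightarrow>
    (\<Sum>\<mu>=1..n. \<omega> \<mu> * poly q (\<xi> \<mu>)) = integral {0..1} (poly q)"
  by (simp add: quadrature_rule_def)

lemma quadrature_node_bounds:
  "quadrature_rule n d \<xi> \<omega> \<Longrightarrow> \<mu> \<in> {1..n} \<Longrightarrow> 0 \<le> \<xi> \<mu> \<and> \<xi> \<mu> \<le> 1"
  unfolding quadrature_rule_def by (metis atLeastAtMost_iff image_subset_iff)

lemma quadrature_nodes_inj: "quadrature_rule n d \<xi> \<omega> \<Longrightarrow> inj_on \<xi> {1..n}"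
  by (simp add: quadrature_rule_def strict_mono_on_imp_inj_on)

text \<open>The rule applied to q collapses to the single node \<mu>, and the integral of q is
  positive.\<close>

lemma quadrature_weight_pos:
  assumes rule: "quadrature_rule n d \<xi> \<omega>" and \<mu>: "\<mu> \<in> {1..n}"
    and q: "degree q \<le> d" "q \<noteq> 0" "\<And>x. x \<in> {0..1} \<Longrightarrow> poly q x \<ge> 0"
    and zero: "\<And>j. j \<in> {1..n} \<Longrightarrow> j \<noteq> \<mu> \<Longrightarrow> poly q (\<xi> j) = 0"
  shows "\<omega> \<mu> > 0"
proof -
  have "0 < (\<Sum>j=1..n. \<omega> j * poly q (\<xi> j))"
    using integral_poly_pos[OF q(2,3)] quadrature_ruleD[OF rule q(1)] by simp
  also have "\<dots> = \<omega> \<mu> * poly q (\<xi> \<mu>)"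
    using \<mu> zero by (subst sum.remove[of _ \<mu>]) auto
  finally show ?thesis
    using q(3)[of "\<xi> \<mu>"] quadrature_node_bounds[OF rule \<mu>] by (auto simp: zero_less_mult_iff)
qed

section \<open>Nodal polynomials: positive weights and interior Gauss nodes\<close>

definition root_poly :: "(nat \<Rightarrow> real) \<Rightarrow> nat set \<Rightarrow> real poly" where
  "root_poly \<xi> S = (\<Prod>j\<in>S. [:- \<xi> j, 1:])"

lemma root_poly_nz: "finite S \<Longrightarrow> root_poly \<xi> S \<noteq> 0"
  by (simp add: root_poly_def)

lemma degree_root_poly: "degree (root_poly \<xi> S) = card S"
  by (cases "finite S") (simp_all add: root_poly_def degree_prod_eq_sum_degree)

lemma lead_coeff_root_poly: "lead_coeff (root_poly \<xi> S) = 1"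
  by (simp add: root_poly_def lead_coeff_prod)

lemma poly_root_poly: "poly (root_poly \<xi> S) x = (\<Prod>j\<in>S. x - \<xi> j)"
  by (simp add: root_poly_def poly_prod)

lemma root_poly_zero: "finite S \<Longrightarrow> j \<in> S \<Longrightarrow> poly (root_poly \<xi> S) (\<xi> j) = 0"
  by (auto simp: poly_root_poly)

lemma gauss_weight_pos:
  assumes "gauss_rule n \<xi> \<omega>" "\<mu> \<in> {1..n}"
  shows "\<omega> \<mu> > 0"
proof (rule quadrature_weight_pos[OF _ assms(2)])
  let ?q = "root_poly \<xi> ({1..n} - {\<mu>}) ^ 2"
  show "quadrature_rule n (2 * n - 1) \<xi> \<omega>" using assms(1) by (simp add: gauss_rule_def)
  show "degree ?q \<le> 2 * n - 1" using assms(2) by (simp add: degree_power_eq root_poly_nz degree_root_poly)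
  show "?q \<noteq> 0" by (simp add: root_poly_nz)
  show "poly ?q x \<ge> 0" for x by (simp add: poly_power)
  show "poly ?q (\<xi> j) = 0" if "j \<in> {1..n}" "j \<noteq> \<mu>" for j
    using that by (simp add: poly_power root_poly_zero)
qed

text \<open>If an end point were a node, the squared nodal polynomial of the other nodes times x or
  1 - x would have degree 2 n - 1, vanish at all nodes and yet have a positive integral. Interiority
  matters because elements of the spaces are unconstrained on cell interfaces.\<close>

lemma gauss_node_interior:
  assumes g: "gauss_rule n \<xi> \<omega>" and \<mu>: "\<mu> \<in> {1..n}"
  shows "0 < \<xi> \<mu>" "\<xi> \<mu> < 1"
proof -
  have rule: "quadrature_rule n (2 * n - 1) \<xi> \<omega>" using g by (simp add: gauss_rule_def)
  have ne: "poly l (\<xi> \<mu>) \<noteq> 0"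
    if l: "degree l = 1" "\<And>x. x \<in> {0..1} \<Longrightarrow> poly l x \<ge> 0" for l
  proof
    assume l0: "poly l (\<xi> \<mu>) = 0"
    define q where "q = root_poly \<xi> ({1..n} - {\<mu>}) ^ 2 * l"
    have "l \<noteq> 0" using l(1) by auto
    then have "q \<noteq> 0" by (simp add: q_def root_poly_nz)
    moreover have "poly q x \<ge> 0" if "x \<in> {0..1}" for x
      using l(2)[OF that] by (simp add: q_def poly_power)
    ultimately have pos: "integral {0..1} (poly q) > 0" by (rule integral_poly_pos)
    have "degree q \<le> 2 * n - 1"
      using \<mu> \<open>l \<noteq> 0\<close>
      by (auto simp: q_def degree_mult_eq degree_power_eq root_poly_nz degree_root_poly l(1))
    from quadrature_ruleD[OF rule this] pos
    have "(\<Sum>j=1..n. \<omega> j * poly q (\<xi> j)) \<noteq> 0" by simp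
    moreover have "poly q (\<xi> j) = 0" if "j \<in> {1..n}" for j
      using that l0 by (cases "j = \<mu>") (auto simp: q_def poly_power root_poly_zero)
    ultimately show False by simp
  qed
  show "0 < \<xi> \<mu>" "\<xi> \<mu> < 1"
    using ne[of "[:0, 1:]"] ne[of "[:1, -1:]"] quadrature_node_bounds[OF rule \<mu>] by auto
qed

lemma lobatto_weight_pos:
  assumes g: "gauss_lobatto_rule n \<eta> \<omega>" and n: "n \<ge> 2" and \<nu>: "\<nu> \<in> {1..n}"
  shows "\<omega> \<nu> > 0"
proof -
  have rule: "quadrature_rule n (2 * n - 3) \<eta> \<omega>" and ends: "\<eta> 1 = 0" "\<eta> n = 1"
    using g by (simp_all add: gauss_lobatto_rule_def)
  \<comment> \<open>Interior nodes are cancelled by squares, end points by the factors x and 1 - x,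
    which are already nonnegative on the interval. The degree is 2 n - 3 if \<nu> is an end and 2 n
    - 4 otherwise.\<close>
  define S where "S = {2..<n} - {\<nu>}"
  have S: "finite S" "card S = (if \<nu> = 1 \<or> \<nu> = n then n - 2 else n - 3)"
    using n \<nu> by (auto simp: S_def)
  define l where "l = (if \<nu> = 1 then 1 else [:0, 1:]) * (if \<nu> = n then 1 else [:1, -1::real:])"
  have l: "l \<noteq> 0" "degree l = (if \<nu> = 1 \<or> \<nu> = n then 1 else 2)"
    using n by (auto simp: l_def)
  have "degree (root_poly \<eta> S ^ 2 * l) = 2 * card S + degree l"
    using S(1) l(1) by (simp add: degree_mult_eq degree_power_eq root_poly_nz degree_root_poly)
  also have "\<dots> \<le> 2 * n - 3"
  proof (cases "\<nu> = 1 \<or> \<nu> = n")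
    case False
    then have "n \<ge> 3" using \<nu> by auto
    then show ?thesis using S(2) l(2) False by simp
  qed (use S(2) l(2) n in simp)
  finally have deg: "degree (root_poly \<eta> S ^ 2 * l) \<le> 2 * n - 3" .
  show ?thesis
  proof (rule quadrature_weight_pos[OF rule \<nu> deg])
    show "root_poly \<eta> S ^ 2 * l \<noteq> 0" using S(1) l(1) by (simp add: root_poly_nz)
    show "poly (root_poly \<eta> S ^ 2 * l) x \<ge> 0" if "x \<in> {0..1}" for x
      using that by (auto simp: poly_power l_def)
    show "poly (root_poly \<eta> S ^ 2 * l) (\<eta> j) = 0" if "j \<in> {1..n}" "j \<noteq> \<nu>" for j
    proof (cases "j \<in> S")
      case True
      then show ?thesis using S(1) by (simp add: root_poly_zero poly_power)
    next
      case False
      then have "j = 1 \<or> j = n" using that by (auto simp: S_def)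
      then show ?thesis using that(2) ends by (auto simp: l_def)
    qed
  qed
qed

section \<open>Symmetry of the Gauss-Lobatto end weights\<close>

lemma integral_reflect_unit: "integral {0..1} (\<lambda>x. f (1 - x)) = integral {0..1} (f :: real \<Rightarrow> real)"
proof -
  have "integral {0..1} (\<lambda>x. f (1 - x)) = integral {-1..0} (\<lambda>x. f (1 + x))"
    using Henstock_Kurzweil_Integration.integral_reflect_real[of 0 "-1" "\<lambda>x. f (1 + x)"] by simp
  also have "\<dots> = integral {0..1} f"
    using integral_shift_Icc_real[of "-1" 0 f 1] by (simp add: o_def)
  finally show ?thesis .
qed

lemma quadrature_rule_reflect:
  assumes "quadrature_rule n d \<xi> \<omega>" "degree q \<le> d"
  shows "(\<Sum>\<mu>=1..n. \<omega> \<mu> * poly q (1 - \<xi> \<mu>)) = integral {0..1} (poly q)"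
proof -
  have "degree (pcompose q [:1, -1:]) \<le> d" using assms(2) by (simp add: degree_pcompose)
  from quadrature_ruleD[OF assms(1) this]
  have "(\<Sum>\<mu>=1..n. \<omega> \<mu> * poly q (1 - \<xi> \<mu>)) = integral {0..1} (poly (pcompose q [:1, -1:]))"
    by (simp add: poly_pcompose)
  also have "poly (pcompose q [:1, -1:]) = (\<lambda>x. poly q (1 - x))" by (simp add: poly_pcompose fun_eq_iff)
  finally show ?thesis using integral_reflect_unit[of "poly q"] by simp
qed

text \<open>The interior nodes and their mirror images are the zeros of two monic polynomials \<open>f\<close> and \<open>g\<close>
  orthogonal to \<open>f - g\<close> with weight \<open>x (1 - x)\<close>, hence \<open>f = g\<close>.\<close>

lemma lobatto_end_weights_eq:
  assumes g: "gauss_lobatto_rule n \<eta> \<omega>" and n: "n \<ge> 2"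
  shows "\<omega> 1 = \<omega> n"
proof -
  have rule: "quadrature_rule n (2 * n - 3) \<eta> \<omega>" and ends: "\<eta> 1 = 0" "\<eta> n = 1"
    using g by (simp_all add: gauss_lobatto_rule_def)
  define f where "f = root_poly \<eta> {2..<n}"
  define g where "g = root_poly (\<lambda>j. 1 - \<eta> j) {2..<n}"
  define l where "l = [:0, 1, -1::real:]"
  have nodes: "j \<in> {2..<n} \<or> j = 1 \<or> j = n" if "j \<in> {1..n}" for j using that by auto
  have deg: "degree f = n - 2" "degree g = n - 2" by (simp_all add: f_def g_def degree_root_poly)
  have fz: "poly f (\<eta> j) = 0" "poly g (1 - \<eta> j) = 0" if "j \<in> {2..<n}" for j
    using that root_poly_zero[of "{2..<n}" j \<eta>] root_poly_zero[of "{2..<n}" j "\<lambda>j. 1 - \<eta> j"]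
    by (simp_all add: f_def g_def)
  have "f = g"
  proof (cases "n = 2")
    case True
    then show ?thesis by (simp add: f_def g_def root_poly_def)
  next
    case False
    then have n3: "n \<ge> 3" using n by simp
    have small: "degree (f - g) \<le> n - 3"
    proof (rule degree_le, intro allI impI)
      fix i assume "n - 3 < i"
      then consider "i = n - 2" | "i > n - 2" by linarith
      then show "coeff (f - g) i = 0"
      proof cases
        case 1
        then show ?thesis
          using lead_coeff_root_poly[of \<eta> "{2..<n}"] lead_coeff_root_poly[of "\<lambda>j. 1 - \<eta> j" "{2..<n}"] deg
          by (simp add: f_def g_def)
      next
        case 2
        then show ?thesis using deg by (simp add: coeff_eq_0)
      qed
    qed
    \<comment> \<open>The degree is at most (n - 3) + (n - 2) + 2 = 2 n - 3, exactly the exactness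
      of the rule; one degree is gained since the leading terms of the monic f and g cancel.\<close>
    have "degree ((f - g) * h * l) \<le> 2 * n - 3" if "degree h = n - 2" for h
    proof -
      have "degree ((f - g) * h * l) \<le> degree (f - g) + degree h + degree l"
        using degree_mult_le[of "(f - g) * h" l] degree_mult_le[of "f - g" h] by linarith
      then show ?thesis using small that n3 by (simp add: l_def)
    qed
    then have d: "degree ((f - g) * f * l) \<le> 2 * n - 3" "degree ((f - g) * g * l) \<le> 2 * n - 3"
      using deg by auto
    have "poly ((f - g) * f * l) (\<eta> j) = 0" "poly ((f - g) * g * l) (1 - \<eta> j) = 0" if "j \<in> {1..n}" for j
      using nodes[OF that] ends by (auto simp: fz l_def)
    then have "integral {0..1} (poly ((f - g) * f * l)) = 0" "integral {0..1} (poly ((f - g) * g * l)) = 0"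
      unfolding quadrature_ruleD[OF rule d(1), symmetric] quadrature_rule_reflect[OF rule d(2), symmetric]
      by (intro sum.neutral ballI; simp del: poly_mult)+
    moreover have "poly ((f - g) ^ 2 * l) = (\<lambda>x. poly ((f - g) * f * l) x - poly ((f - g) * g * l) x)"
      by (simp add: fun_eq_iff power2_eq_square algebra_simps)
    moreover have "integral {0..1} (\<lambda>x. poly ((f - g) * f * l) x - poly ((f - g) * g * l) x) =
        integral {0..1} (poly ((f - g) * f * l)) - integral {0..1} (poly ((f - g) * g * l))"
      by (intro integral_diff integrable_continuous_real continuous_intros)
    ultimately have "integral {0..1} (poly ((f - g) ^ 2 * l)) = 0" by simp
    moreover have "poly ((f - g) ^ 2 * l) x \<ge> 0" if "x \<in> {0..1}" for x
    proof -
      have "poly l x = x * (1 - x)" by (simp add: l_def algebra_simps)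
      then show ?thesis using that by (simp add: poly_power)
    qed
    ultimately have "(f - g) ^ 2 * l = 0"
      using integral_poly_pos[of "(f - g) ^ 2 * l"] by force
    moreover have "l \<noteq> 0" by (simp add: l_def)
    ultimately show "f = g" by simp
  qed
  \<comment> \<open>The test polynomial f^2 x vanishes at every node but the right end. Since f = g,
    its values at the mirrored nodes vanish except for the image of the left end, so both end
    weights are read off from the same integral.\<close>
  have dx: "degree (f ^ 2 * [:0, 1:]) \<le> 2 * n - 3"
    using n deg root_poly_nz[of "{2..<n}" \<eta>] by (simp add: degree_mult_eq degree_power_eq f_def del: mult_pCons_right)
  have end_sum: "(\<Sum>j=1..n. \<omega> j * h j) = \<omega> i * h i" if "i \<in> {1..n}" "\<And>j. j \<in> {1..n} \<Longrightarrow> j \<noteq> i \<Longrightarrow> h j = 0" for h i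
    using that by (subst sum.remove[of _ i]) auto
  have fj: "poly f (\<eta> j) = 0 \<or> \<eta> j = 0" if "j \<in> {1..n}" "j \<noteq> n" for j
    using nodes[OF that(1)] that(2) fz(1)[of j] ends by auto
  have gj: "poly f (1 - \<eta> j) = 0 \<or> \<eta> j = 1" if "j \<in> {1..n}" "j \<noteq> 1" for j
    using nodes[OF that(1)] that(2) fz(2)[of j] ends \<open>f = g\<close> by auto
  have wn: "\<omega> n * poly (f ^ 2 * [:0, 1:]) (\<eta> n) = integral {0..1} (poly (f ^ 2 * [:0, 1:]))"
    unfolding quadrature_ruleD[OF rule dx, symmetric]
    by (rule end_sum[symmetric]) (use n fj in \<open>auto simp: poly_power\<close>)
  have w1: "\<omega> 1 * poly (f ^ 2 * [:0, 1:]) (1 - \<eta> 1) = integral {0..1} (poly (f ^ 2 * [:0, 1:]))"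
    unfolding quadrature_rule_reflect[OF rule dx, symmetric]
    by (rule end_sum[symmetric]) (use n gj in \<open>auto simp: poly_power\<close>)
  have "poly f 1 \<noteq> 0"
  proof -
    have "\<eta> j \<noteq> \<eta> n" if "j \<in> {2..<n}" for j
      using inj_onD[OF quadrature_nodes_inj[OF rule], of j n] that n by force
    then show ?thesis using ends by (auto simp: f_def poly_root_poly)
  qed
  have f1: "poly (f ^ 2 * [:0, 1:]) 1 = (poly f 1)\<^sup>2" by (simp add: poly_power)
  have "\<omega> n * (poly f 1)\<^sup>2 = \<omega> 1 * (poly f 1)\<^sup>2"
    using wn w1 unfolding ends diff_zero f1 by simp
  then show ?thesis using \<open>poly f 1 \<noteq> 0\<close> by simp
qed

section \<open>Quadrature of polynomials in two variables\<close>

definition poly_fun :: "nat \<Rightarrow> (real \<Rightarrow> real) \<Rightarrow> bool" where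
  "poly_fun k f \<longleftrightarrow> (\<exists>q. degree q \<le> k \<and> f = poly q)"

lemma poly_fun_sum:
  assumes "\<And>i. i \<in> I \<Longrightarrow> poly_fun k (f i)"
  shows "poly_fun k (\<lambda>x. \<Sum>i\<in>I. c i * f i x)"
proof -
  from assms obtain q where q: "\<And>i. i \<in> I \<Longrightarrow> degree (q i) \<le> k \<and> f i = poly (q i)"
    unfolding poly_fun_def by metis
  have "degree (\<Sum>i\<in>I. smult (c i) (q i)) \<le> k"
    using q by (cases "finite I") (auto intro!: degree_sum_le order_trans[OF degree_smult_le])
  moreover have "(\<lambda>x. \<Sum>i\<in>I. c i * f i x) = poly (\<Sum>i\<in>I. smult (c i) (q i))"
    using q by (auto simp: poly_sum fun_eq_iff)
  ultimately show ?thesis unfolding poly_fun_def by blast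
qed

lemma quadrature_interval:
  assumes rule: "quadrature_rule n d \<xi> \<omega>" and f: "poly_fun k f" and "k \<le> d" and h: "h > 0"
  shows "(f has_integral h * (\<Sum>\<mu>=1..n. \<omega> \<mu> * f (x0 + h * \<xi> \<mu>))) {x0..x0 + h}"
proof -
  obtain q where q: "degree q \<le> k" "f = poly q" using f by (auto simp: poly_fun_def)
  let ?q = "pcompose q [:x0, h:]"
  have "degree ?q \<le> d" using q(1) \<open>k \<le> d\<close> h by (simp add: degree_pcompose)
  from quadrature_ruleD[OF rule this]
  have "integral {0..1} (poly ?q) = (\<Sum>\<mu>=1..n. \<omega> \<mu> * f (x0 + h * \<xi> \<mu>))"
    by (simp add: poly_pcompose q(2) mult.commute)
  moreover have "poly ?q integrable_on {0..1}"
    by (intro integrable_continuous_real continuous_intros)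
  ultimately have "(poly ?q has_integral (\<Sum>\<mu>=1..n. \<omega> \<mu> * f (x0 + h * \<xi> \<mu>))) (cbox 0 1)"
    using integrable_integral by fastforce
  from has_integral_affinity'[OF this, of "1/h" "- x0 / h"] h
  show ?thesis by (simp add: poly_pcompose q(2) field_simps) (simp add: add_divide_distrib add.commute)
qed

text \<open>The fundamental theorem of calculus, with the integral of the derivative evaluated
  exactly by the rule.\<close>

lemma poly_fun_increment:
  assumes rule: "quadrature_rule n d \<xi> \<omega>" and f: "poly_fun k f" and "k \<le> d" and h: "h > 0"
  shows "f (x0 + h) - f x0 = h * (\<Sum>\<mu>=1..n. \<omega> \<mu> * deriv f (x0 + h * \<xi> \<mu>))"
proof -
  obtain q where q: "degree q \<le> k" "f = poly q" using f by (auto simp: poly_fun_def)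
  have d: "deriv f = poly (pderiv q)"
    unfolding q(2) by (intro ext DERIV_imp_deriv poly_DERIV)
  have "poly_fun k (deriv f)"
    unfolding d poly_fun_def using q(1) by (intro exI[of _ "pderiv q"]) (simp add: degree_pderiv)
  from quadrature_interval[OF rule this \<open>k \<le> d\<close> h, of x0]
  have "(deriv f has_integral h * (\<Sum>\<mu>=1..n. \<omega> \<mu> * deriv f (x0 + h * \<xi> \<mu>))) {x0..x0 + h}" .
  moreover have "(deriv f has_integral f (x0 + h) - f x0) {x0..x0 + h}"
    unfolding d unfolding q(2) using h
    by (intro fundamental_theorem_of_calculus)
      (auto simp flip: has_real_derivative_iff_has_vector_derivative intro: DERIV_subset[OF poly_DERIV])
  ultimately show ?thesis by (rule has_integral_unique[symmetric])
qed

text \<open>Exactly what product rules require: a degree bound in each variable separately for the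
  iterated one-dimensional rules, and joint continuity for Fubini.\<close>

definition bipoly :: "nat \<Rightarrow> (real \<times> real \<Rightarrow> real) \<Rightarrow> bool" where
  "bipoly k P \<longleftrightarrow> (\<forall>y. poly_fun k (\<lambda>x. P (x, y))) \<and> (\<forall>x. poly_fun k (\<lambda>y. P (x, y))) \<and>
    continuous_on UNIV P"

lemma bipoly_quadrature:
  assumes rx: "quadrature_rule m d \<eta> \<omega>'" "k \<le> d" and ry: "quadrature_rule n d' \<xi> \<omega>" "k \<le> d'"
    and P: "bipoly k P" and h: "hx > 0" "hy > 0"
  shows "(P has_integral hx * hy *
      (\<Sum>\<nu>=1..m. \<Sum>\<mu>=1..n. \<omega>' \<nu> * \<omega> \<mu> * P (x0 + hx * \<eta> \<nu>, y0 + hy * \<xi> \<mu>)))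
    (cbox (x0, y0) (x0 + hx, y0 + hy))"
proof -
  have cont: "continuous_on (cbox (x0, y0) (x0 + hx, y0 + hy)) P"
    using P continuous_on_subset by (auto simp: bipoly_def)
  have inner: "integral (cbox y0 (y0 + hy)) (\<lambda>y. P (x, y)) = hy * (\<Sum>\<mu>=1..n. \<omega> \<mu> * P (x, y0 + hy * \<xi> \<mu>))" for x
    unfolding cbox_interval using P
    by (intro integral_unique quadrature_interval[OF ry(1) _ ry(2) h(2)]) (simp add: bipoly_def)
  let ?g = "\<lambda>x. \<Sum>\<mu>=1..n. (hy * \<omega> \<mu>) * P (x, y0 + hy * \<xi> \<mu>)"
  have "poly_fun k ?g" using P by (intro poly_fun_sum) (simp add: bipoly_def)
  from quadrature_interval[OF rx(1) this rx(2) h(1), of x0]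
  have "integral (cbox x0 (x0 + hx)) ?g = hx * (\<Sum>\<nu>=1..m. \<omega>' \<nu> * ?g (x0 + hx * \<eta> \<nu>))"
    by (intro integral_unique) simp
  then have "integral (cbox (x0, y0) (x0 + hx, y0 + hy)) P = hx * (\<Sum>\<nu>=1..m. \<omega>' \<nu> * ?g (x0 + hx * \<eta> \<nu>))"
    unfolding integral_prod_continuous[OF cont] inner by (simp add: sum_distrib_left mult.assoc)
  also have "\<dots> = hx * hy * (\<Sum>\<nu>=1..m. \<Sum>\<mu>=1..n. \<omega>' \<nu> * \<omega> \<mu> * P (x0 + hx * \<eta> \<nu>, y0 + hy * \<xi> \<mu>))"
    by (simp add: sum_distrib_left ac_simps)
  finally show ?thesis
    using integrable_integral[OF integrable_continuous[OF cont]] by simp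
qed

text \<open>A discrete divergence theorem. Writing each increment as a Gauss sum of derivatives
  turns both face sums into sums over the same tensor grid, where the divergence is only needed at
  the nodes.\<close>

lemma bipoly_div_free:
  assumes rule: "quadrature_rule n d \<xi> \<omega>" "k \<le> d" and P: "bipoly k P" and Q: "bipoly k Q"
    and h: "hx > 0" "hy > 0"
    and div: "\<And>\<mu> \<nu>. \<mu> \<in> {1..n} \<Longrightarrow> \<nu> \<in> {1..n} \<Longrightarrow>
      deriv (\<lambda>t. P (t, y0 + hy * \<xi> \<nu>)) (x0 + hx * \<xi> \<mu>) + deriv (\<lambda>t. Q (x0 + hx * \<xi> \<mu>, t)) (y0 + hy * \<xi> \<nu>) = 0"
  shows "(\<Sum>\<mu>=1..n. \<omega> \<mu> * (P (x0 + hx, y0 + hy * \<xi> \<mu>) - P (x0, y0 + hy * \<xi> \<mu>))) / hx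
    + (\<Sum>\<mu>=1..n. \<omega> \<mu> * (Q (x0 + hx * \<xi> \<mu>, y0 + hy) - Q (x0 + hx * \<xi> \<mu>, y0))) / hy = 0"
proof -
  let ?p = "\<lambda>\<mu> \<nu>. deriv (\<lambda>t. P (t, y0 + hy * \<xi> \<nu>)) (x0 + hx * \<xi> \<mu>)"
  let ?q = "\<lambda>\<mu> \<nu>. deriv (\<lambda>t. Q (x0 + hx * \<xi> \<mu>, t)) (y0 + hy * \<xi> \<nu>)"
  have p: "P (x0 + hx, y0 + hy * \<xi> \<nu>) - P (x0, y0 + hy * \<xi> \<nu>) = hx * (\<Sum>\<mu>=1..n. \<omega> \<mu> * ?p \<mu> \<nu>)" for \<nu>
    using P by (intro poly_fun_increment[OF rule(1) _ rule(2) h(1)]) (simp add: bipoly_def)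
  have q: "Q (x0 + hx * \<xi> \<mu>, y0 + hy) - Q (x0 + hx * \<xi> \<mu>, y0) = hy * (\<Sum>\<nu>=1..n. \<omega> \<nu> * ?q \<mu> \<nu>)" for \<mu>
    using Q by (intro poly_fun_increment[OF rule(1) _ rule(2) h(2)]) (simp add: bipoly_def)
  have "(\<Sum>\<nu>=1..n. \<omega> \<nu> * (P (x0 + hx, y0 + hy * \<xi> \<nu>) - P (x0, y0 + hy * \<xi> \<nu>))) / hx
      = (\<Sum>\<nu>=1..n. \<Sum>\<mu>=1..n. \<omega> \<nu> * \<omega> \<mu> * ?p \<mu> \<nu>)"
    unfolding p using h by (simp add: sum_divide_distrib sum_distrib_left mult.assoc)
  also have "\<dots> = (\<Sum>\<mu>=1..n. \<Sum>\<nu>=1..n. \<omega> \<nu> * \<omega> \<mu> * ?p \<mu> \<nu>)" by (rule sum.swap)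
  finally have 1: "(\<Sum>\<nu>=1..n. \<omega> \<nu> * (P (x0 + hx, y0 + hy * \<xi> \<nu>) - P (x0, y0 + hy * \<xi> \<nu>))) / hx
      = (\<Sum>\<mu>=1..n. \<Sum>\<nu>=1..n. \<omega> \<nu> * \<omega> \<mu> * ?p \<mu> \<nu>)" .
  have 2: "(\<Sum>\<mu>=1..n. \<omega> \<mu> * (Q (x0 + hx * \<xi> \<mu>, y0 + hy) - Q (x0 + hx * \<xi> \<mu>, y0))) / hy
      = (\<Sum>\<mu>=1..n. \<Sum>\<nu>=1..n. \<omega> \<nu> * \<omega> \<mu> * ?q \<mu> \<nu>)"
    unfolding q using h by (simp add: sum_divide_distrib sum_distrib_left ac_simps)
  show ?thesis
    unfolding 1 2 sum.distrib[symmetric] distrib_left[symmetric] using div by simp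
qed

lemma bipoly_poly_sum:
  "bipoly k (\<lambda>z. \<Sum>a\<le>k. \<Sum>b\<le>k - a. (fst z ^ a * snd z ^ b) * c a b)"
proof -
  have mono: "poly_fun k (\<lambda>x. x ^ a)" if "a \<le> k" for a
    unfolding poly_fun_def using that
    by (intro exI[of _ "monom 1 a"]) (auto simp: poly_monom degree_monom_eq)
  have "poly_fun k (\<lambda>x. \<Sum>a\<le>k. (\<Sum>b\<le>k - a. y ^ b * c a b) * x ^ a)" for y
    by (rule poly_fun_sum) (simp add: mono)
  moreover have "(\<Sum>a\<le>k. (\<Sum>b\<le>k - a. y ^ b * c a b) * x ^ a) = (\<Sum>a\<le>k. \<Sum>b\<le>k - a. (x ^ a * y ^ b) * c a b)" for x y
    by (simp add: sum_distrib_left mult.commute mult.left_commute)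
  ultimately have 1: "poly_fun k (\<lambda>x. \<Sum>a\<le>k. \<Sum>b\<le>k - a. (x ^ a * y ^ b) * c a b)" for y
    by simp
  have "poly_fun k (\<lambda>y. \<Sum>a\<le>k. 1 * (\<Sum>b\<le>k - a. (x ^ a * c a b) * y ^ b))" for x
    by (intro poly_fun_sum mono) auto
  moreover have "(\<Sum>a\<le>k. 1 * (\<Sum>b\<le>k - a. (x ^ a * c a b) * y ^ b)) = (\<Sum>a\<le>k. \<Sum>b\<le>k - a. (x ^ a * y ^ b) * c a b)" for x y
    by (simp add: ac_simps)
  ultimately have 2: "poly_fun k (\<lambda>y. \<Sum>a\<le>k. \<Sum>b\<le>k - a. (x ^ a * y ^ b) * c a b)" for x
    by simp
  show ?thesis unfolding bipoly_def using 1 2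
    by (auto intro!: continuous_intros)
qed

section \<open>One cell and its four neighbours on the other mesh\<close>

lemma has_integral_split_fst:
  fixes f :: "real \<times> real \<Rightarrow> 'a::real_normed_vector"
  assumes "(f has_integral i) (cbox (a, c) (m, d))" "(f has_integral j) (cbox (m, c) (b, d))" "a \<le> m" "m \<le> b"
  shows "(f has_integral (i + j)) (cbox (a, c) (b, d))"
proof (rule has_integral_split[where k = "(1, 0)" and c = m])
  have "cbox (a, c) (b, d) \<inter> {x. x \<bullet> (1, 0) \<le> m} = cbox (a, c) (m, d)"
    "cbox (a, c) (b, d) \<inter> {x. m \<le> x \<bullet> (1, 0)} = cbox (m, c) (b, d)"
    using assms(3,4) by (auto simp: cbox_Pair_eq)
  then show "(f has_integral i) (cbox (a, c) (b, d) \<inter> {x. x \<bullet> (1, 0) \<le> m})"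
    "(f has_integral j) (cbox (a, c) (b, d) \<inter> {x. m \<le> x \<bullet> (1, 0)})"
    using assms(1,2) by simp_all
qed (simp add: Basis_prod_def)

lemma has_integral_split_snd:
  fixes f :: "real \<times> real \<Rightarrow> 'a::real_normed_vector"
  assumes "(f has_integral i) (cbox (a, c) (b, m))" "(f has_integral j) (cbox (a, m) (b, d))" "c \<le> m" "m \<le> d"
  shows "(f has_integral (i + j)) (cbox (a, c) (b, d))"
proof (rule has_integral_split[where k = "(0, 1)" and c = m])
  have "cbox (a, c) (b, d) \<inter> {x. x \<bullet> (0, 1) \<le> m} = cbox (a, c) (b, m)"
    "cbox (a, c) (b, d) \<inter> {x. m \<le> x \<bullet> (0, 1)} = cbox (a, m) (b, d)"
    using assms(3,4) by (auto simp: cbox_Pair_eq)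
  then show "(f has_integral i) (cbox (a, c) (b, d) \<inter> {x. x \<bullet> (0, 1) \<le> m})"
    "(f has_integral j) (cbox (a, c) (b, d) \<inter> {x. m \<le> x \<bullet> (0, 1)})"
    using assms(1,2) by simp_all
qed (simp add: Basis_prod_def)

text \<open>As inner products with fixed vectors, the components inherit what is known for every
  \<open>n \<bullet> P \<sigma> \<sigma>' z\<close>.\<close>

lemma mag_inner: "mag U $ l = (0, 0, axis l 1, 0) \<bullet> U"
  by (cases U) (simp add: mag_def inner_axis')

lemma rho_inner: "rho U = (1, 0, 0, 0) \<bullet> U"
  by (cases U) (simp add: rho_def)

lemma node_x_eq: "node_x M \<xi> q \<mu> = xpos M (q - 1/4) + dx M / 2 * \<xi> \<mu>"
  by (simp add: node_x_def xpos_def algebra_simps)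

lemma node_y_eq: "node_y M \<xi> q \<mu> = ypos M (q - 1/4) + dy M / 2 * \<xi> \<mu>"
  by (simp add: node_y_def ypos_def algebra_simps)

lemma xpos_quarter: "xpos M (q + 1/4) = xpos M (q - 1/4) + dx M / 2"
  by (simp add: xpos_def algebra_simps)

lemma ypos_quarter: "ypos M (q + 1/4) = ypos M (q - 1/4) + dy M / 2"
  by (simp add: ypos_def algebra_simps)

lemma quadrature_weights_sum: "quadrature_rule n d \<xi> \<omega> \<Longrightarrow> (\<Sum>\<mu>=1..n. \<omega> \<mu>) = 1"
proof -
  assume "quadrature_rule n d \<xi> \<omega>"
  moreover have "poly (1 :: real poly) = (\<lambda>_. 1)" by (simp add: fun_eq_iff)
  ultimately show ?thesis using quadrature_ruleD[of n d \<xi> \<omega> 1] by simp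
qed

text \<open>Inside the open box W agrees with the continuous P, and z is a limit point of that box;
  the values of W on the boundary are arbitrary.\<close>

lemma value_from_box:
  assumes "continuous_on UNIV P" "\<And>z. z \<in> box a b \<Longrightarrow> W z = P z" "box a b \<noteq> {}" "z \<in> cbox a b"
  shows "value_from (box a b) W z = P z"
  unfolding value_from_def
proof (rule tendsto_Lim)
  have "z \<in> closure (box a b)" using assms(3,4) by (simp add: closure_box)
  then show "at z within box a b \<noteq> bot"
    by (auto simp: closure_def trivial_limit_within interior_open open_box intro: interior_limit_point)
  have "(P \<longlongrightarrow> P z) (at z within box a b)"
    using assms(1) by (metis continuous_on_def tendsto_within_subset UNIV_I subset_UNIV)
  moreover have "\<forall>\<^sub>F x in at z within box a b. W x = P x"
    using assms(2) by (auto simp: eventually_at_filter)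
  ultimately show "(W \<longlongrightarrow> P z) (at z within box a b)"
    by (simp add: filterlim_cong)
qed

lemma Lim_at_right_eq:
  fixes f :: "real \<Rightarrow> 'a::t2_space"
  assumes "isCont f a" "a < b" "\<And>t. a < t \<Longrightarrow> t < b \<Longrightarrow> g t = f t"
  shows "Lim (at_right a) g = f a"
proof (rule tendsto_Lim)
  have "(f \<longlongrightarrow> f a) (at_right a)" using assms(1) by (simp add: isCont_def filterlim_at_split)
  moreover have "\<forall>\<^sub>F t in at_right a. g t = f t"
    using assms(2,3) by (auto simp: eventually_at_right_field)
  ultimately show "(g \<longlongrightarrow> f a) (at_right a)" by (simp add: filterlim_cong)
qed simp

lemma Lim_at_left_eq:
  fixes f :: "real \<Rightarrow> 'a::t2_space"
  assumes "isCont f a" "b < a" "\<And>t. b < t \<Longrightarrow> t < a \<Longrightarrow> g t = f t"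
  shows "Lim (at_left a) g = f a"
proof (rule tendsto_Lim)
  have "(f \<longlongrightarrow> f a) (at_left a)" using assms(1) by (simp add: isCont_def filterlim_at_split)
  moreover have "\<forall>\<^sub>F t in at_left a. g t = f t"
    using assms(2,3) by (auto simp: eventually_at_left_field)
  ultimately show "(g \<longlongrightarrow> f a) (at_left a)" by (simp add: filterlim_cong)
qed simp

text \<open>\<open>W\<close> lives on the mesh not being evolved.
  \<open>P \<sigma> \<sigma>'\<close> is its polynomial on the cell centred at the corner (\<sigma>,
  \<sigma>') of the cell (r, s), extended to the whole plane, so that one-sided limits become plain
  values. The primal and the dual update are two instances.\<close>

locale central_cell =
  fixes M :: mesh and k N L :: nat and \<xi> \<omega> \<eta> \<omega>' :: "nat \<Rightarrow> real"
    and W :: "real \<times> real \<Rightarrow> state" and r s :: real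
    and P :: "real \<Rightarrow> real \<Rightarrow> real \<times> real \<Rightarrow> state"
  assumes mesh: "dx M > 0" "dy M > 0"
    and N_def: "N = k + 1"
    and L: "L \<ge> 2" "k \<le> 2 * L - 3"
    and gauss: "gauss_rule N \<xi> \<omega>"
    and lobatto: "gauss_lobatto_rule L \<eta> \<omega>'"
    and poly: "\<sigma> \<in> {-1, 1} \<Longrightarrow> \<sigma>' \<in> {-1, 1} \<Longrightarrow> bipoly k (\<lambda>z. n \<bullet> P \<sigma> \<sigma>' z)"
    and cont: "\<sigma> \<in> {-1, 1} \<Longrightarrow> \<sigma>' \<in> {-1, 1} \<Longrightarrow> continuous_on UNIV (P \<sigma> \<sigma>')"
    and W_eq: "\<sigma> \<in> {-1, 1} \<Longrightarrow> \<sigma>' \<in> {-1, 1} \<Longrightarrow> z \<in> cell M (r + \<sigma>/2) (s + \<sigma>'/2) \<Longrightarrow> W z = P \<sigma> \<sigma>' z"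
    and div_free: "\<sigma> \<in> {-1, 1} \<Longrightarrow> \<sigma>' \<in> {-1, 1} \<Longrightarrow> divergence_free_on (cell M (r + \<sigma>/2) (s + \<sigma>'/2)) W"
    and nodes: "admissible_at_nodes M N \<xi> L \<eta> W r s"
begin

abbreviation "xg \<sigma> \<equiv> node_x M \<xi> (r + \<sigma>/4)"
abbreviation "yg \<sigma> \<equiv> node_y M \<xi> (s + \<sigma>/4)"
abbreviation "xl \<sigma> \<equiv> node_x M \<eta> (r + \<sigma>/4)"
abbreviation "yl \<sigma> \<equiv> node_y M \<eta> (s + \<sigma>/4)"

lemma gauss_quad: "quadrature_rule N (2 * N - 1) \<xi> \<omega>" "k \<le> 2 * N - 1"
  using gauss by (simp_all add: gauss_rule_def N_def)

lemma lobatto_quad: "quadrature_rule L (2 * L - 3) \<eta> \<omega>'" "\<eta> 1 = 0" "\<eta> L = 1"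
  using lobatto by (simp_all add: gauss_lobatto_rule_def)

lemma quarter_subset_cell:
  assumes "\<sigma> \<in> {-1, 1}" "\<sigma>' \<in> {-1, 1}"
  shows "quarter M (r + \<sigma>/4) (s + \<sigma>'/4) \<subseteq> cell M (r + \<sigma>/2) (s + \<sigma>'/2)"
  using assms mesh unfolding quarter_def cell_def
  by (auto simp: box_prod xpos_def ypos_def field_simps)

lemma value_from_quarter:
  assumes "\<sigma> \<in> {-1, 1}" "\<sigma>' \<in> {-1, 1}"
    "z \<in> cbox (xpos M (r + \<sigma>/4 - 1/4), ypos M (s + \<sigma>'/4 - 1/4)) (xpos M (r + \<sigma>/4 + 1/4), ypos M (s + \<sigma>'/4 + 1/4))"
  shows "value_from (quarter M (r + \<sigma>/4) (s + \<sigma>'/4)) W z = P \<sigma> \<sigma>' z"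
  unfolding quarter_def
proof (rule value_from_box[OF cont[OF assms(1,2)] _ _ assms(3)])
  show "W z = P \<sigma> \<sigma>' z" if "z \<in> box (xpos M (r + \<sigma>/4 - 1/4), ypos M (s + \<sigma>'/4 - 1/4)) (xpos M (r + \<sigma>/4 + 1/4), ypos M (s + \<sigma>'/4 + 1/4))" for z
    using W_eq[OF assms(1,2)] quarter_subset_cell[OF assms(1,2)] that unfolding quarter_def by blast
  show "box (xpos M (r + \<sigma>/4 - 1/4), ypos M (s + \<sigma>'/4 - 1/4)) (xpos M (r + \<sigma>/4 + 1/4), ypos M (s + \<sigma>'/4 + 1/4)) \<noteq> {}"
    using mesh unfolding box_prod xpos_quarter ypos_quarter by (simp add: box_real)
qed

lemma P_admissible:
  assumes "\<sigma> \<in> {-1, 1}" "\<sigma>' \<in> {-1, 1}" "\<mu> \<in> {1..N}" "\<nu> \<in> {1..L}"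
  shows "P \<sigma> \<sigma>' (xg \<sigma> \<mu>, yl \<sigma>' \<nu>) \<in> admissible" "P \<sigma> \<sigma>' (xl \<sigma> \<nu>, yg \<sigma>' \<mu>) \<in> admissible"
proof -
  have b: "0 \<le> \<xi> \<mu>" "\<xi> \<mu> \<le> 1" "0 \<le> \<eta> \<nu>" "\<eta> \<nu> \<le> 1"
    using quadrature_node_bounds[OF gauss_quad(1) assms(3)] quadrature_node_bounds[OF lobatto_quad(1) assms(4)]
    by auto
  then have "dx M * \<xi> \<mu> \<le> dx M" "dy M * \<xi> \<mu> \<le> dy M" "dx M * \<eta> \<nu> \<le> dx M" "dy M * \<eta> \<nu> \<le> dy M"
    using mesh by (simp_all add: mult_left_le)
  then have "(xg \<sigma> \<mu>, yl \<sigma>' \<nu>) \<in> cbox (xpos M (r + \<sigma>/4 - 1/4), ypos M (s + \<sigma>'/4 - 1/4)) (xpos M (r + \<sigma>/4 + 1/4), ypos M (s + \<sigma>'/4 + 1/4))"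
    "(xl \<sigma> \<nu>, yg \<sigma>' \<mu>) \<in> cbox (xpos M (r + \<sigma>/4 - 1/4), ypos M (s + \<sigma>'/4 - 1/4)) (xpos M (r + \<sigma>/4 + 1/4), ypos M (s + \<sigma>'/4 + 1/4))"
    using b mesh unfolding cbox_Pair_eq xpos_quarter ypos_quarter node_x_eq node_y_eq by auto
  then show "P \<sigma> \<sigma>' (xg \<sigma> \<mu>, yl \<sigma>' \<nu>) \<in> admissible" "P \<sigma> \<sigma>' (xl \<sigma> \<nu>, yg \<sigma>' \<mu>) \<in> admissible"
    using nodes[unfolded admissible_at_nodes_def Let_def, rule_format, OF assms] value_from_quarter[OF assms(1,2)]
    by metis+
qed

text \<open>The Lobatto end points are the two faces, where fluxes are evaluated, and the mid-line
  x_r, approached from either side, where the field jumps.\<close>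

lemma xl_ends:
  "xl (-1) 1 = xpos M (r - 1/2)" "xl (-1) L = xpos M r" "xl 1 1 = xpos M r" "xl 1 L = xpos M (r + 1/2)"
  unfolding node_x_eq lobatto_quad(2,3) by (simp_all add: xpos_def field_simps)

lemma yl_ends:
  "yl (-1) 1 = ypos M (s - 1/2)" "yl (-1) L = ypos M s" "yl 1 1 = ypos M s" "yl 1 L = ypos M (s + 1/2)"
  unfolding node_y_eq lobatto_quad(2,3) by (simp_all add: ypos_def field_simps)

section \<open>Point values and one-sided limits on the Gauss grid lines\<close>

lemma gauss_xg:
  assumes "\<mu> \<in> {1..N}" "\<sigma> \<in> {-1, 1}"
  shows "xpos M (r + \<sigma>/2 - 1/2) < xg \<sigma> \<mu>" "xg \<sigma> \<mu> < xpos M (r + \<sigma>/2 + 1/2)"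
    "xpos M (r + \<sigma>/4 - 1/4) < xg \<sigma> \<mu>" "xg \<sigma> \<mu> < xpos M (r + \<sigma>/4 + 1/4)"
proof -
  have "0 < \<xi> \<mu>" "\<xi> \<mu> < 1" using gauss_node_interior[OF gauss assms(1)] by auto
  then have "0 < dx M * \<xi> \<mu>" "dx M * \<xi> \<mu> < dx M" using mesh by simp_all
  then show "xpos M (r + \<sigma>/2 - 1/2) < xg \<sigma> \<mu>" "xg \<sigma> \<mu> < xpos M (r + \<sigma>/2 + 1/2)"
    "xpos M (r + \<sigma>/4 - 1/4) < xg \<sigma> \<mu>" "xg \<sigma> \<mu> < xpos M (r + \<sigma>/4 + 1/4)"
    using assms(2) mesh unfolding node_x_eq by (auto simp: xpos_def field_simps)
qed

lemma gauss_yg: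
  assumes "\<mu> \<in> {1..N}" "\<sigma> \<in> {-1, 1}"
  shows "ypos M (s + \<sigma>/2 - 1/2) < yg \<sigma> \<mu>" "yg \<sigma> \<mu> < ypos M (s + \<sigma>/2 + 1/2)"
    "ypos M (s + \<sigma>/4 - 1/4) < yg \<sigma> \<mu>" "yg \<sigma> \<mu> < ypos M (s + \<sigma>/4 + 1/4)"
proof -
  have "0 < \<xi> \<mu>" "\<xi> \<mu> < 1" using gauss_node_interior[OF gauss assms(1)] by auto
  then have "0 < dy M * \<xi> \<mu>" "dy M * \<xi> \<mu> < dy M" using mesh by simp_all
  then show "ypos M (s + \<sigma>/2 - 1/2) < yg \<sigma> \<mu>" "yg \<sigma> \<mu> < ypos M (s + \<sigma>/2 + 1/2)"
    "ypos M (s + \<sigma>/4 - 1/4) < yg \<sigma> \<mu>" "yg \<sigma> \<mu> < ypos M (s + \<sigma>/4 + 1/4)"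
    using assms(2) mesh unfolding node_y_eq by (auto simp: ypos_def field_simps)
qed

lemma W_at:
  assumes "\<sigma> \<in> {-1, 1}" "\<sigma>' \<in> {-1, 1}"
    "xpos M (r + \<sigma>/2 - 1/2) < x" "x < xpos M (r + \<sigma>/2 + 1/2)"
    "ypos M (s + \<sigma>'/2 - 1/2) < y" "y < ypos M (s + \<sigma>'/2 + 1/2)"
  shows "W (x, y) = P \<sigma> \<sigma>' (x, y)"
  using assms by (intro W_eq) (simp_all add: cell_def box_prod box_real)

lemma W_x:
  assumes \<mu>: "\<mu> \<in> {1..N}" "\<sigma>' \<in> {-1, 1}"
  shows "t \<in> {xpos M r<..<xpos M (r + 1)} \<Longrightarrow> W (t, yg \<sigma>' \<mu>) = P 1 \<sigma>' (t, yg \<sigma>' \<mu>)"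
    "t \<in> {xpos M (r - 1)<..<xpos M r} \<Longrightarrow> W (t, yg \<sigma>' \<mu>) = P (-1) \<sigma>' (t, yg \<sigma>' \<mu>)"
proof -
  have eqs: "r + 1/2 - 1/2 = r" "r + 1/2 + 1/2 = r + 1" "r + -1/2 - 1/2 = r - 1" "r + -1/2 + 1/2 = r" by simp_all
  show "t \<in> {xpos M r<..<xpos M (r + 1)} \<Longrightarrow> W (t, yg \<sigma>' \<mu>) = P 1 \<sigma>' (t, yg \<sigma>' \<mu>)"
    using W_at[of 1, OF _ \<mu>(2) _ _ gauss_yg(1,2)[OF \<mu>], unfolded eqs] by simp
  show "t \<in> {xpos M (r - 1)<..<xpos M r} \<Longrightarrow> W (t, yg \<sigma>' \<mu>) = P (-1) \<sigma>' (t, yg \<sigma>' \<mu>)"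
    using W_at[of "-1", OF _ \<mu>(2) _ _ gauss_yg(1,2)[OF \<mu>], unfolded eqs] by simp
qed

lemma W_y:
  assumes \<mu>: "\<mu> \<in> {1..N}" "\<sigma> \<in> {-1, 1}"
  shows "t \<in> {ypos M s<..<ypos M (s + 1)} \<Longrightarrow> W (xg \<sigma> \<mu>, t) = P \<sigma> 1 (xg \<sigma> \<mu>, t)"
    "t \<in> {ypos M (s - 1)<..<ypos M s} \<Longrightarrow> W (xg \<sigma> \<mu>, t) = P \<sigma> (-1) (xg \<sigma> \<mu>, t)"
proof -
  have eqs: "s + 1/2 - 1/2 = s" "s + 1/2 + 1/2 = s + 1" "s + -1/2 - 1/2 = s - 1" "s + -1/2 + 1/2 = s" by simp_all
  show "t \<in> {ypos M s<..<ypos M (s + 1)} \<Longrightarrow> W (xg \<sigma> \<mu>, t) = P \<sigma> 1 (xg \<sigma> \<mu>, t)"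
    using W_at[of _ 1, OF \<mu>(2) _ gauss_xg(1,2)[OF \<mu>], unfolded eqs] by simp
  show "t \<in> {ypos M (s - 1)<..<ypos M s} \<Longrightarrow> W (xg \<sigma> \<mu>, t) = P \<sigma> (-1) (xg \<sigma> \<mu>, t)"
    using W_at[of _ "-1", OF \<mu>(2) _ gauss_xg(1,2)[OF \<mu>], unfolded eqs] by simp
qed

lemma W_mid_x:
  assumes \<mu>: "\<mu> \<in> {1..N}" "\<sigma>' \<in> {-1, 1}"
  shows "W (xpos M (r + 1/2), yg \<sigma>' \<mu>) = P 1 \<sigma>' (xpos M (r + 1/2), yg \<sigma>' \<mu>)"
    "W (xpos M (r - 1/2), yg \<sigma>' \<mu>) = P (-1) \<sigma>' (xpos M (r - 1/2), yg \<sigma>' \<mu>)"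
  using mesh by (auto intro!: W_x[OF \<mu>] simp: xpos_def)

lemma W_mid_y:
  assumes \<mu>: "\<mu> \<in> {1..N}" "\<sigma> \<in> {-1, 1}"
  shows "W (xg \<sigma> \<mu>, ypos M (s + 1/2)) = P \<sigma> 1 (xg \<sigma> \<mu>, ypos M (s + 1/2))"
    "W (xg \<sigma> \<mu>, ypos M (s - 1/2)) = P \<sigma> (-1) (xg \<sigma> \<mu>, ypos M (s - 1/2))"
  using mesh by (auto intro!: W_y[OF \<mu>] simp: ypos_def)

text \<open>The map \<open>f\<close> is left general to treat the normal field, the density and the
  whole state together.\<close>

lemma Lim_x:
  fixes f :: "state \<Rightarrow> 'a::t2_space"
  assumes f: "continuous_on UNIV f" and \<mu>: "\<mu> \<in> {1..N}" "\<sigma>' \<in> {-1, 1}"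
  shows "Lim (at_right (xpos M r)) (\<lambda>t. f (W (t, yg \<sigma>' \<mu>))) = f (P 1 \<sigma>' (xpos M r, yg \<sigma>' \<mu>))"
    "Lim (at_left (xpos M r)) (\<lambda>t. f (W (t, yg \<sigma>' \<mu>))) = f (P (-1) \<sigma>' (xpos M r, yg \<sigma>' \<mu>))"
proof -
  have c: "isCont (\<lambda>t. f (P \<sigma> \<sigma>' (t, yg \<sigma>' \<mu>))) (xpos M r)" if "\<sigma> \<in> {-1, 1}" for \<sigma>
  proof -
    have "continuous_on UNIV (\<lambda>t. (t, yg \<sigma>' \<mu>))" by (intro continuous_intros)
    then have "continuous_on UNIV (\<lambda>t. f (P \<sigma> \<sigma>' (t, yg \<sigma>' \<mu>)))"
      by (rule continuous_on_compose2[OF f continuous_on_compose2[OF cont[OF that \<mu>(2)]]]) simp_all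
    then show ?thesis by (simp add: continuous_on_eq_continuous_at)
  qed
  have b: "xpos M (r - 1) < xpos M r" "xpos M r < xpos M (r + 1)"
    using mesh by (simp_all add: xpos_def algebra_simps)
  show "Lim (at_right (xpos M r)) (\<lambda>t. f (W (t, yg \<sigma>' \<mu>))) = f (P 1 \<sigma>' (xpos M r, yg \<sigma>' \<mu>))"
    by (rule Lim_at_right_eq[OF c b(2)]) (use W_x(1)[OF \<mu>] in auto)
  show "Lim (at_left (xpos M r)) (\<lambda>t. f (W (t, yg \<sigma>' \<mu>))) = f (P (-1) \<sigma>' (xpos M r, yg \<sigma>' \<mu>))"
    by (rule Lim_at_left_eq[OF c b(1)]) (use W_x(2)[OF \<mu>] in auto)
qed

lemma Lim_y:
  fixes f :: "state \<Rightarrow> 'a::t2_space"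
  assumes f: "continuous_on UNIV f" and \<mu>: "\<mu> \<in> {1..N}" "\<sigma> \<in> {-1, 1}"
  shows "Lim (at_right (ypos M s)) (\<lambda>t. f (W (xg \<sigma> \<mu>, t))) = f (P \<sigma> 1 (xg \<sigma> \<mu>, ypos M s))"
    "Lim (at_left (ypos M s)) (\<lambda>t. f (W (xg \<sigma> \<mu>, t))) = f (P \<sigma> (-1) (xg \<sigma> \<mu>, ypos M s))"
proof -
  have c: "isCont (\<lambda>t. f (P \<sigma> \<sigma>' (xg \<sigma> \<mu>, t))) (ypos M s)" if "\<sigma>' \<in> {-1, 1}" for \<sigma>'
  proof -
    have "continuous_on UNIV (\<lambda>t. (xg \<sigma> \<mu>, t))" by (intro continuous_intros)
    then have "continuous_on UNIV (\<lambda>t. f (P \<sigma> \<sigma>' (xg \<sigma> \<mu>, t)))"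
      by (rule continuous_on_compose2[OF f continuous_on_compose2[OF cont[OF \<mu>(2) that]]]) simp_all
    then show ?thesis by (simp add: continuous_on_eq_continuous_at)
  qed
  have b: "ypos M (s - 1) < ypos M s" "ypos M s < ypos M (s + 1)"
    using mesh by (simp_all add: ypos_def algebra_simps)
  show "Lim (at_right (ypos M s)) (\<lambda>t. f (W (xg \<sigma> \<mu>, t))) = f (P \<sigma> 1 (xg \<sigma> \<mu>, ypos M s))"
    by (rule Lim_at_right_eq[OF c b(2)]) (use W_y(1)[OF \<mu>] in auto)
  show "Lim (at_left (ypos M s)) (\<lambda>t. f (W (xg \<sigma> \<mu>, t))) = f (P \<sigma> (-1) (xg \<sigma> \<mu>, ypos M s))"
    by (rule Lim_at_left_eq[OF c b(1)]) (use W_y(2)[OF \<mu>] in auto)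
qed

section \<open>Cell average and divergence on the four quarters\<close>

lemma has_integral_quarter:
  assumes \<sigma>: "\<sigma> \<in> {-1, 1}" "\<sigma>' \<in> {-1, 1}"
  shows "(W has_integral integral (cbox (xpos M (r + \<sigma>/4 - 1/4), ypos M (s + \<sigma>'/4 - 1/4)) (xpos M (r + \<sigma>/4 + 1/4), ypos M (s + \<sigma>'/4 + 1/4))) (P \<sigma> \<sigma>'))
    (cbox (xpos M (r + \<sigma>/4 - 1/4), ypos M (s + \<sigma>'/4 - 1/4)) (xpos M (r + \<sigma>/4 + 1/4), ypos M (s + \<sigma>'/4 + 1/4)))"
proof (rule has_integral_spike_interior)
  show "(P \<sigma> \<sigma>' has_integral integral (cbox (xpos M (r + \<sigma>/4 - 1/4), ypos M (s + \<sigma>'/4 - 1/4)) (xpos M (r + \<sigma>/4 + 1/4), ypos M (s + \<sigma>'/4 + 1/4))) (P \<sigma> \<sigma>'))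
    (cbox (xpos M (r + \<sigma>/4 - 1/4), ypos M (s + \<sigma>'/4 - 1/4)) (xpos M (r + \<sigma>/4 + 1/4), ypos M (s + \<sigma>'/4 + 1/4)))"
    by (intro integrable_integral integrable_continuous continuous_on_subset[OF cont[OF \<sigma>]]) simp
  show "W z = P \<sigma> \<sigma>' z" if "z \<in> box (xpos M (r + \<sigma>/4 - 1/4), ypos M (s + \<sigma>'/4 - 1/4)) (xpos M (r + \<sigma>/4 + 1/4), ypos M (s + \<sigma>'/4 + 1/4))" for z
    using W_eq[OF \<sigma>] quarter_subset_cell[OF \<sigma>] that unfolding quarter_def by blast
qed

lemma cell_avg_quarters:
  "n \<bullet> cell_avg M W r s = (1 / (dx M * dy M)) * (\<Sum>\<sigma>\<in>{-1, 1}. \<Sum>\<sigma>'\<in>{-1, 1}.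
    integral (cbox (xpos M (r + \<sigma>/4 - 1/4), ypos M (s + \<sigma>'/4 - 1/4)) (xpos M (r + \<sigma>/4 + 1/4), ypos M (s + \<sigma>'/4 + 1/4)))
      (\<lambda>z. n \<bullet> P \<sigma> \<sigma>' z))"
proof -
  let ?Q = "\<lambda>\<sigma> \<sigma>'. cbox (xpos M (r + \<sigma>/4 - 1/4), ypos M (s + \<sigma>'/4 - 1/4)) (xpos M (r + \<sigma>/4 + 1/4), ypos M (s + \<sigma>'/4 + 1/4))"
  let ?I = "\<lambda>\<sigma> \<sigma>'. integral (?Q \<sigma> \<sigma>') (P \<sigma> \<sigma>')"
  have le: "xpos M (r - 1/2) \<le> xpos M r" "xpos M r \<le> xpos M (r + 1/2)"
      "ypos M (s - 1/2) \<le> ypos M s" "ypos M s \<le> ypos M (s + 1/2)"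
    using mesh by (simp_all add: xpos_def ypos_def)
  have eqs: "r + -1/4 - 1/4 = r - 1/2" "r + -1/4 + 1/4 = r" "r + 1/4 - 1/4 = r" "r + 1/4 + 1/4 = r + 1/2"
      "s + -1/4 - 1/4 = s - 1/2" "s + -1/4 + 1/4 = s" "s + 1/4 - 1/4 = s" "s + 1/4 + 1/4 = s + 1/2"
    by simp_all
  have i: "-1 \<in> {-1, 1::real}" "1 \<in> {-1, 1::real}" by simp_all
  have "(W has_integral (?I (-1) (-1) + ?I 1 (-1)) + (?I (-1) 1 + ?I 1 1))
      (cbox (xpos M (r - 1/2), ypos M (s - 1/2)) (xpos M (r + 1/2), ypos M (s + 1/2)))"
    using has_integral_split_snd[OF
        has_integral_split_fst[OF
          has_integral_quarter[OF i(1) i(1), unfolded eqs] has_integral_quarter[OF i(2) i(1), unfolded eqs] le(1,2)]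
        has_integral_split_fst[OF
          has_integral_quarter[OF i(1) i(2), unfolded eqs] has_integral_quarter[OF i(2) i(2), unfolded eqs] le(1,2)]
        le(3,4)]
    unfolding eqs .
  then have "integral (cell M r s) W = (?I (-1) (-1) + ?I 1 (-1)) + (?I (-1) 1 + ?I 1 1)"
    unfolding cell_def integral_open_interval by (rule integral_unique)
  also have "\<dots> = (\<Sum>\<sigma>\<in>{-1, 1}. \<Sum>\<sigma>'\<in>{-1, 1}. ?I \<sigma> \<sigma>')" by simp
  finally have e: "integral (cell M r s) W = (\<Sum>\<sigma>\<in>{-1, 1}. \<Sum>\<sigma>'\<in>{-1, 1}. ?I \<sigma> \<sigma>')" .
  have I: "n \<bullet> ?I \<sigma> \<sigma>' = integral (?Q \<sigma> \<sigma>') (\<lambda>z. n \<bullet> P \<sigma> \<sigma>' z)" if "\<sigma> \<in> {-1, 1}" "\<sigma>' \<in> {-1, 1}" for \<sigma> \<sigma>'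
    using integral_linear[OF integrable_continuous[OF continuous_on_subset[OF cont[OF that] subset_UNIV]] bounded_linear_inner_right[of n]]
    by (simp add: o_def)
  have "(\<Sum>\<sigma>\<in>{-1, 1}. \<Sum>\<sigma>'\<in>{-1, 1}. n \<bullet> ?I \<sigma> \<sigma>') =
      (\<Sum>\<sigma>\<in>{-1, 1}. \<Sum>\<sigma>'\<in>{-1, 1}. integral (?Q \<sigma> \<sigma>') (\<lambda>z. n \<bullet> P \<sigma> \<sigma>' z))"
    by (rule sum.cong[OF refl], rule sum.cong[OF refl], rule I)
  then show ?thesis
    unfolding cell_avg_def e inner_scaleR_right inner_sum_right by (rule arg_cong)
qed

text \<open>The weights of the combined rule sum to 1, so the constant \<open>c\<close> may be moved
  inside. The two rules stay independent because the average is computed both with Lobatto nodes in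
  x and Gauss nodes in y, and the other way round.\<close>

lemma quarter_mean:
  assumes rx: "quadrature_rule m d \<zeta> \<alpha>" "k \<le> d" and ry: "quadrature_rule m' d' \<zeta>' \<alpha>'" "k \<le> d'"
  shows "n \<bullet> cell_avg M W r s + c = (1/4) * (\<Sum>\<sigma>\<in>{-1, 1}. \<Sum>\<sigma>'\<in>{-1, 1}.
    \<Sum>\<nu>=1..m. \<Sum>\<mu>=1..m'. \<alpha> \<nu> * \<alpha>' \<mu> *
      (n \<bullet> P \<sigma> \<sigma>' (node_x M \<zeta> (r + \<sigma>/4) \<nu>, node_y M \<zeta>' (s + \<sigma>'/4) \<mu>) + c))"
proof -
  let ?S = "\<lambda>\<sigma> \<sigma>'. \<Sum>\<nu>=1..m. \<Sum>\<mu>=1..m'. \<alpha> \<nu> * \<alpha>' \<mu> *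
      (n \<bullet> P \<sigma> \<sigma>' (node_x M \<zeta> (r + \<sigma>/4) \<nu>, node_y M \<zeta>' (s + \<sigma>'/4) \<mu>))"
  have I: "integral (cbox (xpos M (r + \<sigma>/4 - 1/4), ypos M (s + \<sigma>'/4 - 1/4)) (xpos M (r + \<sigma>/4 + 1/4), ypos M (s + \<sigma>'/4 + 1/4)))
      (\<lambda>z. n \<bullet> P \<sigma> \<sigma>' z) = (dx M / 2) * (dy M / 2) * ?S \<sigma> \<sigma>'" if \<sigma>: "\<sigma> \<in> {-1, 1}" "\<sigma>' \<in> {-1, 1}" for \<sigma> \<sigma>'
    unfolding xpos_quarter ypos_quarter node_x_eq node_y_eq using mesh
    by (intro integral_unique bipoly_quadrature[OF rx ry poly[OF \<sigma>]]) simp_all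
  have shift: "(1/4) * (\<Sum>\<sigma>\<in>{-1, 1}. \<Sum>\<sigma>'\<in>{-1, 1}. f \<sigma> \<sigma>') + c =
      (1/4) * (\<Sum>\<sigma>\<in>{-1, 1}. \<Sum>\<sigma>'\<in>{-1, 1}. f \<sigma> \<sigma>' + c)" for f :: "real \<Rightarrow> real \<Rightarrow> real"
    by simp
  have scale: "dx M > 0 \<Longrightarrow> dy M > 0 \<Longrightarrow> (1 / (dx M * dy M)) * ((dx M / 2) * (dy M / 2) * x) = (1/4) * x" for x
    by simp
  have w: "(\<Sum>\<nu>=1..m. \<Sum>\<mu>=1..m'. \<alpha> \<nu> * \<alpha>' \<mu> * c) = c"
  proof -
    have "(\<Sum>\<nu>=1..m. \<Sum>\<mu>=1..m'. \<alpha> \<nu> * \<alpha>' \<mu> * c) = (\<Sum>\<nu>=1..m. \<alpha> \<nu>) * (\<Sum>\<mu>=1..m'. \<alpha>' \<mu>) * c"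
      unfolding sum_product unfolding sum_distrib_right ..
    then show ?thesis
      unfolding quadrature_weights_sum[OF rx(1)] quadrature_weights_sum[OF ry(1)] by simp
  qed
  have "n \<bullet> cell_avg M W r s = (1 / (dx M * dy M)) * (\<Sum>\<sigma>\<in>{-1, 1}. \<Sum>\<sigma>'\<in>{-1, 1}. (dx M / 2) * (dy M / 2) * ?S \<sigma> \<sigma>')"
    unfolding cell_avg_quarters
    by (rule arg_cong, rule sum.cong[OF refl], rule sum.cong[OF refl], rule I)
  also have "\<dots> = (1/4) * (\<Sum>\<sigma>\<in>{-1, 1}. \<Sum>\<sigma>'\<in>{-1, 1}. ?S \<sigma> \<sigma>')"
    unfolding sum_distrib_left[symmetric] by (rule scale[OF mesh])
  finally have "n \<bullet> cell_avg M W r s = (1/4) * (\<Sum>\<sigma>\<in>{-1, 1}. \<Sum>\<sigma>'\<in>{-1, 1}. ?S \<sigma> \<sigma>')" .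
  then have "n \<bullet> cell_avg M W r s + c = (1/4) * (\<Sum>\<sigma>\<in>{-1, 1}. \<Sum>\<sigma>'\<in>{-1, 1}. ?S \<sigma> \<sigma>') + c"
    by (rule arg_cong)
  also have "\<dots> = (1/4) * (\<Sum>\<sigma>\<in>{-1, 1}. \<Sum>\<sigma>'\<in>{-1, 1}. ?S \<sigma> \<sigma>' + c)"
    by (rule shift)
  finally show ?thesis unfolding distrib_left sum.distrib w .
qed

text \<open>Stated per quarter because the normal fields jump across the mid-lines. The divergence
  condition concerns \<open>W\<close>; it passes to \<open>P \<sigma> \<sigma>'\<close> since both
  agree near the Gauss grid nodes, which lie inside the open cell.\<close>

lemma quarter_div_free:
  assumes \<sigma>: "\<sigma> \<in> {-1, 1}" "\<sigma>' \<in> {-1, 1}"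
  shows "(\<Sum>\<mu>=1..N. \<omega> \<mu> * (mag (P \<sigma> \<sigma>' (xl \<sigma> L, yg \<sigma>' \<mu>)) $ 1 - mag (P \<sigma> \<sigma>' (xl \<sigma> 1, yg \<sigma>' \<mu>)) $ 1)) / (dx M / 2)
    + (\<Sum>\<mu>=1..N. \<omega> \<mu> * (mag (P \<sigma> \<sigma>' (xg \<sigma> \<mu>, yl \<sigma>' L)) $ 2 - mag (P \<sigma> \<sigma>' (xg \<sigma> \<mu>, yl \<sigma>' 1)) $ 2)) / (dy M / 2) = 0"
proof -
  let ?c = "cell M (r + \<sigma>/2) (s + \<sigma>'/2)"
  have op: "open ?c" by (simp add: cell_def open_box)
  have "deriv (\<lambda>t. mag (P \<sigma> \<sigma>' (t, yg \<sigma>' \<nu>)) $ 1) (xg \<sigma> \<mu>) + deriv (\<lambda>t. mag (P \<sigma> \<sigma>' (xg \<sigma> \<mu>, t)) $ 2) (yg \<sigma>' \<nu>) = 0"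
    if \<mu>: "\<mu> \<in> {1..N}" "\<nu> \<in> {1..N}" for \<mu> \<nu>
  proof -
    have z: "(xg \<sigma> \<mu>, yg \<sigma>' \<nu>) \<in> ?c"
      using gauss_xg[OF \<mu>(1) \<sigma>(1)] gauss_yg[OF \<mu>(2) \<sigma>(2)] by (simp add: cell_def box_prod box_real)
    have W: "eventually (\<lambda>z. W z = P \<sigma> \<sigma>' z) (nhds (xg \<sigma> \<mu>, yg \<sigma>' \<nu>))"
      using eventually_nhds_in_open[OF op z] by eventually_elim (rule W_eq[OF \<sigma>])
    have fx: "filterlim (\<lambda>t. (t, yg \<sigma>' \<nu>)) (nhds (xg \<sigma> \<mu>, yg \<sigma>' \<nu>)) (nhds (xg \<sigma> \<mu>))"
      and fy: "filterlim (\<lambda>t. (xg \<sigma> \<mu>, t)) (nhds (xg \<sigma> \<mu>, yg \<sigma>' \<nu>)) (nhds (yg \<sigma>' \<nu>))"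
      by (intro tendsto_intros filterlim_ident)+
    have "deriv (\<lambda>t. mag (W (t, yg \<sigma>' \<nu>)) $ 1) (xg \<sigma> \<mu>) = deriv (\<lambda>t. mag (P \<sigma> \<sigma>' (t, yg \<sigma>' \<nu>)) $ 1) (xg \<sigma> \<mu>)"
      by (rule deriv_cong_ev[OF _ refl]) (rule eventually_mono[OF eventually_compose_filterlim[OF W fx]], simp)
    moreover have "deriv (\<lambda>t. mag (W (xg \<sigma> \<mu>, t)) $ 2) (yg \<sigma>' \<nu>) = deriv (\<lambda>t. mag (P \<sigma> \<sigma>' (xg \<sigma> \<mu>, t)) $ 2) (yg \<sigma>' \<nu>)"
      by (rule deriv_cong_ev[OF _ refl]) (rule eventually_mono[OF eventually_compose_filterlim[OF W fy]], simp)
    ultimately show ?thesis using div_free[OF \<sigma>] z unfolding divergence_free_on_def by fastforce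
  qed
  then show ?thesis
    using bipoly_div_free[OF gauss_quad poly[OF \<sigma>, of "(0, 0, axis 1 1, 0)"] poly[OF \<sigma>, of "(0, 0, axis 2 1, 0)"],
        of "dx M / 2" "dy M / 2" "ypos M (s + \<sigma>'/4 - 1/4)" "xpos M (r + \<sigma>/4 - 1/4)"] mesh
    unfolding mag_inner[symmetric] node_x_eq node_y_eq lobatto_quad(2,3) by simp
qed

end

section \<open>Update of one cell average\<close>

text \<open>Common abstraction of the tests for density and energy; \<open>g\<close> stands for \<open>v\<^sup>* \<bullet> B\<^sup>*\<close>.\<close>

definition dual_test :: "(real \<Rightarrow> real \<Rightarrow> real) \<Rightarrow> state \<Rightarrow> real \<Rightarrow> real \<Rightarrow> bool" where
  "dual_test p n c g \<longleftrightarrow>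
    (\<forall>U\<in>admissible. n \<bullet> U + c > 0) \<and>
    (\<forall>l. \<forall>U\<in>admissible. \<forall>V\<in>admissible.
      n \<bullet> (flux p l U - flux p l V) - g * (mag U $ l - mag V $ l)
        \<le> wave_bound p l U V * ((n \<bullet> U + c) + (n \<bullet> V + c))) \<and>
    (\<forall>U\<in>admissible. \<bar>n \<bullet> source U + g\<bar> \<le> (n \<bullet> U + c) / sqrt (rho U))"

lemma dual_test_energy: "dual_test p (dual_vec vs Bs) ((norm Bs)\<^sup>2 / 2) (vs \<bullet> Bs)"
  using dual_energy_pos wave_bound_flux source_dual_bound
  unfolding dual_test_def dual_energy_def[symmetric] by blast

text \<open>The source has no mass component, hence g = 0, and the mass flux is controlled by the
  normal velocity alone.\<close>

lemma dual_test_density: "dual_test p (1, 0, 0, 0) 0 0"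
proof -
  have "rho U * vel U $ l - rho V * vel V $ l \<le> wave_bound p l U V * (rho U + rho V)"
    if "U \<in> admissible" "V \<in> admissible" for U V l
  proof -
    have "rho U * vel U $ l \<le> rho U * wave_bound p l U V" "rho V * (- vel V $ l) \<le> rho V * wave_bound p l U V"
      using wave_bound_ge_speed[OF that, of l p] that
      by (intro mult_left_mono; auto simp: admissible_def)+
    then show ?thesis by (simp add: algebra_simps)
  qed
  then show ?thesis
    unfolding dual_test_def
    by (auto simp: inner_diff_right flux_def Let_def source_def admissible_def simp flip: rho_inner)
qed

text \<open>The four states follow one grid line: left face, both sides of the mid-line, right face.
  Writing n . S = (n . S + g) - g removes the jump from the total normal increment and leaves the
  increments over the two halves. The mean state \<open>V\<close> is admissible by convexity, and
  twice its value under the affine form is the sum over both sides, which absorbs the 2 in the jump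
  speed.\<close>

lemma side_bound:
  assumes test: "dual_test p n c g"
    and adm: "UL \<in> admissible" "Um \<in> admissible" "Up \<in> admissible" "UR \<in> admissible"
    and wb: "wave_bound p l UR UL \<le> a"
    and J: "J = mag Up $ l - mag Um $ l" and V: "V = (1/2) *\<^sub>R (Um + Up)"
    and js: "\<bar>J\<bar> / (2 * sqrt (rho V)) \<le> a"
  shows "0 \<le> a"
    "n \<bullet> (flux p l UR - flux p l UL) + J * (n \<bullet> source V) \<le>
      a * ((n \<bullet> UL + c) + (n \<bullet> Um + c) + ((n \<bullet> Up + c) + (n \<bullet> UR + c)))
      + g * ((mag Um $ l - mag UL $ l) + (mag UR $ l - mag Up $ l))"
proof -
  have "V = (1 - 1/2) *\<^sub>R Um + (1/2) *\<^sub>R Up" by (simp add: V algebra_simps)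
  then have Va: "V \<in> admissible" using admissible_convex[OF adm(2,3), of "1/2"] by simp
  then have r: "sqrt (rho V) > 0" by (simp add: admissible_def)
  show "0 \<le> a" using js r by (meson abs_ge_zero divide_nonneg_pos mult_pos_pos order_trans zero_less_numeral)
  have e: "n \<bullet> U + c > 0" if "U \<in> admissible" for U using test that by (simp add: dual_test_def)
  have 1: "n \<bullet> (flux p l UR - flux p l UL) \<le> g * (mag UR $ l - mag UL $ l) + a * ((n \<bullet> UR + c) + (n \<bullet> UL + c))"
  proof -
    have "wave_bound p l UR UL * ((n \<bullet> UR + c) + (n \<bullet> UL + c)) \<le> a * ((n \<bullet> UR + c) + (n \<bullet> UL + c))"
      using wb e[OF adm(1)] e[OF adm(4)] by (intro mult_right_mono) auto
    moreover have "n \<bullet> (flux p l UR - flux p l UL) - g * (mag UR $ l - mag UL $ l)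
        \<le> wave_bound p l UR UL * ((n \<bullet> UR + c) + (n \<bullet> UL + c))"
      using test adm by (simp add: dual_test_def)
    ultimately show ?thesis by linarith
  qed
  have "\<bar>J * (n \<bullet> source V + g)\<bar> \<le> \<bar>J\<bar> * ((n \<bullet> V + c) / sqrt (rho V))"
    unfolding abs_mult using test Va by (intro mult_left_mono) (auto simp: dual_test_def)
  also have "\<dots> = \<bar>J\<bar> / (2 * sqrt (rho V)) * (2 * (n \<bullet> V + c))"
    using r by (simp add: field_simps)
  also have "\<dots> \<le> a * (2 * (n \<bullet> V + c))" using js e[OF Va] by (intro mult_right_mono) auto
  also have "2 * (n \<bullet> V + c) = (n \<bullet> Um + c) + (n \<bullet> Up + c)" by (simp add: V inner_add_right)
  finally have 2: "J * (n \<bullet> source V + g) \<le> a * ((n \<bullet> Um + c) + (n \<bullet> Up + c))" by linarith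
  show "n \<bullet> (flux p l UR - flux p l UL) + J * (n \<bullet> source V) \<le>
      a * ((n \<bullet> UL + c) + (n \<bullet> Um + c) + ((n \<bullet> Up + c) + (n \<bullet> UR + c)))
      + g * ((mag Um $ l - mag UL $ l) + (mag UR $ l - mag Up $ l))"
    using 1 2 unfolding J by (simp add: algebra_simps)
qed

lemma end_terms_le:
  fixes h w :: "nat \<Rightarrow> real"
  assumes "L \<ge> 2" "\<And>\<nu>. \<nu> \<in> {1..L} \<Longrightarrow> w \<nu> > 0" "w 1 = w L" "\<And>\<nu>. \<nu> \<in> {1..L} \<Longrightarrow> h \<nu> \<ge> 0"
  shows "w 1 * (h 1 + h L) \<le> (\<Sum>\<nu>=1..L. w \<nu> * h \<nu>)"
proof -
  have "(\<Sum>\<nu>\<in>{1, L}. w \<nu> * h \<nu>) \<le> (\<Sum>\<nu>=1..L. w \<nu> * h \<nu>)"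
    using assms by (intro sum_mono2) (auto intro!: mult_nonneg_nonneg simp: less_imp_le)
  then show ?thesis using assms(1,3) by (simp add: algebra_simps)
qed

lemma mag_continuous: "continuous_on UNIV (\<lambda>U. mag U $ l)"
  unfolding mag_inner by (intro continuous_intros)

lemma rho_continuous: "continuous_on UNIV rho"
  unfolding rho_inner[abs_def] by (intro continuous_intros)

lemma sum_sides:
  fixes E D :: "real \<Rightarrow> 'i \<Rightarrow> real"
  shows "(\<Sum>\<mu>\<in>I. w \<mu> / 2 * (a * (\<Sum>\<sigma>\<in>{-1, 1}. E \<sigma> \<mu>) + g * (\<Sum>\<sigma>\<in>{-1, 1}. D \<sigma> \<mu>))) =
    a / 2 * (\<Sum>\<sigma>\<in>{-1, 1}. \<Sum>\<mu>\<in>I. w \<mu> * E \<sigma> \<mu>) + g / 2 * (\<Sum>\<sigma>\<in>{-1, 1}. \<Sum>\<mu>\<in>I. w \<mu> * D \<sigma> \<mu>)"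
proof -
  have pair: "(\<Sum>\<sigma>\<in>{-1, 1}. f \<sigma>) = f (-1) + f 1" for f :: "real \<Rightarrow> real" by simp
  have "w \<mu> / 2 * (a * (E (-1) \<mu> + E 1 \<mu>) + g * (D (-1) \<mu> + D 1 \<mu>)) =
      a / 2 * (w \<mu> * E (-1) \<mu>) + a / 2 * (w \<mu> * E 1 \<mu>) + (g / 2 * (w \<mu> * D (-1) \<mu>) + g / 2 * (w \<mu> * D 1 \<mu>))" for \<mu>
    by (simp add: field_simps)
  then show ?thesis
    unfolding pair by (simp only: sum.distrib distrib_left sum_distrib_left)
qed

section \<open>Contributions along grid lines and the complete update\<close>

context central_cell
begin

lemma omega_pos: "\<mu> \<in> {1..N} \<Longrightarrow> \<omega> \<mu> > 0"
  using gauss_weight_pos[OF gauss] .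

lemma omega'_pos: "\<nu> \<in> {1..L} \<Longrightarrow> \<omega>' \<nu> > 0"
  using lobatto_weight_pos[OF lobatto L(1)] .

lemma omega'_ends: "\<omega>' 1 = \<omega>' L"
  using lobatto_end_weights_eq[OF lobatto L(1)] .

lemma L_range: "1 \<in> {1..L}" "L \<in> {1..L}"
  using L by auto

lemma x_side:
  assumes test: "dual_test p n c g" and \<mu>: "\<mu> \<in> {1..N}" "\<sigma>' \<in> {-1, 1}"
    and wb: "wave_bound p 1 (W (xpos M (r + 1/2), yg \<sigma>' \<mu>)) (W (xpos M (r - 1/2), yg \<sigma>' \<mu>)) \<le> a"
    and js: "jump_speed1 M W r (yg \<sigma>' \<mu>) \<le> a"
  shows "0 \<le> a"
    "n \<bullet> (flux p 1 (W (xpos M (r + 1/2), yg \<sigma>' \<mu>)) - flux p 1 (W (xpos M (r - 1/2), yg \<sigma>' \<mu>)))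
      + jump (\<lambda>t. mag (W (t, yg \<sigma>' \<mu>)) $ 1) (xpos M r) * (n \<bullet> source (mean (\<lambda>t. W (t, yg \<sigma>' \<mu>)) (xpos M r)))
    \<le> a * (\<Sum>\<sigma>\<in>{-1, 1}. (n \<bullet> P \<sigma> \<sigma>' (xl \<sigma> 1, yg \<sigma>' \<mu>) + c) + (n \<bullet> P \<sigma> \<sigma>' (xl \<sigma> L, yg \<sigma>' \<mu>) + c))
      + g * (\<Sum>\<sigma>\<in>{-1, 1}. mag (P \<sigma> \<sigma>' (xl \<sigma> L, yg \<sigma>' \<mu>)) $ 1 - mag (P \<sigma> \<sigma>' (xl \<sigma> 1, yg \<sigma>' \<mu>)) $ 1)"
proof -
  define y where "y = yg \<sigma>' \<mu>"
  have i: "-1 \<in> {-1, 1::real}" "1 \<in> {-1, 1::real}" by simp_all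
  have adm: "P (-1) \<sigma>' (xl (-1) 1, y) \<in> admissible" "P (-1) \<sigma>' (xl (-1) L, y) \<in> admissible"
      "P 1 \<sigma>' (xl 1 1, y) \<in> admissible" "P 1 \<sigma>' (xl 1 L, y) \<in> admissible"
    unfolding y_def using P_admissible(2)[OF i(1) \<mu>(2,1)] P_admissible(2)[OF i(2) \<mu>(2,1)] L_range by auto
  have W: "W (xpos M (r + 1/2), y) = P 1 \<sigma>' (xl 1 L, y)" "W (xpos M (r - 1/2), y) = P (-1) \<sigma>' (xl (-1) 1, y)"
    unfolding y_def xl_ends using W_mid_x[OF \<mu>] by simp_all
  have jump: "jump (\<lambda>t. mag (W (t, y)) $ 1) (xpos M r) = mag (P 1 \<sigma>' (xl 1 1, y)) $ 1 - mag (P (-1) \<sigma>' (xl (-1) L, y)) $ 1"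
    unfolding jump_def y_def xl_ends by (simp add: Lim_x[OF mag_continuous \<mu>])
  have mean: "mean (\<lambda>t. W (t, y)) (xpos M r) = (1/2) *\<^sub>R (P (-1) \<sigma>' (xl (-1) L, y) + P 1 \<sigma>' (xl 1 1, y))"
    unfolding mean_def y_def xl_ends using Lim_x[OF continuous_on_id \<mu>] by simp
  \<comment> \<open>Linearity of the density identifies the mean under the root in
    \<open>jump_speed1\<close> with the density of the state at which the source is taken.\<close>
  have rmean: "mean (\<lambda>t. rho (W (t, y))) (xpos M r) = rho (mean (\<lambda>t. W (t, y)) (xpos M r))"
    unfolding mean unfolding mean_def y_def xl_ends Lim_x[OF rho_continuous \<mu>] by (simp add: rho_def)
  note sb = side_bound[OF test adm wb[folded y_def, unfolded W] jump mean js[folded y_def, unfolded jump_speed1_def rmean]]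
  show "0 \<le> a" by (rule sb(1))
  show "n \<bullet> (flux p 1 (W (xpos M (r + 1/2), yg \<sigma>' \<mu>)) - flux p 1 (W (xpos M (r - 1/2), yg \<sigma>' \<mu>)))
      + jump (\<lambda>t. mag (W (t, yg \<sigma>' \<mu>)) $ 1) (xpos M r) * (n \<bullet> source (mean (\<lambda>t. W (t, yg \<sigma>' \<mu>)) (xpos M r)))
    \<le> a * (\<Sum>\<sigma>\<in>{-1, 1}. (n \<bullet> P \<sigma> \<sigma>' (xl \<sigma> 1, yg \<sigma>' \<mu>) + c) + (n \<bullet> P \<sigma> \<sigma>' (xl \<sigma> L, yg \<sigma>' \<mu>) + c))
      + g * (\<Sum>\<sigma>\<in>{-1, 1}. mag (P \<sigma> \<sigma>' (xl \<sigma> L, yg \<sigma>' \<mu>)) $ 1 - mag (P \<sigma> \<sigma>' (xl \<sigma> 1, yg \<sigma>' \<mu>)) $ 1)"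
    using sb(2) unfolding y_def[symmetric] W by simp
qed

lemma y_side:
  assumes test: "dual_test p n c g" and \<mu>: "\<mu> \<in> {1..N}" "\<sigma> \<in> {-1, 1}"
    and wb: "wave_bound p 2 (W (xg \<sigma> \<mu>, ypos M (s + 1/2))) (W (xg \<sigma> \<mu>, ypos M (s - 1/2))) \<le> a"
    and js: "jump_speed2 M W (xg \<sigma> \<mu>) s \<le> a"
  shows "0 \<le> a"
    "n \<bullet> (flux p 2 (W (xg \<sigma> \<mu>, ypos M (s + 1/2))) - flux p 2 (W (xg \<sigma> \<mu>, ypos M (s - 1/2))))
      + jump (\<lambda>t. mag (W (xg \<sigma> \<mu>, t)) $ 2) (ypos M s) * (n \<bullet> source (mean (\<lambda>t. W (xg \<sigma> \<mu>, t)) (ypos M s)))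
    \<le> a * (\<Sum>\<sigma>'\<in>{-1, 1}. (n \<bullet> P \<sigma> \<sigma>' (xg \<sigma> \<mu>, yl \<sigma>' 1) + c) + (n \<bullet> P \<sigma> \<sigma>' (xg \<sigma> \<mu>, yl \<sigma>' L) + c))
      + g * (\<Sum>\<sigma>'\<in>{-1, 1}. mag (P \<sigma> \<sigma>' (xg \<sigma> \<mu>, yl \<sigma>' L)) $ 2 - mag (P \<sigma> \<sigma>' (xg \<sigma> \<mu>, yl \<sigma>' 1)) $ 2)"
proof -
  define x where "x = xg \<sigma> \<mu>"
  have i: "-1 \<in> {-1, 1::real}" "1 \<in> {-1, 1::real}" by simp_all
  have adm: "P \<sigma> (-1) (x, yl (-1) 1) \<in> admissible" "P \<sigma> (-1) (x, yl (-1) L) \<in> admissible"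
      "P \<sigma> 1 (x, yl 1 1) \<in> admissible" "P \<sigma> 1 (x, yl 1 L) \<in> admissible"
    unfolding x_def using P_admissible(1)[OF \<mu>(2) i(1) \<mu>(1)] P_admissible(1)[OF \<mu>(2) i(2) \<mu>(1)] L_range by auto
  have W: "W (x, ypos M (s + 1/2)) = P \<sigma> 1 (x, yl 1 L)" "W (x, ypos M (s - 1/2)) = P \<sigma> (-1) (x, yl (-1) 1)"
    unfolding x_def yl_ends using W_mid_y[OF \<mu>] by simp_all
  have jump: "jump (\<lambda>t. mag (W (x, t)) $ 2) (ypos M s) = mag (P \<sigma> 1 (x, yl 1 1)) $ 2 - mag (P \<sigma> (-1) (x, yl (-1) L)) $ 2"
    unfolding jump_def x_def yl_ends by (simp add: Lim_y[OF mag_continuous \<mu>])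
  have mean: "mean (\<lambda>t. W (x, t)) (ypos M s) = (1/2) *\<^sub>R (P \<sigma> (-1) (x, yl (-1) L) + P \<sigma> 1 (x, yl 1 1))"
    unfolding mean_def x_def yl_ends using Lim_y[OF continuous_on_id \<mu>] by simp
  have rmean: "mean (\<lambda>t. rho (W (x, t))) (ypos M s) = rho (mean (\<lambda>t. W (x, t)) (ypos M s))"
    unfolding mean unfolding mean_def x_def yl_ends Lim_y[OF rho_continuous \<mu>] by (simp add: rho_def)
  note sb = side_bound[OF test adm wb[folded x_def, unfolded W] jump mean js[folded x_def, unfolded jump_speed2_def rmean]]
  show "0 \<le> a" by (rule sb(1))
  show "n \<bullet> (flux p 2 (W (xg \<sigma> \<mu>, ypos M (s + 1/2))) - flux p 2 (W (xg \<sigma> \<mu>, ypos M (s - 1/2))))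
      + jump (\<lambda>t. mag (W (xg \<sigma> \<mu>, t)) $ 2) (ypos M s) * (n \<bullet> source (mean (\<lambda>t. W (xg \<sigma> \<mu>, t)) (ypos M s)))
    \<le> a * (\<Sum>\<sigma>'\<in>{-1, 1}. (n \<bullet> P \<sigma> \<sigma>' (xg \<sigma> \<mu>, yl \<sigma>' 1) + c) + (n \<bullet> P \<sigma> \<sigma>' (xg \<sigma> \<mu>, yl \<sigma>' L) + c))
      + g * (\<Sum>\<sigma>'\<in>{-1, 1}. mag (P \<sigma> \<sigma>' (xg \<sigma> \<mu>, yl \<sigma>' L)) $ 2 - mag (P \<sigma> \<sigma>' (xg \<sigma> \<mu>, yl \<sigma>' 1)) $ 2)"
    using sb(2) unfolding x_def[symmetric] W by simp
qed

text \<open>Interior Lobatto nodes contribute positively and are dropped; what is kept are the face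
  and mid-line values bounding the flux in \<open>x_side\<close>, with the same Gauss
  weights.\<close>

lemma mean_ge_x_ends:
  assumes pos: "\<And>U. U \<in> admissible \<Longrightarrow> n \<bullet> U + c > 0"
  shows "\<omega>' 1 / 4 * (\<Sum>\<sigma>\<in>{-1, 1}. \<Sum>\<sigma>'\<in>{-1, 1}. \<Sum>\<mu>=1..N. \<omega> \<mu> *
      ((n \<bullet> P \<sigma> \<sigma>' (xl \<sigma> 1, yg \<sigma>' \<mu>) + c) + (n \<bullet> P \<sigma> \<sigma>' (xl \<sigma> L, yg \<sigma>' \<mu>) + c)))
    \<le> n \<bullet> cell_avg M W r s + c"
proof -
  have "\<omega>' 1 * (\<Sum>\<mu>=1..N. \<omega> \<mu> *
      ((n \<bullet> P \<sigma> \<sigma>' (xl \<sigma> 1, yg \<sigma>' \<mu>) + c) + (n \<bullet> P \<sigma> \<sigma>' (xl \<sigma> L, yg \<sigma>' \<mu>) + c)))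
    \<le> (\<Sum>\<nu>=1..L. \<Sum>\<mu>=1..N. \<omega>' \<nu> * \<omega> \<mu> * (n \<bullet> P \<sigma> \<sigma>' (xl \<sigma> \<nu>, yg \<sigma>' \<mu>) + c))"
    if \<sigma>: "\<sigma> \<in> {-1, 1}" "\<sigma>' \<in> {-1, 1}" for \<sigma> \<sigma>'
  proof -
    define h where "h \<nu> = (\<Sum>\<mu>=1..N. \<omega> \<mu> * (n \<bullet> P \<sigma> \<sigma>' (xl \<sigma> \<nu>, yg \<sigma>' \<mu>) + c))" for \<nu>
    have "h \<nu> \<ge> 0" if "\<nu> \<in> {1..L}" for \<nu>
      unfolding h_def using omega_pos pos P_admissible(2)[OF \<sigma> _ that]
      by (intro sum_nonneg mult_nonneg_nonneg) (auto simp: less_imp_le simp del: split_paired_All)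
    then have "\<omega>' 1 * (h 1 + h L) \<le> (\<Sum>\<nu>=1..L. \<omega>' \<nu> * h \<nu>)"
      using end_terms_le[of L \<omega>' h, OF L(1) omega'_pos omega'_ends] by blast
    then show ?thesis
      unfolding h_def sum.distrib[symmetric] distrib_left[symmetric] sum_distrib_left mult.assoc[symmetric] .
  qed
  then have "(\<Sum>\<sigma>\<in>{-1, 1}. \<Sum>\<sigma>'\<in>{-1, 1}. \<omega>' 1 * (\<Sum>\<mu>=1..N. \<omega> \<mu> *
      ((n \<bullet> P \<sigma> \<sigma>' (xl \<sigma> 1, yg \<sigma>' \<mu>) + c) + (n \<bullet> P \<sigma> \<sigma>' (xl \<sigma> L, yg \<sigma>' \<mu>) + c))))
    \<le> (\<Sum>\<sigma>\<in>{-1, 1}. \<Sum>\<sigma>'\<in>{-1, 1}. \<Sum>\<nu>=1..L. \<Sum>\<mu>=1..N. \<omega>' \<nu> * \<omega> \<mu> * (n \<bullet> P \<sigma> \<sigma>' (xl \<sigma> \<nu>, yg \<sigma>' \<mu>) + c))"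
    by (intro sum_mono)
  then show ?thesis
    unfolding quarter_mean[OF lobatto_quad(1) L(2) gauss_quad] sum_distrib_left[symmetric] by simp
qed

lemma mean_ge_y_ends:
  assumes pos: "\<And>U. U \<in> admissible \<Longrightarrow> n \<bullet> U + c > 0"
  shows "\<omega>' 1 / 4 * (\<Sum>\<sigma>\<in>{-1, 1}. \<Sum>\<sigma>'\<in>{-1, 1}. \<Sum>\<mu>=1..N. \<omega> \<mu> *
      ((n \<bullet> P \<sigma> \<sigma>' (xg \<sigma> \<mu>, yl \<sigma>' 1) + c) + (n \<bullet> P \<sigma> \<sigma>' (xg \<sigma> \<mu>, yl \<sigma>' L) + c)))
    \<le> n \<bullet> cell_avg M W r s + c"
proof -
  have "\<omega>' 1 * (\<Sum>\<mu>=1..N. \<omega> \<mu> *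
      ((n \<bullet> P \<sigma> \<sigma>' (xg \<sigma> \<mu>, yl \<sigma>' 1) + c) + (n \<bullet> P \<sigma> \<sigma>' (xg \<sigma> \<mu>, yl \<sigma>' L) + c)))
    \<le> (\<Sum>\<mu>=1..N. \<Sum>\<nu>=1..L. \<omega> \<mu> * \<omega>' \<nu> * (n \<bullet> P \<sigma> \<sigma>' (xg \<sigma> \<mu>, yl \<sigma>' \<nu>) + c))"
    if \<sigma>: "\<sigma> \<in> {-1, 1}" "\<sigma>' \<in> {-1, 1}" for \<sigma> \<sigma>'
  proof -
    have "\<omega>' 1 * (\<omega> \<mu> * ((n \<bullet> P \<sigma> \<sigma>' (xg \<sigma> \<mu>, yl \<sigma>' 1) + c) + (n \<bullet> P \<sigma> \<sigma>' (xg \<sigma> \<mu>, yl \<sigma>' L) + c)))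
        \<le> (\<Sum>\<nu>=1..L. \<omega> \<mu> * \<omega>' \<nu> * (n \<bullet> P \<sigma> \<sigma>' (xg \<sigma> \<mu>, yl \<sigma>' \<nu>) + c))" if \<mu>: "\<mu> \<in> {1..N}" for \<mu>
    proof -
      define h where "h \<nu> = n \<bullet> P \<sigma> \<sigma>' (xg \<sigma> \<mu>, yl \<sigma>' \<nu>) + c" for \<nu>
      have "h \<nu> \<ge> 0" if "\<nu> \<in> {1..L}" for \<nu>
        unfolding h_def using pos P_admissible(1)[OF \<sigma> \<mu> that] by (simp add: less_imp_le)
      then have "\<omega>' 1 * (h 1 + h L) \<le> (\<Sum>\<nu>=1..L. \<omega>' \<nu> * h \<nu>)"
        using end_terms_le[of L \<omega>' h, OF L(1) omega'_pos omega'_ends] by blast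
      then have "\<omega> \<mu> * (\<omega>' 1 * (h 1 + h L)) \<le> \<omega> \<mu> * (\<Sum>\<nu>=1..L. \<omega>' \<nu> * h \<nu>)"
        using omega_pos[OF \<mu>] by (intro mult_left_mono) auto
      then show ?thesis
        unfolding h_def[symmetric] sum_distrib_left by (simp only: mult.assoc mult.left_commute)
    qed
    then show ?thesis unfolding sum_distrib_left by (intro sum_mono)
  qed
  then have "(\<Sum>\<sigma>\<in>{-1, 1}. \<Sum>\<sigma>'\<in>{-1, 1}. \<omega>' 1 * (\<Sum>\<mu>=1..N. \<omega> \<mu> *
      ((n \<bullet> P \<sigma> \<sigma>' (xg \<sigma> \<mu>, yl \<sigma>' 1) + c) + (n \<bullet> P \<sigma> \<sigma>' (xg \<sigma> \<mu>, yl \<sigma>' L) + c))))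
    \<le> (\<Sum>\<sigma>\<in>{-1, 1}. \<Sum>\<sigma>'\<in>{-1, 1}. \<Sum>\<mu>=1..N. \<Sum>\<nu>=1..L. \<omega> \<mu> * \<omega>' \<nu> * (n \<bullet> P \<sigma> \<sigma>' (xg \<sigma> \<mu>, yl \<sigma>' \<nu>) + c))"
    by (intro sum_mono)
  then show ?thesis
    unfolding quarter_mean[OF gauss_quad lobatto_quad(1) L(2)] sum_distrib_left[symmetric] by simp
qed


text \<open>A step of length \<tau> from the other mesh's average alone; the old average enters only
  through convexity in \<open>update_admissible\<close>.\<close>

lemma update_dual_pos:
  assumes test: "dual_test p n c g"
    and wb1: "\<And>\<sigma>' \<mu>. \<sigma>' \<in> {-1, 1} \<Longrightarrow> \<mu> \<in> {1..N} \<Longrightarrow>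
      wave_bound p 1 (W (xpos M (r + 1/2), yg \<sigma>' \<mu>)) (W (xpos M (r - 1/2), yg \<sigma>' \<mu>)) \<le> a1"
    and js1: "\<And>\<sigma>' \<mu>. \<sigma>' \<in> {-1, 1} \<Longrightarrow> \<mu> \<in> {1..N} \<Longrightarrow> jump_speed1 M W r (yg \<sigma>' \<mu>) \<le> a1"
    and wb2: "\<And>\<sigma> \<mu>. \<sigma> \<in> {-1, 1} \<Longrightarrow> \<mu> \<in> {1..N} \<Longrightarrow>
      wave_bound p 2 (W (xg \<sigma> \<mu>, ypos M (s + 1/2))) (W (xg \<sigma> \<mu>, ypos M (s - 1/2))) \<le> a2"
    and js2: "\<And>\<sigma> \<mu>. \<sigma> \<in> {-1, 1} \<Longrightarrow> \<mu> \<in> {1..N} \<Longrightarrow> jump_speed2 M W (xg \<sigma> \<mu>) s \<le> a2"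
    and \<tau>: "\<tau> > 0" and cfl: "a1 * \<tau> / dx M + a2 * \<tau> / dy M < \<omega>' 1 / 2"
  shows "n \<bullet> (cell_avg M W r s + \<tau> *\<^sub>R
    (- ((1 / dx M) *\<^sub>R (\<Sum>\<sigma>\<in>{-1, 1}. \<Sum>\<mu>=1..N. (\<omega> \<mu> / 2) *\<^sub>R
        (flux p 1 (W (xpos M (r + 1/2), yg \<sigma> \<mu>)) - flux p 1 (W (xpos M (r - 1/2), yg \<sigma> \<mu>)))))
     - (1 / dy M) *\<^sub>R (\<Sum>\<sigma>\<in>{-1, 1}. \<Sum>\<mu>=1..N. (\<omega> \<mu> / 2) *\<^sub>R
        (flux p 2 (W (xg \<sigma> \<mu>, ypos M (s + 1/2))) - flux p 2 (W (xg \<sigma> \<mu>, ypos M (s - 1/2)))))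
     + S_op M N \<xi> \<omega> W r s)) + c > 0"
    (is "n \<bullet> ?Z + c > 0")
proof -
  have e_pos: "n \<bullet> U + c > 0" if "U \<in> admissible" for U using test that by (simp add: dual_test_def)
  define A where "A = n \<bullet> cell_avg M W r s + c"
  define endX where "endX \<sigma> \<sigma>' \<mu> = (n \<bullet> P \<sigma> \<sigma>' (xl \<sigma> 1, yg \<sigma>' \<mu>) + c) + (n \<bullet> P \<sigma> \<sigma>' (xl \<sigma> L, yg \<sigma>' \<mu>) + c)" for \<sigma> \<sigma>' \<mu>
  define endY where "endY \<sigma> \<sigma>' \<mu> = (n \<bullet> P \<sigma> \<sigma>' (xg \<sigma> \<mu>, yl \<sigma>' 1) + c) + (n \<bullet> P \<sigma> \<sigma>' (xg \<sigma> \<mu>, yl \<sigma>' L) + c)" for \<sigma> \<sigma>' \<mu>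
  define BX where "BX \<sigma> \<sigma>' \<mu> = mag (P \<sigma> \<sigma>' (xl \<sigma> L, yg \<sigma>' \<mu>)) $ 1 - mag (P \<sigma> \<sigma>' (xl \<sigma> 1, yg \<sigma>' \<mu>)) $ 1" for \<sigma> \<sigma>' \<mu>
  define BY where "BY \<sigma> \<sigma>' \<mu> = mag (P \<sigma> \<sigma>' (xg \<sigma> \<mu>, yl \<sigma>' L)) $ 2 - mag (P \<sigma> \<sigma>' (xg \<sigma> \<mu>, yl \<sigma>' 1)) $ 2" for \<sigma> \<sigma>' \<mu>
  define FX where "FX \<sigma>' \<mu> = n \<bullet> (flux p 1 (W (xpos M (r + 1/2), yg \<sigma>' \<mu>)) - flux p 1 (W (xpos M (r - 1/2), yg \<sigma>' \<mu>)))" for \<sigma>' \<mu>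
  define FY where "FY \<sigma> \<mu> = n \<bullet> (flux p 2 (W (xg \<sigma> \<mu>, ypos M (s + 1/2))) - flux p 2 (W (xg \<sigma> \<mu>, ypos M (s - 1/2))))" for \<sigma> \<mu>
  define JX where "JX \<sigma>' \<mu> = jump (\<lambda>t. mag (W (t, yg \<sigma>' \<mu>)) $ 1) (xpos M r) *
      (n \<bullet> source (mean (\<lambda>t. W (t, yg \<sigma>' \<mu>)) (xpos M r)))" for \<sigma>' \<mu>
  define JY where "JY \<sigma> \<mu> = jump (\<lambda>t. mag (W (xg \<sigma> \<mu>, t)) $ 2) (ypos M s) *
      (n \<bullet> source (mean (\<lambda>t. W (xg \<sigma> \<mu>, t)) (ypos M s)))" for \<sigma> \<mu>
  define sumX where "sumX = (\<Sum>\<sigma>\<in>{-1, 1}. \<Sum>\<sigma>'\<in>{-1, 1}. \<Sum>\<mu>=1..N. \<omega> \<mu> * endX \<sigma> \<sigma>' \<mu>)"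
  define sumY where "sumY = (\<Sum>\<sigma>\<in>{-1, 1}. \<Sum>\<sigma>'\<in>{-1, 1}. \<Sum>\<mu>=1..N. \<omega> \<mu> * endY \<sigma> \<sigma>' \<mu>)"
  define divX where "divX = (\<Sum>\<sigma>\<in>{-1, 1}. \<Sum>\<sigma>'\<in>{-1, 1}. \<Sum>\<mu>=1..N. \<omega> \<mu> * BX \<sigma> \<sigma>' \<mu>)"
  define divY where "divY = (\<Sum>\<sigma>\<in>{-1, 1}. \<Sum>\<sigma>'\<in>{-1, 1}. \<Sum>\<mu>=1..N. \<omega> \<mu> * BY \<sigma> \<sigma>' \<mu>)"
  define GX where "GX = (\<Sum>\<sigma>'\<in>{-1, 1}. \<Sum>\<mu>=1..N. \<omega> \<mu> / 2 * (FX \<sigma>' \<mu> + JX \<sigma>' \<mu>))"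
  define GY where "GY = (\<Sum>\<sigma>\<in>{-1, 1}. \<Sum>\<mu>=1..N. \<omega> \<mu> / 2 * (FY \<sigma> \<mu> + JY \<sigma> \<mu>))"

  have a0: "0 \<le> a1" "0 \<le> a2"
    using x_side(1)[OF test _ _ wb1 js1, of 1 1] y_side(1)[OF test _ _ wb2 js2, of 1 1] by (simp_all add: N_def)
  have SXA: "\<omega>' 1 / 4 * sumX \<le> A" and SYA: "\<omega>' 1 / 4 * sumY \<le> A"
    unfolding A_def sumX_def sumY_def endX_def endY_def using mean_ge_x_ends[OF e_pos] mean_ge_y_ends[OF e_pos] by blast+
  have w0: "\<omega>' 1 > 0" using omega'_pos L_range by blast
  \<comment> \<open>The average of \<open>W\<close> here is over a cell of the opposite mesh, so its
    positivity is derived from the nodal values rather than from the hypotheses on averages.\<close>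
  have "sumX > 0"
  proof -
    have "\<omega> \<mu> * endX \<sigma> \<sigma>' \<mu> > 0" if "\<sigma> \<in> {-1, 1}" "\<sigma>' \<in> {-1, 1}" "\<mu> \<in> {1..N}" for \<sigma> \<sigma>' \<mu>
      unfolding endX_def using omega_pos[OF that(3)] P_admissible(2)[OF that] L_range
      by (intro mult_pos_pos add_pos_pos e_pos) auto
    then show ?thesis unfolding sumX_def using N_def by (intro sum_pos) auto
  qed
  then have A0: "A > 0" using SXA w0 by (meson divide_pos_pos less_le_trans mult_pos_pos zero_less_numeral)

  have GX: "GX \<le> a1 / 2 * sumX + g / 2 * divX"
  proof -
    have "FX \<sigma>' \<mu> + JX \<sigma>' \<mu> \<le> a1 * (\<Sum>\<sigma>\<in>{-1, 1}. endX \<sigma> \<sigma>' \<mu>) + g * (\<Sum>\<sigma>\<in>{-1, 1}. BX \<sigma> \<sigma>' \<mu>)"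
      if "\<sigma>' \<in> {-1, 1}" "\<mu> \<in> {1..N}" for \<sigma>' \<mu>
      unfolding FX_def JX_def endX_def BX_def by (rule x_side(2)[OF test that(2,1) wb1[OF that] js1[OF that]])
    then have "GX \<le> (\<Sum>\<sigma>'\<in>{-1, 1}. \<Sum>\<mu>=1..N. \<omega> \<mu> / 2 *
        (a1 * (\<Sum>\<sigma>\<in>{-1, 1}. endX \<sigma> \<sigma>' \<mu>) + g * (\<Sum>\<sigma>\<in>{-1, 1}. BX \<sigma> \<sigma>' \<mu>)))"
      unfolding GX_def using omega_pos by (intro sum_mono mult_left_mono) (simp_all only: less_imp_le divide_nonneg_pos zero_less_numeral)
    also have "\<dots> = a1 / 2 * sumX + g / 2 * divX"
    proof -
      have "sumX = (\<Sum>\<sigma>'\<in>{-1, 1}. \<Sum>\<sigma>\<in>{-1, 1}. \<Sum>\<mu>=1..N. \<omega> \<mu> * endX \<sigma> \<sigma>' \<mu>)"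
        "divX = (\<Sum>\<sigma>'\<in>{-1, 1}. \<Sum>\<sigma>\<in>{-1, 1}. \<Sum>\<mu>=1..N. \<omega> \<mu> * BX \<sigma> \<sigma>' \<mu>)"
        unfolding sumX_def divX_def by (rule sum.swap)+
      then show ?thesis unfolding sum_sides by (simp only: sum.distrib sum_distrib_left)
    qed
    finally show ?thesis .
  qed
  have GY: "GY \<le> a2 / 2 * sumY + g / 2 * divY"
  proof -
    have "FY \<sigma> \<mu> + JY \<sigma> \<mu> \<le> a2 * (\<Sum>\<sigma>'\<in>{-1, 1}. endY \<sigma> \<sigma>' \<mu>) + g * (\<Sum>\<sigma>'\<in>{-1, 1}. BY \<sigma> \<sigma>' \<mu>)"
      if "\<sigma> \<in> {-1, 1}" "\<mu> \<in> {1..N}" for \<sigma> \<mu>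
      unfolding FY_def JY_def endY_def BY_def by (rule y_side(2)[OF test that(2,1) wb2[OF that] js2[OF that]])
    then have "GY \<le> (\<Sum>\<sigma>\<in>{-1, 1}. \<Sum>\<mu>=1..N. \<omega> \<mu> / 2 *
        (a2 * (\<Sum>\<sigma>'\<in>{-1, 1}. endY \<sigma> \<sigma>' \<mu>) + g * (\<Sum>\<sigma>'\<in>{-1, 1}. BY \<sigma> \<sigma>' \<mu>)))"
      unfolding GY_def using omega_pos by (intro sum_mono mult_left_mono) (simp_all only: less_imp_le divide_nonneg_pos zero_less_numeral)
    also have "\<dots> = a2 / 2 * sumY + g / 2 * divY"
      unfolding sum_sides sumY_def divY_def by (simp only: sum.distrib sum_distrib_left)
    finally show ?thesis .
  qed
  \<comment> \<open>A quarter has sides \<open>dx M / 2\<close> and \<open>dy M / 2\<close>; the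
    common factor 2 drops out of its divergence identity.\<close>
  have T: "divX / dx M + divY / dy M = 0"
  proof -
    have q: "(\<Sum>\<mu>=1..N. \<omega> \<mu> * BX \<sigma> \<sigma>' \<mu>) / dx M + (\<Sum>\<mu>=1..N. \<omega> \<mu> * BY \<sigma> \<sigma>' \<mu>) / dy M = 0"
      if "\<sigma> \<in> {-1, 1}" "\<sigma>' \<in> {-1, 1}" for \<sigma> \<sigma>'
    proof -
      have "x / (a / 2) + y / (b / 2) = 2 * (x / a + y / b)" for x y a b :: real
        by (simp add: distrib_left mult.commute)
      then have "x / (a / 2) + y / (b / 2) = 0 \<Longrightarrow> x / a + y / b = 0" for x y a b :: real
        by simp
      then show ?thesis using quarter_div_free[OF that] unfolding BX_def BY_def by blast
    qed
    have "divX / dx M + divY / dy M = (\<Sum>\<sigma>\<in>{-1, 1}. \<Sum>\<sigma>'\<in>{-1, 1}.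
        (\<Sum>\<mu>=1..N. \<omega> \<mu> * BX \<sigma> \<sigma>' \<mu>) / dx M + (\<Sum>\<mu>=1..N. \<omega> \<mu> * BY \<sigma> \<sigma>' \<mu>) / dy M)"
      unfolding divX_def divY_def sum.distrib sum_divide_distrib ..
    also have "\<dots> = 0" using q by (intro sum.neutral ballI)
    finally show ?thesis .
  qed
  define fx where "fx = (\<Sum>\<sigma>\<in>{-1, 1}. \<Sum>\<mu>=1..N. \<omega> \<mu> / 2 * FX \<sigma> \<mu>)"
  define fy where "fy = (\<Sum>\<sigma>\<in>{-1, 1}. \<Sum>\<mu>=1..N. \<omega> \<mu> / 2 * FY \<sigma> \<mu>)"
  define jx where "jx = (\<Sum>\<sigma>\<in>{-1, 1}. \<Sum>\<mu>=1..N. \<omega> \<mu> / 2 * JX \<sigma> \<mu>)"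
  define jy where "jy = (\<Sum>\<sigma>\<in>{-1, 1}. \<Sum>\<mu>=1..N. \<omega> \<mu> / 2 * JY \<sigma> \<mu>)"
  have G: "GX = fx + jx" "GY = fy + jy"
    unfolding GX_def GY_def fx_def fy_def jx_def jy_def distrib_left sum.distrib by (rule refl)+
  \<comment> \<open>In \<open>S_op\<close> one index pair selects a y-node for the x-jump and an
    x-node for the y-jump, so the sum separates into the two directions.\<close>
  have S: "n \<bullet> S_op M N \<xi> \<omega> W r s = - (jx / dx M + jy / dy M)"
    unfolding S_op_def Let_def inner_minus_right inner_sum_right inner_scaleR_right inner_add_right
      jx_def jy_def JX_def JY_def sum_divide_distrib sum.distrib[symmetric]
    by (simp only: distrib_left times_divide_eq_left times_divide_eq_right mult.assoc)
  have Z: "n \<bullet> ?Z = n \<bullet> cell_avg M W r s + \<tau> * (- (1 / dx M * fx) - 1 / dy M * fy + - (jx / dx M + jy / dy M))"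
    unfolding inner_add_right[of n "cell_avg M W r s"] inner_scaleR_right[of n \<tau>]
      inner_add_right[of n _ "S_op M N \<xi> \<omega> W r s"] S fx_def fy_def FX_def FY_def
    by (simp only: inner_diff_right inner_minus_right inner_scaleR_right inner_sum_right)
  have Z_eq: "n \<bullet> ?Z + c = A - \<tau> * (GX / dx M + GY / dy M)"
    unfolding Z G A_def by (simp add: algebra_simps add_divide_distrib)
  have "GX / dx M + GY / dy M \<le> a1 / 2 * sumX / dx M + a2 / 2 * sumY / dy M"
  proof -
    have "GX / dx M \<le> (a1 / 2 * sumX + g / 2 * divX) / dx M" "GY / dy M \<le> (a2 / 2 * sumY + g / 2 * divY) / dy M"
      using GX GY mesh by (simp_all add: divide_right_mono)
    moreover have "g / 2 * divX / dx M + g / 2 * divY / dy M = 0"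
      using arg_cong[OF T, of "(*) (g / 2)"] by (simp add: distrib_left)
    ultimately show ?thesis by (simp add: add_divide_distrib)
  qed
  moreover have "a1 / 2 * sumX / dx M + a2 / 2 * sumY / dy M \<le> (a1 / dx M + a2 / dy M) * (2 * A / \<omega>' 1)"
  proof -
    \<comment> \<open>Both directions are compared with the whole of \<open>A\<close>, since either
      product rule computes it; therefore the CFL condition bounds the sum of the two Courant
      numbers, and 2 / \<open>\<omega>' 1\<close> is the reciprocal of its bound.\<close>
    have h: "sumX / 2 \<le> 2 * A / \<omega>' 1" "sumY / 2 \<le> 2 * A / \<omega>' 1"
      using SXA SYA w0 by (simp_all add: field_simps)
    have q: "0 \<le> a1 / dx M" "0 \<le> a2 / dy M" using a0 mesh by simp_all
    have "a1 / 2 * sumX / dx M + a2 / 2 * sumY / dy M = a1 / dx M * (sumX / 2) + a2 / dy M * (sumY / 2)"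
      by simp
    also have "\<dots> \<le> a1 / dx M * (2 * A / \<omega>' 1) + a2 / dy M * (2 * A / \<omega>' 1)"
      by (rule add_mono[OF mult_left_mono[OF h(1) q(1)] mult_left_mono[OF h(2) q(2)]])
    also have "\<dots> = (a1 / dx M + a2 / dy M) * (2 * A / \<omega>' 1)" by (rule distrib_right[symmetric])
    finally show ?thesis .
  qed
  ultimately have "GX / dx M + GY / dy M \<le> (a1 / dx M + a2 / dy M) * (2 * A / \<omega>' 1)"
    by (rule order_trans)
  from mult_left_mono[OF this less_imp_le[OF \<tau>]]
  have "n \<bullet> ?Z + c \<ge> A - \<tau> * ((a1 / dx M + a2 / dy M) * (2 * A / \<omega>' 1))"
    unfolding Z_eq by (rule diff_left_mono)
  moreover have "\<tau> * ((a1 / dx M + a2 / dy M) * (2 * A / \<omega>' 1)) = (a1 * \<tau> / dx M + a2 * \<tau> / dy M) * (2 * A / \<omega>' 1)"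
  proof -
    have "\<tau> * (a1 / dx M + a2 / dy M) = a1 * \<tau> / dx M + a2 * \<tau> / dy M"
      by (simp add: distrib_left mult.commute)
    then show ?thesis by (simp only: mult.assoc[symmetric])
  qed
  moreover have "(a1 * \<tau> / dx M + a2 * \<tau> / dy M) * (2 * A / \<omega>' 1) < A"
  proof -
    have "(a1 * \<tau> / dx M + a2 * \<tau> / dy M) * (2 * A / \<omega>' 1) < \<omega>' 1 / 2 * (2 * A / \<omega>' 1)"
      using cfl A0 w0 by (intro mult_strict_right_mono) auto
    also have "\<dots> = A" using w0 by simp
    finally show ?thesis .
  qed
  ultimately show ?thesis by linarith
qed

text \<open>Because \<Delta>t = \<theta> \<tau>, the relaxation term of \<open>L_op\<close> turns
  the update into (1 - \<theta>) times the old average plus \<theta> times the step from the other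
  average. Dividing the CFL condition by \<theta> gives the one for step length \<tau>.\<close>

lemma update_admissible:
  assumes wb1: "\<And>\<sigma>' \<mu>. \<sigma>' \<in> {-1, 1} \<Longrightarrow> \<mu> \<in> {1..N} \<Longrightarrow>
      wave_bound p 1 (W (xpos M (r + 1/2), yg \<sigma>' \<mu>)) (W (xpos M (r - 1/2), yg \<sigma>' \<mu>)) \<le> a1"
    and js1: "\<And>\<sigma>' \<mu>. \<sigma>' \<in> {-1, 1} \<Longrightarrow> \<mu> \<in> {1..N} \<Longrightarrow> jump_speed1 M W r (yg \<sigma>' \<mu>) \<le> a1"
    and wb2: "\<And>\<sigma> \<mu>. \<sigma> \<in> {-1, 1} \<Longrightarrow> \<mu> \<in> {1..N} \<Longrightarrow>
      wave_bound p 2 (W (xg \<sigma> \<mu>, ypos M (s + 1/2))) (W (xg \<sigma> \<mu>, ypos M (s - 1/2))) \<le> a2"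
    and js2: "\<And>\<sigma> \<mu>. \<sigma> \<in> {-1, 1} \<Longrightarrow> \<mu> \<in> {1..N} \<Longrightarrow> jump_speed2 M W (xg \<sigma> \<mu>) s \<le> a2"
    and V: "cell_avg M V r s \<in> admissible"
    and \<tau>: "\<tau> > 0" and \<theta>: "\<theta> = \<Delta>t / \<tau>" "0 < \<theta>" "\<theta> \<le> 1"
    and cfl: "a1 * \<Delta>t / dx M + a2 * \<Delta>t / dy M < \<theta> * \<omega>' 1 / 2"
  shows "cell_avg M V r s + \<Delta>t *\<^sub>R Lnew p M N \<xi> \<omega> \<tau> V W r s \<in> admissible"
proof -
  define R where "R = - ((1 / dx M) *\<^sub>R (\<Sum>\<sigma>\<in>{-1, 1}. \<Sum>\<mu>=1..N. (\<omega> \<mu> / 2) *\<^sub>R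
        (flux p 1 (W (xpos M (r + 1/2), yg \<sigma> \<mu>)) - flux p 1 (W (xpos M (r - 1/2), yg \<sigma> \<mu>)))))
     - (1 / dy M) *\<^sub>R (\<Sum>\<sigma>\<in>{-1, 1}. \<Sum>\<mu>=1..N. (\<omega> \<mu> / 2) *\<^sub>R
        (flux p 2 (W (xg \<sigma> \<mu>, ypos M (s + 1/2))) - flux p 2 (W (xg \<sigma> \<mu>, ypos M (s - 1/2)))))
     + S_op M N \<xi> \<omega> W r s"
  have dt: "\<Delta>t = \<theta> * \<tau>" using \<theta>(1) \<tau> by simp
  have "\<theta> * (a1 * \<tau> / dx M + a2 * \<tau> / dy M) < \<theta> * (\<omega>' 1 / 2)"
    using cfl by (simp add: dt algebra_simps)
  then have cfl': "a1 * \<tau> / dx M + a2 * \<tau> / dy M < \<omega>' 1 / 2" using \<theta>(2) by simp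
  have pos: "n \<bullet> (cell_avg M W r s + \<tau> *\<^sub>R R) + c > 0" if "dual_test p n c g" for n c g
    unfolding R_def by (rule update_dual_pos[OF that wb1 js1 wb2 js2 \<tau> cfl'])
  have "cell_avg M W r s + \<tau> *\<^sub>R R \<in> admissible"
    using pos[OF dual_test_density] pos[OF dual_test_energy]
    by (intro admissibleI) (simp_all add: rho_inner dual_energy_def)
  from admissible_convex[OF V this \<theta>(2,3)]
  show ?thesis
  proof (rule back_subst[of "\<lambda>z. z \<in> admissible"])
    have "Lnew p M N \<xi> \<omega> \<tau> V W r s = (1 / \<tau>) *\<^sub>R (cell_avg M W r s - cell_avg M V r s) + R"
      unfolding Lnew_def L_op_def R_def diff_conv_add_uminus add.assoc ..
    then show "(1 - \<theta>) *\<^sub>R cell_avg M V r s + \<theta> *\<^sub>R (cell_avg M W r s + \<tau> *\<^sub>R R) =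
        cell_avg M V r s + \<Delta>t *\<^sub>R Lnew p M N \<xi> \<omega> \<tau> V W r s"
      using \<tau> by (simp add: dt scaleR_add_right scaleR_diff_right scaleR_diff_left)
  qed
qed

end

text \<open>One vector-valued polynomial per neighbour serves all functionals n at once, as n is
  applied to its coefficients.\<close>

lemma central_cell_exists:
  assumes "dx M > 0" "dy M > 0" "N = k + 1" "L \<ge> 2" "k \<le> 2 * L - 3"
    and "gauss_rule N \<xi> \<omega>" "gauss_lobatto_rule L \<eta> \<omega>'"
    and W: "W \<in> ldf_space M C k"
    and C: "\<And>\<sigma> \<sigma>'. \<sigma> \<in> {-1, 1} \<Longrightarrow> \<sigma>' \<in> {-1, 1} \<Longrightarrow> (r + \<sigma>/2, s + \<sigma>'/2) \<in> C"
    and "admissible_at_nodes M N \<xi> L \<eta> W r s"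
  obtains P where "central_cell M k N L \<xi> \<omega> \<eta> \<omega>' W r s P"
proof -
  define rep where "rep \<sigma> \<sigma>' F \<longleftrightarrow> (\<forall>n. bipoly k (\<lambda>z. n \<bullet> F z)) \<and> continuous_on UNIV F \<and>
      (\<forall>z \<in> cell M (r + \<sigma>/2) (s + \<sigma>'/2). W z = F z)" for \<sigma> \<sigma>' F
  have ex: "\<exists>F. rep \<sigma> \<sigma>' F" if "\<sigma> \<in> {-1, 1}" "\<sigma>' \<in> {-1, 1}" for \<sigma> \<sigma>'
  proof -
    have "polynomial_on k (cell M (r + \<sigma>/2) (s + \<sigma>'/2)) W"
      using W C[OF that] unfolding ldf_space_def by blast
    then obtain c where c: "\<forall>(x, y) \<in> cell M (r + \<sigma>/2) (s + \<sigma>'/2).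
        W (x, y) = (\<Sum>a\<le>k. \<Sum>b\<le>k - a. (x ^ a * y ^ b) *\<^sub>R c a b)"
      unfolding polynomial_on_def by blast
    define F where "F z = (\<Sum>a\<le>k. \<Sum>b\<le>k - a. (fst z ^ a * snd z ^ b) *\<^sub>R c a b)" for z
    have "bipoly k (\<lambda>z. n \<bullet> F z)" for n
      unfolding F_def inner_sum_right inner_scaleR_right by (rule bipoly_poly_sum)
    moreover have "continuous_on UNIV F" unfolding F_def[abs_def] by (intro continuous_intros)
    moreover have "\<forall>z \<in> cell M (r + \<sigma>/2) (s + \<sigma>'/2). W z = F z"
      using c by (simp add: F_def case_prod_beta)
    ultimately show ?thesis unfolding rep_def by blast
  qed
  define P where "P \<sigma> \<sigma>' = (SOME F. rep \<sigma> \<sigma>' F)" for \<sigma> \<sigma>'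
  have P: "rep \<sigma> \<sigma>' (P \<sigma> \<sigma>')" if "\<sigma> \<in> {-1, 1}" "\<sigma>' \<in> {-1, 1}" for \<sigma> \<sigma>'
    unfolding P_def by (rule someI_ex[OF ex[OF that]])
  have div: "divergence_free_on (cell M (r + \<sigma>/2) (s + \<sigma>'/2)) W" if "\<sigma> \<in> {-1, 1}" "\<sigma>' \<in> {-1, 1}" for \<sigma> \<sigma>'
    using W C[OF that] unfolding ldf_space_def by blast
  have "central_cell M k N L \<xi> \<omega> \<eta> \<omega>' W r s P"
    by (rule central_cell.intro[OF assms(1-7) _ _ _ div assms(10)]) (use P[unfolded rep_def] in blast)+
  then show thesis by (rule that)
qed

section \<open>The central scheme on the whole mesh\<close>

text \<open>\<open>Max\<close> bounds its elements only on finite sets, so the sets in the wave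
  speeds must be shown finite.\<close>

lemma finite_cell_nodes:
  assumes "finite C" "\<And>r s. finite (A r s)"
  shows "finite {f r s y | r s y. (r, s) \<in> C \<and> y \<in> A r s}"
proof (rule finite_subset)
  show "finite ((\<lambda>((r, s), y). f r s y) ` (SIGMA (r, s):C. A r s))"
    using assms by (intro finite_imageI finite_SigmaI) auto
qed force

lemma finite_cells: "finite (primal_cells M)" "finite (dual_cells M)"
proof -
  have "primal_cells M = (\<lambda>(i, j). (real i, real j)) ` ({1..cells_x M} \<times> {1..cells_y M})"
    "dual_cells M = (\<lambda>(i, j). (real i + 1/2, real j + 1/2)) ` ({0..cells_x M} \<times> {0..cells_y M})"
    by (auto simp: primal_cells_def dual_cells_def)
  then show "finite (primal_cells M)" "finite (dual_cells M)" by simp_all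
qed

lemma finite_nodes: "finite (nodes_x M n \<xi> r)" "finite (nodes_y M n \<xi> s)"
proof -
  have "nodes_x M n \<xi> r \<subseteq> (\<Union>\<sigma>\<in>{-1, 1}. node_x M \<xi> (r + \<sigma>/4) ` {1..n})"
    "nodes_y M n \<xi> s \<subseteq> (\<Union>\<sigma>\<in>{-1, 1}. node_y M \<xi> (s + \<sigma>/4) ` {1..n})"
    unfolding nodes_x_def nodes_y_def by blast+
  then show "finite (nodes_x M n \<xi> r)" "finite (nodes_y M n \<xi> s)"
    by (simp_all add: finite_subset)
qed

lemma node_in_nodes:
  assumes "\<mu> \<in> {1..n}" "\<sigma> \<in> {-1, 1}"
  shows "node_x M \<xi> (r + \<sigma>/4) \<mu> \<in> nodes_x M n \<xi> r" "node_y M \<xi> (s + \<sigma>/4) \<mu> \<in> nodes_y M n \<xi> s"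
  using assms unfolding nodes_x_def nodes_y_def by blast+

lemma primal_neighbours:
  assumes "(r, s) \<in> primal_cells M" "\<sigma> \<in> {-1, 1}" "\<sigma>' \<in> {-1, 1}"
  shows "(r + \<sigma>/2, s + \<sigma>'/2) \<in> dual_cells M"
proof -
  obtain i j where ij: "r = real i" "s = real j" "i \<in> {1..cells_x M}" "j \<in> {1..cells_y M}"
    using assms(1) by (auto simp: primal_cells_def)
  \<comment> \<open>For \<sigma> = -1 the centre i - 1/2 is (i - 1) + 1/2, and i >= 1 keeps the
    natural subtraction exact.\<close>
  have "\<exists>i'. i' \<in> {0..cells_x M} \<and> r + \<sigma>/2 = real i' + 1/2"
    using ij assms(2) by (intro exI[of _ "if \<sigma> = 1 then i else i - 1"]) (auto simp: of_nat_diff)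
  moreover have "\<exists>j'. j' \<in> {0..cells_y M} \<and> s + \<sigma>'/2 = real j' + 1/2"
    using ij assms(3) by (intro exI[of _ "if \<sigma>' = 1 then j else j - 1"]) (auto simp: of_nat_diff)
  ultimately show ?thesis unfolding dual_cells_def by blast
qed

text \<open>The outermost dual cells reach the indices 0 and \<open>cells_x M + 1\<close>, hence the
  ghost layer.\<close>

lemma dual_neighbours:
  assumes "(r, s) \<in> dual_cells M" "\<sigma> \<in> {-1, 1}" "\<sigma>' \<in> {-1, 1}"
  shows "(r + \<sigma>/2, s + \<sigma>'/2) \<in> primal_ghost_cells M"
proof -
  obtain i j where ij: "r = real i + 1/2" "s = real j + 1/2" "i \<in> {0..cells_x M}" "j \<in> {0..cells_y M}"
    using assms(1) by (auto simp: dual_cells_def)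
  have "\<exists>i'. i' \<in> {0..cells_x M + 1} \<and> r + \<sigma>/2 = real i'"
    using ij assms(2) by (intro exI[of _ "if \<sigma> = 1 then i + 1 else i"]) auto
  moreover have "\<exists>j'. j' \<in> {0..cells_y M + 1} \<and> s + \<sigma>'/2 = real j'"
    using ij assms(3) by (intro exI[of _ "if \<sigma>' = 1 then j + 1 else j"]) auto
  ultimately show ?thesis unfolding primal_ghost_cells_def by blast
qed

lemma le_Max_union:
  assumes "finite A" "finite B"
  shows "x \<in> A \<Longrightarrow> x \<le> Max (A \<union> B)" "x \<in> B \<Longrightarrow> x \<le> Max (A \<union> B)"
  using assms by (auto intro: Max_ge)

lemma wave_speed1_bounds:
  assumes a: "a = max (a_hat1 p M N \<xi> UC UD) (beta1 M N \<xi> UC UD)"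
  shows "(r, s) \<in> primal_cells M \<Longrightarrow> y \<in> nodes_y M N \<xi> s \<Longrightarrow> wave_bound p 1 (UD (xpos M (r + 1/2), y)) (UD (xpos M (r - 1/2), y)) \<le> a"
    "(r, s) \<in> primal_cells M \<Longrightarrow> y \<in> nodes_y M N \<xi> s \<Longrightarrow> jump_speed1 M UD r y \<le> a"
    "(r, s) \<in> dual_cells M \<Longrightarrow> y \<in> nodes_y M N \<xi> s \<Longrightarrow> wave_bound p 1 (UC (xpos M (r + 1/2), y)) (UC (xpos M (r - 1/2), y)) \<le> a"
    "(r, s) \<in> dual_cells M \<Longrightarrow> y \<in> nodes_y M N \<xi> s \<Longrightarrow> jump_speed1 M UC r y \<le> a"
proof -
  note fin = finite_cell_nodes[OF finite_cells(1) finite_nodes(2)] finite_cell_nodes[OF finite_cells(2) finite_nodes(2)]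
  have le: "x \<le> a_hat1 p M N \<xi> UC UD \<Longrightarrow> x \<le> a" "x \<le> beta1 M N \<xi> UC UD \<Longrightarrow> x \<le> a" for x
    using a by auto
  show "(r, s) \<in> primal_cells M \<Longrightarrow> y \<in> nodes_y M N \<xi> s \<Longrightarrow> wave_bound p 1 (UD (xpos M (r + 1/2), y)) (UD (xpos M (r - 1/2), y)) \<le> a"
    by (rule le(1), unfold a_hat1_def, rule le_Max_union(2)[OF fin(2,1)], rule CollectI, intro exI conjI, rule refl)
  show "(r, s) \<in> primal_cells M \<Longrightarrow> y \<in> nodes_y M N \<xi> s \<Longrightarrow> jump_speed1 M UD r y \<le> a"
    by (rule le(2), unfold beta1_def, rule le_Max_union(1)[OF fin], rule CollectI, intro exI conjI, rule refl)
  show "(r, s) \<in> dual_cells M \<Longrightarrow> y \<in> nodes_y M N \<xi> s \<Longrightarrow> wave_bound p 1 (UC (xpos M (r + 1/2), y)) (UC (xpos M (r - 1/2), y)) \<le> a"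
    by (rule le(1), unfold a_hat1_def, rule le_Max_union(1)[OF fin(2,1)], rule CollectI, intro exI conjI, rule refl)
  show "(r, s) \<in> dual_cells M \<Longrightarrow> y \<in> nodes_y M N \<xi> s \<Longrightarrow> jump_speed1 M UC r y \<le> a"
    by (rule le(2), unfold beta1_def, rule le_Max_union(2)[OF fin], rule CollectI, intro exI conjI, rule refl)
qed

lemma wave_speed2_bounds:
  assumes a: "a = max (a_hat2 p M N \<xi> UC UD) (beta2 M N \<xi> UC UD)"
  shows "(r, s) \<in> primal_cells M \<Longrightarrow> x \<in> nodes_x M N \<xi> r \<Longrightarrow> wave_bound p 2 (UD (x, ypos M (s + 1/2))) (UD (x, ypos M (s - 1/2))) \<le> a"
    "(r, s) \<in> primal_cells M \<Longrightarrow> x \<in> nodes_x M N \<xi> r \<Longrightarrow> jump_speed2 M UD x s \<le> a"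
    "(r, s) \<in> dual_cells M \<Longrightarrow> x \<in> nodes_x M N \<xi> r \<Longrightarrow> wave_bound p 2 (UC (x, ypos M (s + 1/2))) (UC (x, ypos M (s - 1/2))) \<le> a"
    "(r, s) \<in> dual_cells M \<Longrightarrow> x \<in> nodes_x M N \<xi> r \<Longrightarrow> jump_speed2 M UC x s \<le> a"
proof -
  note fin = finite_cell_nodes[OF finite_cells(1) finite_nodes(1)] finite_cell_nodes[OF finite_cells(2) finite_nodes(1)]
  have le: "x \<le> a_hat2 p M N \<xi> UC UD \<Longrightarrow> x \<le> a" "x \<le> beta2 M N \<xi> UC UD \<Longrightarrow> x \<le> a" for x
    using a by auto
  show "(r, s) \<in> primal_cells M \<Longrightarrow> x \<in> nodes_x M N \<xi> r \<Longrightarrow> wave_bound p 2 (UD (x, ypos M (s + 1/2))) (UD (x, ypos M (s - 1/2))) \<le> a"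
    by (rule le(1), unfold a_hat2_def, rule le_Max_union(2)[OF fin(2,1)], rule CollectI, intro exI conjI, rule refl)
  show "(r, s) \<in> primal_cells M \<Longrightarrow> x \<in> nodes_x M N \<xi> r \<Longrightarrow> jump_speed2 M UD x s \<le> a"
    by (rule le(2), unfold beta2_def, rule le_Max_union(1)[OF fin], rule CollectI, intro exI conjI, rule refl)
  show "(r, s) \<in> dual_cells M \<Longrightarrow> x \<in> nodes_x M N \<xi> r \<Longrightarrow> wave_bound p 2 (UC (x, ypos M (s + 1/2))) (UC (x, ypos M (s - 1/2))) \<le> a"
    by (rule le(1), unfold a_hat2_def, rule le_Max_union(1)[OF fin(2,1)], rule CollectI, intro exI conjI, rule refl)
  show "(r, s) \<in> dual_cells M \<Longrightarrow> x \<in> nodes_x M N \<xi> r \<Longrightarrow> jump_speed2 M UC x s \<le> a"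
    by (rule le(2), unfold beta2_def, rule le_Max_union(2)[OF fin], rule CollectI, intro exI conjI, rule refl)
qed

theorem theorem5p1:
  fixes p :: "real \<Rightarrow> real \<Rightarrow> real"
    and M :: mesh
    and k N L :: nat
    and \<xi> \<omega> \<eta> \<omega>' :: "nat \<Rightarrow> real"
    and UC UD :: "real \<times> real \<Rightarrow> state"
    and a1 a2 \<Delta>t \<tau>max \<theta> :: real
  assumes eos: "equation_of_state p"
    and mesh: "valid_mesh M"
    and N_def: "N = k + 1"
    and L_def: "L = nat \<lceil>(real k + 3) / 2\<rceil>"
    and gauss: "gauss_rule N \<xi> \<omega>"
    and lobatto: "gauss_lobatto_rule L \<eta> \<omega>'"
    and UC_space: "UC \<in> W_primal M k"
    and UD_space: "UD \<in> W_dual M k"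
    and UC_avg: "\<forall>(r, s) \<in> primal_cells M. cell_avg M UC r s \<in> admissible"
    and UD_avg: "\<forall>(r, s) \<in> dual_cells M. cell_avg M UD r s \<in> admissible"
    and nodes: "\<forall>(r, s) \<in> primal_cells M \<union> dual_cells M.
        admissible_at_nodes M N \<xi> L \<eta> UC r s \<and> admissible_at_nodes M N \<xi> L \<eta> UD r s"
    and a1: "a1 = max (a_hat1 p M N \<xi> UC UD) (beta1 M N \<xi> UC UD)"
    and a2: "a2 = max (a_hat2 p M N \<xi> UC UD) (beta2 M N \<xi> UC UD)"
    and dt: "\<Delta>t > 0" and tau: "\<tau>max > 0"
    and theta: "\<theta> = \<Delta>t / \<tau>max" "0 < \<theta>" "\<theta> \<le> 1"
    and CFL: "a1 * \<Delta>t / dx M + a2 * \<Delta>t / dy M < \<theta> * \<omega>' 1 / 2"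
  shows "(\<forall>(r, s) \<in> primal_cells M.
            cell_avg M UC r s + \<Delta>t *\<^sub>R Lnew p M N \<xi> \<omega> \<tau>max UC UD r s \<in> admissible) \<and>
         (\<forall>(r, s) \<in> dual_cells M.
            cell_avg M UD r s + \<Delta>t *\<^sub>R Lnew p M N \<xi> \<omega> \<tau>max UD UC r s \<in> admissible)"
proof -
  have M: "dx M > 0" "dy M > 0" using mesh by (simp_all add: valid_mesh_def)
  \<comment> \<open>The ceiling gives 2 L - 3 >= k, so the Lobatto rule is exact for the polynomials
    used, and L >= 2 because k + 3 >= 3.\<close>
  have "real L \<ge> (real k + 3) / 2" unfolding L_def by linarith
  then have "real (k + 3) \<le> real (2 * L)" by (simp add: field_simps)
  then have "k + 3 \<le> 2 * L" by (simp only: of_nat_le_iff)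
  then have L: "L \<ge> 2" "k \<le> 2 * L - 3" by linarith+
  have primal: "cell_avg M UC r s + \<Delta>t *\<^sub>R Lnew p M N \<xi> \<omega> \<tau>max UC UD r s \<in> admissible"
    if rs: "(r, s) \<in> primal_cells M" for r s
  proof -
    have "admissible_at_nodes M N \<xi> L \<eta> UD r s" using nodes rs by blast
    then obtain P where "central_cell M k N L \<xi> \<omega> \<eta> \<omega>' UD r s P"
      using central_cell_exists[OF M N_def L gauss lobatto UD_space[unfolded W_dual_def] primal_neighbours[OF rs]]
      by blast
    then interpret central_cell M k N L \<xi> \<omega> \<eta> \<omega>' UD r s P .
    show ?thesis
      using UC_avg rs wave_speed1_bounds(1,2)[OF a1 rs] wave_speed2_bounds(1,2)[OF a2 rs] node_in_nodes
      by (intro update_admissible[OF _ _ _ _ _ tau theta CFL]) auto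
  qed
  have dual: "cell_avg M UD r s + \<Delta>t *\<^sub>R Lnew p M N \<xi> \<omega> \<tau>max UD UC r s \<in> admissible"
    if rs: "(r, s) \<in> dual_cells M" for r s
  proof -
    have "admissible_at_nodes M N \<xi> L \<eta> UC r s" using nodes rs by blast
    then obtain P where "central_cell M k N L \<xi> \<omega> \<eta> \<omega>' UC r s P"
      using central_cell_exists[OF M N_def L gauss lobatto UC_space[unfolded W_primal_def] dual_neighbours[OF rs]]
      by blast
    then interpret central_cell M k N L \<xi> \<omega> \<eta> \<omega>' UC r s P .
    show ?thesis
      using UD_avg rs wave_speed1_bounds(3,4)[OF a1 rs] wave_speed2_bounds(3,4)[OF a2 rs] node_in_nodes
      by (intro update_admissible[OF _ _ _ _ _ tau theta CFL]) auto
  qed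
  show ?thesis using primal dual by blast
qed

end
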